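(* Let $\mu\subseteq\lambda$ be partitions and $r\ge 0$. Then \[ P_{\lambda/\mu}\, s_{1^r}=P_{\lambda/\mu}\, e_r=P_{\lambda/\mu}\,P_{1^r}=\sum_{\lambda^+,\mu^-}(-1)^{|\mu/\mu^-|}\,\mathrm{vs}_{\lambda^+/\lambda}(t)\,\mathrm{sk}_{\mu/\mu^-}(t)\,P_{\lambda^+/\mu^-}, \] where the sum is over all partitions $\lambda^+\supseteq\lambda$ and $\mu^-\subseteq\mu$ with $|\lambda^+/\lambda|+|\mu/\mu^-|=r$.
   Context: $\Lambda[t]$ is the ring of symmetric functions over $\mathbb{Q}(t)$; $s_\lambda$ are Schur functions, $e_r$ the elementary symmetric functions, $P_\lambda=P_\lambda(t)$ the Hall--Littlewood functions. Let $Q_\lambda=b_\lambda(t)P_\lambda$ with $b_\lambda(t)=\prod_{i\ge1}(1-t)(1-t^2)\cdots(1-t^{m_i(\lambda)})$, and let $\langle\cdot,\cdot\rangle$ be the (extended Hall) scalar product on $\Lambda[t]$ with $\langle P_\lambda,Q_\mu\rangle=\delta_{\lambda\mu}$. For $\mu\subseteq\lambda$ the skew Hall--Littlewood function $P_{\lambda/\mu}$ is the unique element with $\langle P_{\lambda/\mu},Q_\nu\rangle=\langle P_\lambda,Q_\nu Q_\mu\rangle$ for all partitions $\nu$. Notation: $\lambda^c$ is the conjugate partition, $m_j(\lambda)$ the number of parts equal to $j$, $|\lambda/\mu|=|\lambda|-|\mu|$, and $\begin{bmatrix} a\\ b\end{bmatrix}_t=\frac{(1-t^a)\cdots(1-t^{a-b+1})}{(1-t^b)\cdots(1-t)}$.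 The skew shape $\lambda/\mu$ is a vertical strip if $\lambda_i\le\mu_i+1$ for all $i$. Define $\mathrm{vs}_{\lambda/\mu}(t)=\prod_{j\ge1}\begin{bmatrix}\lambda^c_j-\lambda^c_{j+1}\\ \lambda^c_j-\mu^c_j\end{bmatrix}_t$ if $\lambda/\mu$ is a vertical strip and $\mathrm{vs}_{\lambda/\mu}(t)=0$ otherwise. For any $\mu\subseteq\lambda$ define $\mathrm{sk}_{\lambda/\mu}(t)=t^{\sum_j\binom{\lambda^c_j-\mu^c_j}{2}}\prod_{j\ge1}\begin{bmatrix}\lambda^c_j-\mu^c_{j+1}\\ m_j(\mu)\end{bmatrix}_t$. *)

theory Defs
  imports "HOL-Library.Poly_Mapping" "HOL-Computational_Algebra.Polynomial"
    "HOL-Computational_Algebra.Fraction_Field" "HOL-Combinatorics.Permutations"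
begin

type_synonym qt = "rat poly fract"

definition tt :: qt where "tt = Fract [:0, 1:] 1"

text \<open>Lambda[t] = Q(t)[p_1,p_2,...]: polynomials in the power sums; the variable k
  stands for the power sum p_(k+1).  A monomial alpha (multiplicity vector) stands
  for p_rho where rho has Poly_Mapping.lookup alpha k parts equal to k+1.\<close>
type_synonym sym = "(nat \<Rightarrow>\<^sub>0 nat) \<Rightarrow>\<^sub>0 qt"

definition smul :: "qt \<Rightarrow> sym \<Rightarrow> sym" where
  "smul c f = Poly_Mapping.map (\<lambda>v. c * v) f"

definition ev :: "nat \<Rightarrow> sym \<Rightarrow> (nat \<Rightarrow> qt) \<Rightarrow> qt" where
  "ev n f x = (\<Sum>m\<in>Poly_Mapping.keys f. Poly_Mapping.lookup f m *
      (\<Prod>k\<in>Poly_Mapping.keys m. (\<Sum>i<n. x i ^ (k+1)) ^ Poly_Mapping.lookup m k))"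

definition is_partition :: "nat list \<Rightarrow> bool" where
  "is_partition xs \<longleftrightarrow> sorted_wrt (\<ge>) xs \<and> (\<forall>x\<in>set xs. 0 < x)"

definition part :: "nat list \<Rightarrow> nat \<Rightarrow> nat" where
  "part la i = (if i < length la then la ! i else 0)"

definition subpart :: "nat list \<Rightarrow> nat list \<Rightarrow> bool" where
  "subpart mu la \<longleftrightarrow> (\<forall>i. part mu i \<le> part la i)"

definition psize :: "nat list \<Rightarrow> nat" where "psize la = sum_list la"

definition conj :: "nat list \<Rightarrow> nat \<Rightarrow> nat" where
  "conj la j = card {i. i < length la \<and> j \<le> la ! i}"

definition mult :: "nat list \<Rightarrow> nat \<Rightarrow> nat" where
  "mult la j = count_list la j"

definition qbinom :: "nat \<Rightarrow> nat \<Rightarrow> qt" where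
  "qbinom a b = (\<Prod>i<b. 1 - tt ^ (a - i)) / (\<Prod>i\<in>{1..b}. 1 - tt ^ i)"

definition vertical_strip :: "nat list \<Rightarrow> nat list \<Rightarrow> bool" where
  "vertical_strip la mu \<longleftrightarrow> subpart mu la \<and> (\<forall>i. part la i \<le> part mu i + 1)"

text \<open>vs la mu = vs_{la/mu}(t); products over j >= 1 are finite (factors are 1 for j > la_1).\<close>
definition vs :: "nat list \<Rightarrow> nat list \<Rightarrow> qt" where
  "vs la mu = (if vertical_strip la mu then
     (\<Prod>j\<in>{1..part la 0}. qbinom (conj la j - conj la (j+1)) (conj la j - conj mu j))
   else 0)"

definition sk :: "nat list \<Rightarrow> nat list \<Rightarrow> qt" where
  "sk la mu = tt ^ (\<Sum>j\<in>{1..part la 0}. (conj la j - conj mu j) choose 2) *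
     (\<Prod>j\<in>{1..part la 0}. qbinom (conj la j - conj mu (j+1)) (mult mu j))"

definition elem_n :: "nat \<Rightarrow> nat \<Rightarrow> (nat \<Rightarrow> qt) \<Rightarrow> qt" where
  "elem_n r n x = (\<Sum>S | S \<subseteq> {..<n} \<and> card S = r. \<Prod>i\<in>S. x i)"

definition elem :: "nat \<Rightarrow> sym" where
  "elem r = (THE f. \<forall>n x. ev n f x = elem_n r n x)"

definition alt :: "nat \<Rightarrow> (nat \<Rightarrow> nat) \<Rightarrow> (nat \<Rightarrow> qt) \<Rightarrow> qt" where
  "alt n \<alpha> x = (\<Sum>w | w permutes {..<n}. of_int (sign w) * (\<Prod>i<n. x (w i) ^ \<alpha> i))"

definition schur_n :: "nat list \<Rightarrow> nat \<Rightarrow> (nat \<Rightarrow> qt) \<Rightarrow> qt" where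
  "schur_n la n x = (if length la \<le> n then
      alt n (\<lambda>i. part la i + (n - 1 - i)) x / alt n (\<lambda>i. n - 1 - i) x else 0)"

definition schur :: "nat list \<Rightarrow> sym" where
  "schur la = (THE f. \<forall>n x. inj_on x {..<n} \<longrightarrow> ev n f x = schur_n la n x)"

definition vfac :: "nat \<Rightarrow> qt" where
  "vfac m = (\<Prod>i\<in>{1..m}. (1 - tt ^ i) / (1 - tt))"

text \<open>v_la(t) in n variables: m_0 = n - length la.\<close>
definition vla :: "nat list \<Rightarrow> nat \<Rightarrow> qt" where
  "vla la n = vfac (n - length la) * (\<Prod>j\<in>{1..part la 0}. vfac (mult la j))"

text \<open>Macdonald's definition: P_la(x_1..x_n;t) =
  1/v_la(t) * sum_w w(x^la prod_{i<j} (x_i - t x_j)/(x_i - x_j)), and 0 if length la > n.\<close>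
definition HL_n :: "nat list \<Rightarrow> nat \<Rightarrow> (nat \<Rightarrow> qt) \<Rightarrow> qt" where
  "HL_n la n x = (if length la \<le> n then
      (1 / vla la n) * (\<Sum>w | w permutes {..<n}.
         (\<Prod>i<n. x (w i) ^ part la i) *
         (\<Prod>i<n. \<Prod>j\<in>{i<..<n}. (x (w i) - tt * x (w j)) / (x (w i) - x (w j))))
    else 0)"

definition HLP :: "nat list \<Rightarrow> sym" where
  "HLP la = (THE f. \<forall>n x. inj_on x {..<n} \<longrightarrow> ev n f x = HL_n la n x)"

definition bfun :: "nat list \<Rightarrow> qt" where
  "bfun la = (\<Prod>j\<in>{1..part la 0}. \<Prod>i\<in>{1..mult la j}. 1 - tt ^ i)"

definition HLQ :: "nat list \<Rightarrow> sym" where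
  "HLQ la = smul (bfun la) (HLP la)"

text \<open>z_rho(t) = z_rho * prod_i (1 - t^(rho_i))^(-1); <p_rho, p_sigma> = delta z_rho(t).\<close>
definition zt :: "(nat \<Rightarrow>\<^sub>0 nat) \<Rightarrow> qt" where
  "zt \<alpha> = (\<Prod>k\<in>Poly_Mapping.keys \<alpha>. of_nat ((k+1) ^ Poly_Mapping.lookup \<alpha> k * fact (Poly_Mapping.lookup \<alpha> k))
                        / (1 - tt ^ (k+1)) ^ Poly_Mapping.lookup \<alpha> k)"

definition hall :: "sym \<Rightarrow> sym \<Rightarrow> qt" where
  "hall f g = (\<Sum>\<alpha>\<in>Poly_Mapping.keys f. Poly_Mapping.lookup f \<alpha> * Poly_Mapping.lookup g \<alpha> * zt \<alpha>)"

definition skewP :: "nat list \<Rightarrow> nat list \<Rightarrow> sym" where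
  "skewP la mu = (THE f. \<forall>nu. is_partition nu \<longrightarrow>
      hall f (HLQ nu) = hall (HLP la) (HLQ nu * HLQ mu))"

end

theory Submission
  imports Defs "HOL-Computational_Algebra.Formal_Power_Series"
begin

text \<open>
  Write $f^\perp$ for the adjoint of multiplication by $f$. The $Q_\nu$ span $\Lambda[t]$, because
  their span is stable under multiplication by all $e_r$; hence $P_{\lambda/\mu} = Q_\mu^\perp P_\lambda$.
  Since $\sum_r e_r$ is group-like with inverse $\sum_r (-1)^r h_r$,
  \[ e_r \cdot f^\perp g = \sum_k (-1)^k (h_k^\perp f)^\perp (e_{r-k}\, g), \]
  so the theorem follows from the two rules
  $e_r P_\lambda = \sum \mathrm{vs}_{\lambda^+/\lambda} P_{\lambda^+}$ and
  $h_k^\perp Q_\mu = \sum \mathrm{sk}_{\mu/\mu^-} Q_{\mu^-}$.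
  Both come from $Q_\lambda = H_{\lambda_1} H_{\lambda_2} \cdots 1$ for the Jing operators $H_m$,
  the coefficients of $f \mapsto Q(u) f[X - 1/u]$. These satisfy $H_m H_{m+1} = t H_{m+1} H_m$ and
  \[ e_r H_m = H_m e_r + H_{m+1} e_{r-1}, \qquad h_r^\perp H_m = H_m h_r^\perp + h_{r-1}^\perp H_{m-1}, \]
  so moving $e_r$ or $h_r^\perp$ through $H_{\lambda_1} H_{\lambda_2} \cdots$ produces $q$-binomial
  coefficients by Pascal's rule.
  That the iterated Jing operators give the symmetrizations which define Hall-Littlewood functions
  is checked on finite alphabets $A$, where
  $H_m f(A) = (1-t) \sum_{a \in A} a^m \prod_{b \neq a} \frac{a - tb}{a - b}\, f(A - a)$ for $m > 0$.
\<close>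

section \<open>The scalar product and adjoints of multiplication\<close>

text \<open>The power sums generate the ring, so every operator is controlled by its commutators
  with the p_n and their adjoints. The families e, h, q are coefficients of exponentials of sum c_n
  p_n u^n / n. The adjoint of such an exponential is the substitution p_n -> p_n + c_n u^n / (1 -
  t^n), a ring homomorphism. For q, c_n = 1 - t^n cancels the denominator created by the deformed
  scalar product: the adjoint of q adjoins the letter u to the alphabet, and the inverse series
  deletes it. This explains the shape of the Jing operators, and it is also why a function vanishing
  on all finite alphabets must be zero. The commutators of p_n and of its adjoint with H_m are
  multiples of a single Jing operator, free of t; hence the simple rules for e_r and h_r. Powers of
  t enter when words in Jing operators are put back into order. Since e_r is applied to P but the
  adjoint of h_k to Q, only the first rule has to be renormalized by the b_la.\<close>

lemma smul_conv: "smul c f = Poly_Mapping.single 0 c * f"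
  unfolding smul_def by (rule mult_map_scale_conv_mult)

lemma lookup_smul [simp]: "Poly_Mapping.lookup (smul c f) m = c * Poly_Mapping.lookup f m"
  unfolding smul_def by (simp add: Poly_Mapping.map.rep_eq when_def)

interpretation sym: vector_space smul
  by unfold_locales (auto intro!: poly_mapping_eqI simp: lookup_add algebra_simps)

lemma smul_mult_left: "smul c f * g = smul c (f * g)"
  by (simp add: smul_conv mult.assoc)

lemma smul_mult_right: "f * smul c g = smul c (f * g)"
  by (simp add: smul_conv mult.left_commute)

lemmas smul_simps = smul_mult_left smul_mult_right sym.scale_right_distrib sym.scale_left_distrib
  sym.scale_right_diff_distrib sym.scale_left_diff_distrib

lemma smul_of_nat: "smul (of_nat n) f = of_nat n * f"
  by (simp add: smul_conv)

definition psum :: "nat \<Rightarrow> sym" where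
  "psum k = Poly_Mapping.single (Poly_Mapping.single k 1) 1"

lemma single_conv_smul: "Poly_Mapping.single m c = smul c (Poly_Mapping.single m 1)"
  by (simp add: smul_conv mult_single)

text \<open>The power sums generate the ring over Q(t), so a linear property can be checked by
  multiplying with one power sum at a time; the total exponent of a monomial is the measure. Most
  operator identities below are proved with this rule.\<close>

lemma sym_induct [case_names one add smul psum]:
  assumes one: "P 1"
    and add: "\<And>f g. P f \<Longrightarrow> P g \<Longrightarrow> P (f + g)"
    and smul: "\<And>c f. P f \<Longrightarrow> P (smul c f)"
    and psum: "\<And>k f. P f \<Longrightarrow> P (psum k * f)"
  shows "P (f :: sym)"
proof -
  have mono: "P (Poly_Mapping.single m 1)" for m
  proof (induction "\<Sum>k\<in>Poly_Mapping.keys m. Poly_Mapping.lookup m k" arbitrary: m)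
    case 0
    then have "m = 0" by (auto simp: in_keys_iff intro!: poly_mapping_eqI)
    then show ?case using one by simp
  next
    case (Suc n)
    then have "Poly_Mapping.keys m \<noteq> {}" by force
    then obtain k where k: "k \<in> Poly_Mapping.keys m" by blast
    define m' where "m' = m - Poly_Mapping.single k 1"
    have pos: "Poly_Mapping.lookup m k > 0" using k by (simp add: in_keys_iff)
    have m: "m = Poly_Mapping.single k 1 + m'"
      using pos by (auto intro!: poly_mapping_eqI simp: m'_def lookup_add lookup_minus lookup_single when_def)
    have sub: "Poly_Mapping.keys m' \<subseteq> Poly_Mapping.keys m"
      by (auto simp: m'_def in_keys_iff lookup_minus)
    have "(\<Sum>k\<in>Poly_Mapping.keys m'. Poly_Mapping.lookup m' k) = (\<Sum>k\<in>Poly_Mapping.keys m. Poly_Mapping.lookup m' k)"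
      by (rule sum.mono_neutral_left) (use sub in \<open>auto simp: in_keys_iff\<close>)
    moreover have "(\<Sum>k\<in>Poly_Mapping.keys m. Poly_Mapping.lookup m k) = (\<Sum>k\<in>Poly_Mapping.keys m. Poly_Mapping.lookup m' k) + 1"
    proof -
      have "(\<Sum>j\<in>Poly_Mapping.keys m. Poly_Mapping.lookup m j) =
         (\<Sum>j\<in>Poly_Mapping.keys m. Poly_Mapping.lookup m' j + (if j = k then 1 else 0))"
        by (rule sum.cong[OF refl]) (use pos in \<open>auto simp: m'_def lookup_minus lookup_single\<close>)
      then show ?thesis using k by (simp add: sum.distrib)
    qed
    ultimately have "n = (\<Sum>k\<in>Poly_Mapping.keys m'. Poly_Mapping.lookup m' k)"
      using Suc(2) by simp
    from Suc(1)[OF this] have "P (psum k * Poly_Mapping.single m' 1)" by (rule psum)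
    then have "P (Poly_Mapping.single (Poly_Mapping.single k 1 + m') 1)" by (simp add: psum_def mult_single)
    then show ?case using m by simp
  qed
  have "f = (\<Sum>m\<in>Poly_Mapping.keys f. Poly_Mapping.single m (Poly_Mapping.lookup f m))"
    by (rule poly_mapping_eqI) (simp add: lookup_sum lookup_single when_def in_keys_iff)
  moreover have "P (\<Sum>m\<in>A. Poly_Mapping.single m (Poly_Mapping.lookup f m))" if "finite A" for A
    using that
  proof induction
    case empty
    have "P (smul 0 1)" by (rule smul[OF one])
    then show ?case by (simp only: sum.empty sym.scale_zero_left)
  next
    case (insert x A)
    have "P (Poly_Mapping.single x (Poly_Mapping.lookup f x))"
      by (subst single_conv_smul) (rule smul[OF mono])
    with insert show ?case by (simp add: add)
  qed
  ultimately show ?thesis by (metis finite_keys)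
qed

lemma lookup_psum_mult: "Poly_Mapping.lookup (psum k * f) m =
  (if Poly_Mapping.lookup m k = 0 then 0 else Poly_Mapping.lookup f (m - Poly_Mapping.single k 1))"
proof -
  have *: "m = Poly_Mapping.single k 1 + q \<longleftrightarrow> Poly_Mapping.lookup m k \<noteq> 0 \<and> q = m - Poly_Mapping.single k 1" for q
  proof
    assume "m = Poly_Mapping.single k 1 + q"
    then show "Poly_Mapping.lookup m k \<noteq> 0 \<and> q = m - Poly_Mapping.single k 1"
      by (auto simp: lookup_add lookup_single)
  next
    assume "Poly_Mapping.lookup m k \<noteq> 0 \<and> q = m - Poly_Mapping.single k 1"
    then show "m = Poly_Mapping.single k 1 + q"
      by (auto intro!: poly_mapping_eqI simp: lookup_add lookup_minus lookup_single when_def)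
  qed
  have "Poly_Mapping.lookup (psum k * f) m =
     Sum_any (\<lambda>l. (1 when Poly_Mapping.single k 1 = l) * Sum_any (\<lambda>q. Poly_Mapping.lookup f q when m = l + q))"
    by (simp add: lookup_mult psum_def lookup_single)
  also have "\<dots> = Sum_any (\<lambda>q. Poly_Mapping.lookup f q when m = Poly_Mapping.single k 1 + q)"
    by (simp add: when_mult)
  also have "\<dots> = (if Poly_Mapping.lookup m k = 0 then 0 else Poly_Mapping.lookup f (m - Poly_Mapping.single k 1))"
    unfolding * by (simp add: when_def)
  finally show ?thesis .
qed

lemma lookup_one_sym: "Poly_Mapping.lookup 1 (m::nat \<Rightarrow>\<^sub>0 nat) = (if m = 0 then 1 else (0::qt))"
  by (simp add: lookup_one when_def)

section \<open>Non-vanishing of 1 - t^n and norms of power-sum monomials\<close>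

lemma tt_power: "tt ^ n = Fract (monom 1 n) 1"
  unfolding tt_def
  by (induction n) (simp_all add: One_fract_def monom_Suc)

lemma tt_power_neq_1: "n > 0 \<Longrightarrow> tt ^ n \<noteq> 1"
  unfolding tt_power One_fract_def by (auto simp: eq_fract monom_eq_1_iff)

lemma one_minus_tt_power [simp]: "n > 0 \<Longrightarrow> 1 - tt ^ n \<noteq> 0"
  using tt_power_neq_1[of n] by auto

lemma one_minus_tt [simp]: "1 - tt \<noteq> 0" "tt \<noteq> 1" "1 \<noteq> tt"
  using tt_power_neq_1[of 1] by auto

lemma tt_neq_0 [simp]: "tt \<noteq> 0"
  unfolding tt_def Zero_fract_def by (auto simp: eq_fract)

text \<open>The squared norm of the power sum p_n, where n = k + 1.\<close>

definition zn :: "nat \<Rightarrow> qt" where "zn k = of_nat (Suc k) / (1 - tt ^ Suc k)"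

lemma of_nat_Suc_qt [simp]: "(1 + of_nat k :: qt) \<noteq> 0" "(of_nat k + 1 :: qt) \<noteq> 0"
  using of_nat_neq_0[of k, where ?'a = qt] by (simp_all add: add.commute)

lemma zn_neq_0 [simp]: "zn k \<noteq> 0"
  unfolding zn_def using one_minus_tt_power[of "Suc k"] by simp

text \<open>A product over \<open>keys\<close> changes its range with the monomial. Enlarging the
  range to a common finite set, as also in \<open>hall_conv\<close>, \<open>monval_conv\<close> and
  \<open>evp_conv\<close>, makes two of them comparable factor by factor.\<close>

lemma zt_conv: "finite A \<Longrightarrow> Poly_Mapping.keys m \<subseteq> A \<Longrightarrow>
  zt m = (\<Prod>k\<in>A. fact (Poly_Mapping.lookup m k) * zn k ^ Poly_Mapping.lookup m k)"
  unfolding zt_def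
  by (rule prod.mono_neutral_cong_left)
     (auto simp: in_keys_iff zn_def power_divide)

lemma zt_neq_0 [simp]: "zt m \<noteq> 0"
  by (subst zt_conv[of "Poly_Mapping.keys m"]) auto

lemma zt_0 [simp]: "zt 0 = 1"
  by (simp add: zt_def)

lemma zt_add_single: "zt (m + Poly_Mapping.single k 1) = zt m * (of_nat (Suc (Poly_Mapping.lookup m k)) * zn k)"
proof -
  define A where "A = insert k (Poly_Mapping.keys m)"
  have "zt (m + Poly_Mapping.single k 1) =
    (\<Prod>i\<in>A. fact (Poly_Mapping.lookup (m + Poly_Mapping.single k 1) i) * zn i ^ Poly_Mapping.lookup (m + Poly_Mapping.single k 1) i)"
    by (rule zt_conv) (auto simp: A_def in_keys_iff lookup_add lookup_single when_def split: if_splits)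
  also have "\<dots> = (\<Prod>i\<in>A. (fact (Poly_Mapping.lookup m i) * zn i ^ Poly_Mapping.lookup m i) *
     (if i = k then of_nat (Suc (Poly_Mapping.lookup m k)) * zn k else 1))"
    by (intro prod.cong) (auto simp: lookup_add lookup_single when_def algebra_simps)
  also have "\<dots> = zt m * (of_nat (Suc (Poly_Mapping.lookup m k)) * zn k)"
    by (subst prod.distrib) (simp add: zt_conv[of A m] A_def subset_insertI)
  finally show ?thesis .
qed

lemma hall_conv: "finite A \<Longrightarrow> Poly_Mapping.keys f \<subseteq> A \<Longrightarrow>
   hall f g = (\<Sum>m\<in>A. Poly_Mapping.lookup f m * Poly_Mapping.lookup g m * zt m)"
  unfolding hall_def by (rule sum.mono_neutral_left) (auto simp: in_keys_iff)

lemma hall_sym: "hall f g = hall g f"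
proof -
  have "hall f g = (\<Sum>m\<in>Poly_Mapping.keys f \<union> Poly_Mapping.keys g. Poly_Mapping.lookup f m * Poly_Mapping.lookup g m * zt m)"
    by (rule hall_conv) auto
  moreover have "hall g f = (\<Sum>m\<in>Poly_Mapping.keys f \<union> Poly_Mapping.keys g. Poly_Mapping.lookup g m * Poly_Mapping.lookup f m * zt m)"
    by (rule hall_conv) auto
  ultimately show ?thesis by (simp add: mult_ac)
qed

lemma hall_add_right: "hall f (g + h) = hall f g + hall f h"
  by (simp add: hall_def lookup_add algebra_simps sum.distrib)

lemma hall_smul_right: "hall f (smul c g) = c * hall f g"
  by (simp add: hall_def sum_distrib_left mult_ac)

lemma hall_add_left: "hall (f + g) h = hall f h + hall g h"
  by (simp add: hall_sym[of _ h] hall_add_right)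

lemma hall_smul_left: "hall (smul c f) h = c * hall f h"
  by (simp add: hall_sym[of _ h] hall_smul_right)

lemma hall_zero [simp]: "hall f 0 = 0" "hall 0 f = 0"
  by (simp_all add: hall_def)

lemma hall_minus: "hall (- f) g = - hall f g" "hall f (- g) = - hall f g"
  using hall_smul_left[of "-1" f g] hall_smul_right[of f "-1" g] by simp_all

lemma hall_diff: "hall (f - f') g = hall f g - hall f' g" "hall f (g - g') = hall f g - hall f g'"
  using hall_add_left[of f "- f'" g] hall_add_right[of f g "- g'"] by (simp_all add: hall_minus)

lemma hall_sum_left: "hall (\<Sum>i\<in>A. f i) g = (\<Sum>i\<in>A. hall (f i) g)"
  by (induction A rule: infinite_finite_induct) (simp_all add: hall_add_left)

lemma hall_sum_right: "hall g (\<Sum>i\<in>A. f i) = (\<Sum>i\<in>A. hall g (f i))"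
  by (induction A rule: infinite_finite_induct) (simp_all add: hall_add_right)

lemma hall_one: "hall 1 f = Poly_Mapping.lookup f 0"
  by (subst hall_conv[of "{0}"]) (auto simp: lookup_one_sym)

lemma hall_single_left: "hall (Poly_Mapping.single m 1) f = Poly_Mapping.lookup f m * zt m"
  by (subst hall_conv[of "{m}"]) auto

text \<open>Non-degeneracy: distinct power-sum monomials are orthogonal and \<open>zt m\<close> is
  nonzero, so pairing with a monomial reads off a coefficient.\<close>

lemma hall_eqI: "(\<And>h. hall f h = hall g h) \<Longrightarrow> f = g"
proof (rule poly_mapping_eqI)
  fix m assume "\<And>h. hall f h = hall g h"
  then have "hall (Poly_Mapping.single m 1) f = hall (Poly_Mapping.single m 1) g"
    by (simp add: hall_sym[of "Poly_Mapping.single m 1"])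
  then show "Poly_Mapping.lookup f m = Poly_Mapping.lookup g m"
    by (simp add: hall_single_left)
qed

text \<open>This is $n/(1-t^n)$ times the derivative by $p_n$, where $n = k + 1$.\<close>
definition pd :: "nat \<Rightarrow> sym \<Rightarrow> sym" where
  "pd k g = Abs_poly_mapping (\<lambda>m. Poly_Mapping.lookup g (m + Poly_Mapping.single k 1)
      * (of_nat (Suc (Poly_Mapping.lookup m k)) * zn k))"

lemma lookup_pd: "Poly_Mapping.lookup (pd k g) m =
   Poly_Mapping.lookup g (m + Poly_Mapping.single k 1) * (of_nat (Suc (Poly_Mapping.lookup m k)) * zn k)"
proof -
  \<comment> \<open>The support lies in the preimage of the finite support of \<open>g\<close> under
    an injective shift.\<close>
  have "finite ((\<lambda>m. m + Poly_Mapping.single k 1) -` Poly_Mapping.keys g)"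
    by (rule finite_vimageI) (auto simp: inj_on_def)
  then have "finite {m. Poly_Mapping.lookup g (m + Poly_Mapping.single k 1) * (of_nat (Suc (Poly_Mapping.lookup m k)) * zn k) \<noteq> 0}"
    by (rule finite_subset[rotated]) (auto simp: in_keys_iff)
  then show ?thesis unfolding pd_def by (subst lookup_Abs_poly_mapping) auto
qed

lemma hall_psum: "hall (psum k * f) g = hall f (pd k g)"
proof -
  let ?s = "\<lambda>m. m + Poly_Mapping.single k (1::nat)"
  have sub: "Poly_Mapping.keys (psum k * f) \<subseteq> ?s ` Poly_Mapping.keys f"
  proof
    fix m assume "m \<in> Poly_Mapping.keys (psum k * f)"
    then have *: "Poly_Mapping.lookup m k \<noteq> 0" "m - Poly_Mapping.single k 1 \<in> Poly_Mapping.keys f"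
      by (auto simp: in_keys_iff lookup_psum_mult split: if_splits)
    moreover have "m = ?s (m - Poly_Mapping.single k 1)"
      using * by (auto intro!: poly_mapping_eqI simp: lookup_add lookup_minus lookup_single when_def)
    ultimately show "m \<in> ?s ` Poly_Mapping.keys f" by blast
  qed
  have "hall (psum k * f) g = (\<Sum>m\<in>?s ` Poly_Mapping.keys f. Poly_Mapping.lookup (psum k * f) m * Poly_Mapping.lookup g m * zt m)"
    by (rule hall_conv) (use sub in auto)
  also have "\<dots> = (\<Sum>m\<in>Poly_Mapping.keys f. Poly_Mapping.lookup (psum k * f) (?s m) * Poly_Mapping.lookup g (?s m) * zt (?s m))"
    by (subst sum.reindex) (auto simp: inj_on_def)
  also have "\<dots> = hall f (pd k g)"
    unfolding hall_def
    by (intro sum.cong refl) (simp add: lookup_psum_mult lookup_add lookup_pd zt_add_single[unfolded One_nat_def])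
  finally show ?thesis .
qed

lemma pd_add: "pd k (f + g) = pd k f + pd k g"
  by (rule poly_mapping_eqI) (simp add: lookup_pd lookup_add algebra_simps)

lemma pd_smul: "pd k (smul c f) = smul c (pd k f)"
  by (rule poly_mapping_eqI) (simp add: lookup_pd)

lemma pd_one [simp]: "pd k 1 = 0"
proof (rule poly_mapping_eqI)
  fix m :: "nat \<Rightarrow>\<^sub>0 nat"
  have "m + Poly_Mapping.single k 1 \<noteq> 0"
    by (auto simp: poly_mapping_eq_iff fun_eq_iff lookup_add lookup_single intro!: exI[of _ k])
  then show "Poly_Mapping.lookup (pd k 1) m = Poly_Mapping.lookup 0 m"
    by (simp add: lookup_pd lookup_one_sym)
qed

text \<open>Heisenberg relation: up to a constant \<open>pd k\<close> is the derivative by one power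
  sum, so the product rule holds, and \<open>zn n\<close> is the value of \<open>pd n\<close> on
  \<open>psum n\<close>.\<close>

lemma pd_psum: "pd k (psum n * f) = psum n * pd k f + (if k = n then smul (zn n) f else 0)"
proof (rule poly_mapping_eqI)
  fix m
  show "Poly_Mapping.lookup (pd k (psum n * f)) m =
    Poly_Mapping.lookup (psum n * pd k f + (if k = n then smul (zn n) f else 0)) m"
  proof (cases "k = n")
    case False
    then have "m + Poly_Mapping.single k (Suc 0) - Poly_Mapping.single n (Suc 0) = m - Poly_Mapping.single n (Suc 0) + Poly_Mapping.single k (Suc 0)"
      if "Poly_Mapping.lookup m n \<noteq> 0"
      using that by (auto intro!: poly_mapping_eqI simp: lookup_add lookup_minus lookup_single when_def)
    with False show ?thesis
      by (simp add: lookup_pd lookup_psum_mult lookup_add lookup_single lookup_minus)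
  next
    case True
    have *: "Poly_Mapping.lookup m n \<noteq> 0 \<Longrightarrow> m - Poly_Mapping.single n (Suc 0) + Poly_Mapping.single n (Suc 0) = m"
      by (auto intro!: poly_mapping_eqI simp: lookup_add lookup_minus lookup_single when_def)
    have l: "Poly_Mapping.lookup (pd k (psum n * f)) m = Poly_Mapping.lookup f m * (of_nat (Suc (Poly_Mapping.lookup m n)) * zn n)"
      unfolding True lookup_pd lookup_psum_mult by (simp add: lookup_add)
    show ?thesis
    proof (cases "Poly_Mapping.lookup m n = 0")
      case 0: True
      then show ?thesis unfolding l using True by (simp add: lookup_add lookup_psum_mult)
    next
      case False
      then obtain d where d: "Poly_Mapping.lookup m n = Suc d" by (cases "Poly_Mapping.lookup m n") auto
      have "Poly_Mapping.lookup (psum n * pd k f) m = Poly_Mapping.lookup f m * (of_nat (Suc d) * zn n)"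
        unfolding lookup_psum_mult lookup_pd using True False by (simp add: * d lookup_minus)
      then show ?thesis unfolding l using True by (simp add: lookup_add d algebra_simps)
    qed
  qed
qed

section \<open>Adjoints of multiplication operators\<close>

definition perp :: "sym \<Rightarrow> sym \<Rightarrow> sym" where
  "perp f g = (THE u. \<forall>h. hall u h = hall g (f * h))"

text \<open>In infinite dimension an adjoint need not exist. Here multiplication by
  \<open>psum k\<close> has the adjoint \<open>pd k\<close>, and adjoints can be added, scaled and
  composed, which reaches every \<open>f\<close>.\<close>

lemma perp_ex: "\<exists>u. \<forall>h. hall u h = hall g (f * h)"
proof (induction f arbitrary: g rule: sym_induct)
  case one
  show ?case by (rule exI[of _ g]) simp
next
  case (add f1 f2)
  then obtain u1 u2 where "\<forall>h. hall u1 h = hall g (f1 * h)" "\<forall>h. hall u2 h = hall g (f2 * h)" by blast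
  then show ?case by (intro exI[of _ "u1 + u2"]) (simp add: hall_add_left hall_add_right ring_distribs)
next
  case (smul c f)
  then obtain u where "\<forall>h. hall u h = hall g (f * h)" by blast
  then show ?case by (intro exI[of _ "smul c u"]) (simp add: hall_smul_left hall_smul_right smul_mult_left)
next
  case (psum k f)
  then obtain u where "\<forall>h. hall u h = hall (pd k g) (f * h)" by blast
  then show ?case
    by (intro exI[of _ u]) (simp add: hall_sym[of g] hall_psum mult.assoc hall_sym[of "f * _"])
qed

lemma hall_perp: "hall (perp f g) h = hall g (f * h)"
proof -
  have "\<exists>!u. \<forall>h. hall u h = hall g (f * h)"
    using perp_ex[of g f] hall_eqI by (metis)
  from theI'[OF this] show ?thesis unfolding perp_def by blast
qed

lemma hall_perp_right: "hall h (perp f g) = hall (f * h) g"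
  using hall_perp[of f g h] by (simp add: hall_sym)

lemma perp_eqI: "(\<And>h. hall u h = hall g (f * h)) \<Longrightarrow> perp f g = u"
  by (rule hall_eqI) (simp add: hall_perp)

lemma perp_psum: "perp (psum k) g = pd k g"
  by (rule perp_eqI) (metis hall_psum hall_sym)

lemma perp_mult: "perp (f * g) h = perp f (perp g h)"
  by (rule perp_eqI) (simp add: hall_perp mult_ac)

lemma perp_comm: "perp f (perp g h) = perp g (perp f h)"
  by (metis perp_mult mult.commute)

lemma perp_one [simp]: "perp 1 g = g"
  by (rule perp_eqI) simp

lemma perp_add_left: "perp (f + f') g = perp f g + perp f' g"
  by (rule perp_eqI) (simp add: hall_perp hall_add_left hall_add_right ring_distribs)

lemma perp_add_right: "perp f (g + g') = perp f g + perp f g'"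
  by (rule perp_eqI) (simp add: hall_perp hall_add_left)

lemma perp_smul_left: "perp (smul c f) g = smul c (perp f g)"
  by (rule perp_eqI) (simp add: hall_perp hall_smul_left hall_smul_right smul_mult_left)

lemma perp_smul_right: "perp f (smul c g) = smul c (perp f g)"
  by (rule perp_eqI) (simp add: hall_perp hall_smul_left)

lemma perp_zero [simp]: "perp 0 g = 0" "perp f 0 = 0"
  by (rule perp_eqI, simp)+

lemma perp_sum_left: "perp (\<Sum>i\<in>A. f i) g = (\<Sum>i\<in>A. perp (f i) g)"
  by (induction A rule: infinite_finite_induct) (simp_all add: perp_add_left)

lemma perp_sum_right: "perp f (\<Sum>i\<in>A. g i) = (\<Sum>i\<in>A. perp f (g i))"
  by (induction A rule: infinite_finite_induct) (simp_all add: perp_add_right)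

lemma perp_diff_right: "perp f (g - g') = perp f g - perp f g'"
  using perp_add_right[of f g "- g'"] perp_smul_right[of f "-1" g'] by simp

section \<open>Elements given by Newton recursions\<close>

lemma tt_mult_power_neq [simp]: "tt * tt ^ n \<noteq> 1" "1 \<noteq> tt * tt ^ n"
  using tt_power_neq_1[of "Suc n"] by auto

text \<open>Newton's identity, solved for the next term by dividing by its degree. The weights 1,
  (-1)^k and 1 - t^(k+1) give the complete functions, the elementary functions and the q_r.\<close>

fun newton :: "(nat \<Rightarrow> qt) \<Rightarrow> nat \<Rightarrow> sym" where
  "newton c 0 = 1"
| "newton c (Suc r) = smul (1 / of_nat (Suc r)) (\<Sum>k\<le>r. smul (c k) (psum k * newton c (r - k)))"

declare newton.simps [simp del]

text \<open>
  The generating function of \<open>nw c\<close> is the exponential of $\sum_k c_k p_{k+1} u^{k+1}/(k+1)$; the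
  integer index makes all elements of negative degree zero.
\<close>
definition nw :: "(nat \<Rightarrow> qt) \<Rightarrow> int \<Rightarrow> sym" where
  "nw c i = (if i < 0 then 0 else newton c (nat i))"

lemma nw_neg [simp]: "i < 0 \<Longrightarrow> nw c i = 0"
  by (simp add: nw_def)

lemma nw_0 [simp]: "nw c 0 = 1"
  by (simp add: nw_def newton.simps)

text \<open>Terms of negative index vanish, so the sum may run to any \<open>N\<close> with
  \<open>i \<le> int N\<close>. Recursions for different indices can then share one range.\<close>

lemma nw_newton:
  assumes "i \<le> int N"
  shows "smul (of_int i) (nw c i) = (\<Sum>k<N. smul (c k) (psum k * nw c (i - 1 - int k)))"
proof (cases "i > 0")
  case False
  then show ?thesis by (cases "i = 0") simp_all
next
  case True
  define r where "r = nat i - 1"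
  have i: "i = int (Suc r)" using True by (simp add: r_def)
  have "smul (of_int i) (nw c i) = (\<Sum>k\<le>r. smul (c k) (psum k * newton c (r - k)))"
    unfolding i nw_def by (simp add: newton.simps del: of_nat_Suc)
  also have "\<dots> = (\<Sum>k\<le>r. smul (c k) (psum k * nw c (i - 1 - int k)))"
    by (intro sum.cong refl) (simp add: i nw_def nat_diff_distrib)
  also have "\<dots> = (\<Sum>k<N. smul (c k) (psum k * nw c (i - 1 - int k)))"
    by (rule sum.mono_neutral_left) (use assms i in \<open>auto simp: nw_def\<close>)
  finally show ?thesis .
qed

lemma nw_induct [case_names nonpos pos]:
  assumes "\<And>i. i \<le> 0 \<Longrightarrow> P i"
    and "\<And>i N. i > 0 \<Longrightarrow> i = int N \<Longrightarrow> (\<And>j. j < i \<Longrightarrow> P j) \<Longrightarrow> P i"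
  shows "P (i :: int)"
proof (induction "nat i" arbitrary: i rule: less_induct)
  case less
  show ?case
  proof (cases "i \<le> 0")
    case True
    then show ?thesis by (rule assms(1))
  next
    case False
    show ?thesis
    proof (rule assms(2)[of i "nat i"])
      fix j assume "j < i"
      then show "P j" using less False by (cases "j \<le> 0") (auto intro: assms(1))
    qed (use False in auto)
  qed
qed

text \<open>In characteristic zero the recursion determines every term from the initial one.\<close>

lemma nw_eqI:
  assumes "\<And>i. i < 0 \<Longrightarrow> x i = 0" "x 0 = 1"
    and "\<And>i N. i = int N \<Longrightarrow> smul (of_int i) (x i) = (\<Sum>k<N. smul (c k) (psum k * x (i - 1 - int k)))"
  shows "x i = nw c i"
proof (induction i rule: nw_induct)
  case (nonpos i)
  then show ?case using assms(1,2) by (cases "i = 0") auto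
next
  case (pos i N)
  have "smul (of_int i) (x i) = smul (of_int i) (nw c i)"
    unfolding assms(3)[OF pos(2)] by (subst nw_newton[of _ N]) (use pos in \<open>auto intro!: sum.cong\<close>)
  then show ?case using pos by simp
qed

lemma nw_zero: "nw (\<lambda>_. 0) i = (if i = 0 then 1 else 0)"
  by (rule nw_eqI[symmetric]) auto

text \<open>Substituting d u for u in the exponential multiplies the weight of p_n by d^n.\<close>

lemma nw_scale: "smul (d ^ nat i) (nw c i) = nw (\<lambda>k. d ^ Suc k * c k) i"
proof (rule nw_eqI)
  fix i :: int and N assume i: "i = int N"
  have "smul (of_int i) (smul (d ^ nat i) (nw c i)) = smul (d ^ nat i) (\<Sum>k<N. smul (c k) (psum k * nw c (i - 1 - int k)))"
    by (subst nw_newton[of i N c, symmetric]) (simp_all add: i mult.commute)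
  also have "\<dots> = (\<Sum>k<N. smul (d ^ Suc k * c k) (psum k * smul (d ^ nat (i - 1 - int k)) (nw c (i - 1 - int k))))"
    unfolding sym.scale_sum_right
  proof (intro sum.cong refl)
    fix k assume k: "k \<in> {..<N}"
    then have "nat i = Suc k + nat (i - 1 - int k)" using i by auto
    then have "d ^ nat i = d ^ Suc k * d ^ nat (i - 1 - int k)" by (simp only: power_add)
    then show "smul (d ^ nat i) (smul (c k) (psum k * nw c (i - 1 - int k))) =
        smul (d ^ Suc k * c k) (psum k * smul (d ^ nat (i - 1 - int k)) (nw c (i - 1 - int k)))"
      by (simp add: smul_mult_right mult_ac)
  qed
  finally show "smul (of_int i) (smul (d ^ nat i) (nw c i)) =
    (\<Sum>k<N. smul (d ^ Suc k * c k) (psum k * smul (d ^ nat (i - 1 - int k)) (nw c (i - 1 - int k))))" .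
qed auto

definition nwf :: "(nat \<Rightarrow> qt) \<Rightarrow> sym fps" where "nwf c = Abs_fps (\<lambda>n. nw c (int n))"

lemma fps_deriv_nwf: "fps_deriv (nwf c) = Abs_fps (\<lambda>k. smul (c k) (psum k)) * nwf c"
proof (rule fps_ext)
  fix n
  have "fps_nth (fps_deriv (nwf c)) n = smul (of_int (int (Suc n))) (nw c (int (Suc n)))"
    by (simp add: nwf_def smul_of_nat del: of_nat_Suc)
  also have "\<dots> = (\<Sum>k<Suc n. smul (c k) (psum k * nw c (int (Suc n) - 1 - int k)))"
    by (rule nw_newton) simp
  also have "\<dots> = (\<Sum>k=0..n. smul (c k) (psum k) * nw c (int (n - k)))"
    by (rule sum.cong) (auto simp: smul_mult_left of_nat_diff)
  finally show "fps_nth (fps_deriv (nwf c)) n = fps_nth (Abs_fps (\<lambda>k. smul (c k) (psum k)) * nwf c) n"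
    by (simp add: fps_mult_nth nwf_def)
qed

text \<open>Exponentials multiply by adding exponents: the product solves the differential equation
  of \<open>fps_deriv_nwf\<close> for the sum of the weights, and \<open>nw_eqI\<close> gives
  uniqueness.\<close>

lemma nwf_mult: "nwf c * nwf d = nwf (\<lambda>k. c k + d k)"
proof -
  define F where "F = nwf c * nwf d"
  have dF: "fps_deriv F = Abs_fps (\<lambda>k. smul (c k + d k) (psum k)) * F"
  proof -
    have "Abs_fps (\<lambda>k. smul (c k + d k) (psum k)) = Abs_fps (\<lambda>k. smul (c k) (psum k)) + Abs_fps (\<lambda>k. smul (d k) (psum k))"
      by (rule fps_ext) (simp add: sym.scale_left_distrib)
    then show ?thesis
      by (simp add: F_def fps_deriv_nwf algebra_simps)
  qed
  define x where "x i = (if i < 0 then 0 else fps_nth F (nat i))" for i :: int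
  have "x i = nw (\<lambda>k. c k + d k) i" for i
  proof (rule nw_eqI)
    show "x 0 = 1" by (simp add: x_def F_def nwf_def)
    fix i N assume i: "i = int N"
    show "smul (of_int i) (x i) = (\<Sum>k<N. smul (c k + d k) (psum k * x (i - 1 - int k)))"
    proof (cases N)
      case (Suc n)
      have "smul (of_int i) (x i) = fps_nth (fps_deriv F) n"
        using i Suc by (simp add: x_def smul_of_nat del: of_nat_Suc)
      also have "\<dots> = (\<Sum>k=0..n. smul (c k + d k) (psum k) * fps_nth F (n - k))"
        by (simp add: dF fps_mult_nth)
      also have "\<dots> = (\<Sum>k<N. smul (c k + d k) (psum k * x (i - 1 - int k)))"
        by (rule sum.cong) (use i Suc in \<open>auto simp: smul_mult_left x_def nat_diff_distrib\<close>)
      finally show ?thesis .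
    qed (simp add: i)
  qed (simp add: x_def)
  then have "fps_nth F n = nw (\<lambda>k. c k + d k) (int n)" for n
    by (metis x_def of_nat_less_0_iff nat_int)
  then show ?thesis by (intro fps_ext) (simp add: F_def nwf_def)
qed

lemma nw_convolution: "(\<Sum>j\<le>r. nw c (int j) * nw d (int (r - j))) = nw (\<lambda>k. c k + d k) (int r)"
  using arg_cong[OF nwf_mult[of c d], of "\<lambda>F. fps_nth F r"]
  by (simp add: fps_mult_nth nwf_def atLeast0AtMost)

text \<open>With n = k + 1, the adjoint of p_n multiplies the exponential with weights
  \<open>c\<close> by \<open>gam c k\<close> u^n; the denominator comes from the scalar
  product.\<close>

definition gam :: "(nat \<Rightarrow> qt) \<Rightarrow> nat \<Rightarrow> qt" where "gam c k = c k / (1 - tt ^ Suc k)"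

lemma c_zn: "c k * zn k = of_nat (Suc k) * gam c k"
  by (simp add: gam_def zn_def)

lemma smul_of_int_cancel: "i \<noteq> (0::int) \<Longrightarrow> smul (of_int i) x = smul (of_int i) y \<Longrightarrow> x = y"
  by simp

lemma pd_sum: "pd k (\<Sum>i\<in>A. f i) = (\<Sum>i\<in>A. pd k (f i))"
  by (simp flip: perp_psum add: perp_sum_right)

lemma pd_zero [simp]: "pd k 0 = 0"
  by (simp flip: perp_psum)

lemma sum_delta_smul: "(\<Sum>k<(N::nat). smul (a k) (if n = k then f k else 0)) = (if n < N then smul (a n) (f n) else (0::sym))"
proof -
  have "(\<Sum>k<N. smul (a k) (if n = k then f k else 0)) = (\<Sum>k<N. if k = n then smul (a n) (f n) else 0)"
    by (intro sum.cong) auto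
  then show ?thesis by (simp only: sum.delta finite_lessThan lessThan_iff)
qed

text \<open>Differentiating an exponential brings down its coefficient. In the induction the
  commutator contributes n + 1 and the recursion at the lower index i - 1 - n copies of the same
  term, together i.\<close>

lemma pd_nw: "pd n (nw c i) = smul (gam c n) (nw c (i - 1 - int n))"
proof (induction i rule: nw_induct)
  case (nonpos i)
  then show ?case by (cases "i = 0") auto
next
  case (pos i N)
  have "smul (of_int i) (pd n (nw c i)) = pd n (\<Sum>k<N. smul (c k) (psum k * nw c (i - 1 - int k)))"
    using nw_newton[of i N c] pos by (simp flip: pd_smul)
  also have "\<dots> = (\<Sum>k<N. smul (c k) (psum k * pd n (nw c (i - 1 - int k)))) +
      (\<Sum>k<N. smul (c k) (if n = k then smul (zn k) (nw c (i - 1 - int k)) else 0))"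
    by (simp add: pd_sum pd_smul pd_psum sym.scale_right_distrib sum.distrib)
  also have "(\<Sum>k<N. smul (c k) (if n = k then smul (zn k) (nw c (i - 1 - int k)) else 0)) =
      smul (c n * zn n) (nw c (i - 1 - int n))"
    by (subst sum_delta_smul) (use pos in auto)
  also have "(\<Sum>k<N. smul (c k) (psum k * pd n (nw c (i - 1 - int k)))) =
     (\<Sum>k<N. smul (c k) (psum k * smul (gam c n) (nw c (i - 1 - int k - 1 - int n))))"
    by (intro sum.cong refl) (use pos in simp)
  also have "\<dots> = smul (gam c n) (\<Sum>k<N. smul (c k) (psum k * nw c ((i - 1 - int n) - 1 - int k)))"
    by (simp add: sym.scale_sum_right smul_mult_right mult_ac algebra_simps)
  also have "\<dots> = smul (gam c n) (smul (of_int (i - 1 - int n)) (nw c (i - 1 - int n)))"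
    by (subst nw_newton[symmetric]) (use pos in auto)
  also have "\<dots> + smul (c n * zn n) (nw c (i - 1 - int n)) = smul (of_int i) (smul (gam c n) (nw c (i - 1 - int n)))"
    unfolding c_zn by (simp flip: sym.scale_left_distrib) (simp add: ring_distribs)
  finally show ?case by (rule smul_of_int_cancel[rotated]) (use pos in auto)
qed

lemma perp_nw_newton:
  assumes "i \<le> int N"
  shows "smul (of_int i) (perp (nw c i) f) = (\<Sum>k<N. smul (c k) (pd k (perp (nw c (i - 1 - int k)) f)))"
  using assms
  by (simp flip: perp_smul_left perp_psum perp_mult add: nw_newton perp_sum_left)

lemma perp_nw_one: "perp (nw c i) 1 = (if i = 0 then 1 else 0)"
proof (cases "i > 0")
  case True
  then have "smul (of_int i) (perp (nw c i) 1) = (\<Sum>k<nat i. smul (c k) (pd k (perp (nw c (i - 1 - int k)) 1)))"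
    by (intro perp_nw_newton) simp
  also have "\<dots> = 0"
    by (intro sum.neutral) (simp flip: perp_psum add: perp_comm[of "psum _"], simp add: perp_psum)
  finally show ?thesis using True by simp
qed auto

text \<open>In generating-function form, the adjoint of the exponential substitutes p +
  \<open>gam c n\<close> u^(n+1) for p = \<open>psum n\<close>.\<close>

lemma perp_nw_psum:
  "perp (nw c i) (psum n * f) = psum n * perp (nw c i) f + smul (gam c n) (perp (nw c (i - 1 - int n)) f)"
proof (induction i rule: nw_induct)
  case (nonpos i)
  then show ?case by (cases "i = 0") auto
next
  case (pos i N)
  let ?D = "\<lambda>i. perp (nw c i)"
  have "smul (of_int i) (?D i (psum n * f)) = (\<Sum>k<N. smul (c k) (pd k (?D (i - 1 - int k) (psum n * f))))"
    by (rule perp_nw_newton) (use pos in auto)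
  also have "\<dots> = (\<Sum>k<N. smul (c k) (pd k (psum n * ?D (i - 1 - int k) f + smul (gam c n) (?D (i - 1 - int k - 1 - int n) f))))"
    by (intro sum.cong refl) (use pos in simp)
  also have "\<dots> = psum n * (\<Sum>k<N. smul (c k) (pd k (?D (i - 1 - int k) f)))
     + (\<Sum>k<N. smul (c k) (if n = k then smul (zn k) (?D (i - 1 - int k) f) else 0))
     + smul (gam c n) (\<Sum>k<N. smul (c k) (pd k (?D ((i - 1 - int n) - 1 - int k) f)))"
  proof -
    have "smul (c k) (pd k (psum n * ?D (i - 1 - int k) f + smul (gam c n) (?D (i - 1 - int k - 1 - int n) f)))
      = psum n * smul (c k) (pd k (?D (i - 1 - int k) f))
     + smul (c k) (if n = k then smul (zn k) (?D (i - 1 - int k) f) else 0)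
     + smul (gam c n) (smul (c k) (pd k (?D ((i - 1 - int n) - 1 - int k) f)))" for k
    proof -
      have *: "i - 1 - int k - 1 - int n = (i - 1 - int n) - 1 - int k" by simp
      show ?thesis unfolding *
        by (auto simp: pd_add pd_smul pd_psum smul_simps mult.commute[of "c k"] simp del: of_nat_Suc)
    qed
    then show ?thesis by (simp only: sum.distrib sum_distrib_left sym.scale_sum_right)
  qed
  also have "(\<Sum>k<N. smul (c k) (if n = k then smul (zn k) (?D (i - 1 - int k) f) else 0)) =
      smul (c n * zn n) (?D (i - 1 - int n) f)"
    by (subst sum_delta_smul) (use pos in auto)
  also have "(\<Sum>k<N. smul (c k) (pd k (?D (i - 1 - int k) f))) = smul (of_int i) (?D i f)"
    by (rule perp_nw_newton[symmetric]) (use pos in auto)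
  also have "(\<Sum>k<N. smul (c k) (pd k (?D ((i - 1 - int n) - 1 - int k) f))) = smul (of_int (i - 1 - int n)) (?D (i - 1 - int n) f)"
    by (rule perp_nw_newton[symmetric]) (use pos in auto)
  also have "psum n * smul (of_int i) (?D i f) + smul (c n * zn n) (?D (i - 1 - int n) f) +
      smul (gam c n) (smul (of_int (i - 1 - int n)) (?D (i - 1 - int n) f))
     = smul (of_int i) (psum n * ?D i f + smul (gam c n) (?D (i - 1 - int n) f))"
    unfolding c_zn by (simp add: smul_mult_right sym.scale_right_distrib add.assoc flip: sym.scale_left_distrib)
       (simp add: algebra_simps)
  finally show ?case by (rule smul_of_int_cancel[rotated]) (use pos in auto)
qed

text \<open>A substitution for the power sums is a ring homomorphism; this is the coefficient of u^i
  in its multiplicativity.\<close>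

lemma perp_nw_mult:
  "perp (nw c i) (f * g) = (\<Sum>j=0..i. perp (nw c j) f * perp (nw c (i - j)) g)"
proof (induction f arbitrary: i rule: sym_induct)
  case one
  have "(\<Sum>j=0..i. perp (nw c j) 1 * perp (nw c (i - j)) g) = (\<Sum>j=0..i. if j = 0 then perp (nw c i) g else 0)"
    by (intro sum.cong) (auto simp: perp_nw_one)
  then show ?case by simp
next
  case (add f1 f2)
  then show ?case by (simp add: ring_distribs perp_add_right sum.distrib)
next
  case (smul a f)
  then show ?case by (simp add: smul_mult_left perp_smul_right sym.scale_sum_right)
next
  case (psum n f)
  let ?D = "\<lambda>i. perp (nw c i)"
  \<comment> \<open>After the shift the range starts below zero, where all terms vanish.\<close>
  have "(\<Sum>j=0..i. ?D (j - 1 - int n) f * ?D (i - j) g) = (\<Sum>j=-1-int n..i-1-int n. ?D j f * ?D (i - 1 - int n - j) g)"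
    by (rule sum.reindex_bij_witness[of _ "\<lambda>j. j + 1 + int n" "\<lambda>j. j - 1 - int n"]) (auto simp: algebra_simps)
  also have "\<dots> = (\<Sum>j=0..i-1-int n. ?D j f * ?D (i - 1 - int n - j) g)"
    by (rule sum.mono_neutral_right) auto
  finally show ?case
    using psum by (simp add: perp_nw_psum mult.assoc ring_distribs sum.distrib smul_mult_left
       sum_distrib_left flip: sym.scale_sum_right)
qed

text \<open>The four generating functions are prod (1 + x u), prod 1 / (1 - x u), prod (1 - t x u) /
  (1 - x u) and the inverse of the last one.\<close>

definition ee :: "int \<Rightarrow> sym" where "ee = nw (\<lambda>k. (-1) ^ k)"
definition hh :: "int \<Rightarrow> sym" where "hh = nw (\<lambda>_. 1)"
definition qq :: "int \<Rightarrow> sym" where "qq = nw (\<lambda>k. 1 - tt ^ Suc k)"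
definition qinv :: "int \<Rightarrow> sym" where "qinv = nw (\<lambda>k. - (1 - tt ^ Suc k))"

lemma nw_simps [simp]: "ee 0 = 1" "hh 0 = 1" "qq 0 = 1" "qinv 0 = 1"
  "i < 0 \<Longrightarrow> ee i = 0" "i < 0 \<Longrightarrow> hh i = 0" "i < 0 \<Longrightarrow> qq i = 0" "i < 0 \<Longrightarrow> qinv i = 0"
  by (simp_all add: ee_def hh_def qq_def qinv_def)

lemma ee_hh: "(\<Sum>j\<le>r. smul ((-1) ^ j) (hh (int j)) * ee (int (r - j))) = (if r = 0 then 1 else 0)"
proof -
  have "smul ((-1) ^ j) (hh (int j)) = nw (\<lambda>k. (-1) ^ Suc k * 1) (int j)" for j
    using nw_scale[of "-1" "int j" "\<lambda>_. 1"] by (simp add: hh_def)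
  then have "(\<Sum>j\<le>r. smul ((-1) ^ j) (hh (int j)) * ee (int (r - j))) =
     (\<Sum>j\<le>r. nw (\<lambda>k. (-1) ^ Suc k * 1) (int j) * nw (\<lambda>k. (-1) ^ k) (int (r - j)))"
    by (simp add: ee_def)
  also have "\<dots> = nw (\<lambda>_. 0) (int r)"
    by (subst nw_convolution) simp
  finally show ?thesis by (simp add: nw_zero)
qed

text \<open>Here \<open>gam\<close> is constantly 1, so the adjoint of the q-series replaces p_n by
  p_n + u^n: it adjoins the letter u. For \<open>qinv\<close> the sign is reversed and the letter is
  deleted.\<close>

lemma perp_qq_psum: "perp (qq i) (psum n * f) = psum n * perp (qq i) f + perp (qq (i - 1 - int n)) f"
  unfolding qq_def perp_nw_psum by (simp add: gam_def)

lemma perp_qinv_psum: "perp (qinv i) (psum n * f) = psum n * perp (qinv i) f - perp (qinv (i - 1 - int n)) f"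
proof -
  have "gam (\<lambda>k. - (1 - tt ^ Suc k)) n = -1"
    unfolding gam_def using one_minus_tt_power[of "Suc n"]
    by (simp only: minus_divide_left[symmetric] divide_self zero_less_Suc not_False_eq_True)
  then show ?thesis unfolding qinv_def perp_nw_psum by simp
qed

lemma pd_qq: "pd n (qq i) = qq (i - 1 - int n)"
  unfolding qq_def pd_nw by (simp add: gam_def)

text \<open>One computation serves multiplication (\<open>\<sigma>\<close> = 1) and the adjoint
  action (\<open>\<sigma>\<close> = -1) on Jing operators. Let s shift the index \<open>m\<close> by
  \<open>\<sigma>\<close>. Passing p_n through X adds s^n, so after exponentiation E(z) picks up the
  factor 1 + z s and H(z) the factor 1 / (1 - z s). Clearing that denominator puts the second
  \<open>hh\<close> of \<open>hh_X\<close> to the left of X, whereas in \<open>ee_X\<close> it is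
  inside.\<close>

locale shift_commutation =
  fixes L :: "sym \<Rightarrow> sym \<Rightarrow> sym" and X :: "int \<Rightarrow> sym \<Rightarrow> sym" and \<sigma> :: int
  assumes L_add: "L (a + b) f = L a f + L b f" and L_smul: "L (smul x a) f = smul x (L a f)"
    and L_add_right: "L a (f + g) = L a f + L a g"
    and L_one: "L 1 f = f" and L_mult: "L a (L b f) = L (a * b) f"
    and X_add: "X m (f + g) = X m f + X m g" and X_smul: "X m (smul x f) = smul x (X m f)"
    and psum_X: "L (psum k) (X m f) = X m (L (psum k) f) + X (m + \<sigma> * int (Suc k)) f"
begin

lemma L_0 [simp]: "L 0 f = 0"
  using L_smul[of 0 0 f] by simp

lemma X_0 [simp]: "X m 0 = 0"
  using X_smul[of m 0 0] by simp

lemma X_sum: "X m (\<Sum>i\<in>A. f i) = (\<Sum>i\<in>A. X m (f i))"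
  by (induction A rule: infinite_finite_induct) (simp_all add: X_add)

lemma L_sum: "L (\<Sum>i\<in>A. f i) g = (\<Sum>i\<in>A. L (f i) g)"
  by (induction A rule: infinite_finite_induct) (simp_all add: L_add)

lemma L_newton:
  assumes "i \<le> int N"
  shows "smul (of_int i) (L (nw c i) f) = (\<Sum>k<N. smul (c k) (L (psum k) (L (nw c (i - 1 - int k)) f)))"
  unfolding L_smul[symmetric] nw_newton[OF assms] by (simp only: L_sum L_mult L_smul smul_mult_left)

lemma ee_X: "L (ee i) (X m f) = X m (L (ee i) f) + X (m + \<sigma>) (L (ee (i - 1)) f)"
proof (induction i arbitrary: m f rule: nw_induct)
  case (nonpos i)
  then show ?case using L_one by (cases "i = 0") simp_all
next
  case (pos i N)
  \<comment> \<open>The terms created by commutators. With alternating signs they telescope to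
    \<open>a 0\<close>, as \<open>a N\<close> contains \<open>ee\<close> at a negative
    index.\<close>
  define a where "a k = X (m + \<sigma> * int (Suc k)) (L (ee (i - 1 - int k)) f)" for k
  have "smul (of_int i) (L (ee i) (X m f)) = (\<Sum>k<N. smul ((-1)^k) (L (psum k) (L (ee (i - 1 - int k)) (X m f))))"
    unfolding ee_def by (rule L_newton) (use pos in simp)
  also have "\<dots> = (\<Sum>k<N. smul ((-1)^k) (L (psum k) (X m (L (ee (i - 1 - int k)) f) + X (m + \<sigma>) (L (ee (i - 1 - int k - 1)) f))))"
    by (intro sum.cong refl) (use pos in simp)
  also have "\<dots> = (\<Sum>k<N. X m (smul ((-1)^k) (L (psum k) (L (ee (i - 1 - int k)) f))))
     + (\<Sum>k<N. X (m + \<sigma>) (smul ((-1)^k) (L (psum k) (L (ee ((i - 1) - 1 - int k)) f))))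
     + (\<Sum>k<N. smul ((-1)^k) (a k) + smul ((-1)^k) (a (Suc k)))"
    unfolding a_def sum.distrib[symmetric]
    by (intro sum.cong refl) (simp add: L_add_right psum_X X_smul smul_simps algebra_simps)
  also have "(\<Sum>k<N. smul ((-1)^k) (a k) + smul ((-1)^k) (a (Suc k))) = (\<Sum>k<N. smul ((-1)^k) (a k) - smul ((-1)^Suc k) (a (Suc k)))"
    by simp
  also have "\<dots> = smul ((-1)^0) (a 0) - smul ((-1)^N) (a N)"
    by (rule sum_lessThan_telescope')
  also have "a N = 0" using pos by (simp add: a_def)
  also have "(\<Sum>k<N. X m (smul ((-1)^k) (L (psum k) (L (ee (i - 1 - int k)) f)))) = smul (of_int i) (X m (L (ee i) f))"
    unfolding X_sum[symmetric] X_smul[symmetric] ee_def by (subst L_newton[of i N]) (use pos in auto)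
  also have "(\<Sum>k<N. X (m + \<sigma>) (smul ((-1)^k) (L (psum k) (L (ee (i - 1 - 1 - int k)) f)))) = smul (of_int (i - 1)) (X (m + \<sigma>) (L (ee (i - 1)) f))"
    unfolding X_sum[symmetric] X_smul[symmetric] ee_def by (subst L_newton[of "i - 1" N]) (use pos in auto)
  finally have "smul (of_int i) (L (ee i) (X m f)) = smul (of_int i) (X m (L (ee i) f) + X (m + \<sigma>) (L (ee (i - 1)) f))"
    by (simp add: a_def smul_simps)
  then show ?case by (rule smul_of_int_cancel[rotated]) (use pos(1) in simp)
qed

lemma hh_X: "L (hh i) (X m f) = X m (L (hh i) f) + L (hh (i - 1)) (X (m + \<sigma>) f)"
proof (induction i arbitrary: m f rule: nw_induct)
  case (nonpos i)
  then show ?case using L_one by (cases "i = 0") simp_all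
next
  case (pos i N)
  \<comment> \<open>The claim for smaller indices, iterated until the index of \<open>hh\<close> is
    used up. At index \<open>i - 1\<close> this is exactly the sum of the commutator terms in the
    Newton recursion.\<close>
  have expand: "L (hh (int n)) (X m f) = (\<Sum>k<Suc n. X (m + \<sigma> * int k) (L (hh (int n - int k)) f))" if "int n < i" for n m
    using that
  proof (induction n arbitrary: m)
    case 0
    then show ?case by (simp add: L_one)
  next
    case (Suc n)
    have "L (hh (int (Suc n))) (X m f) = X m (L (hh (int (Suc n))) f) + L (hh (int n)) (X (m + \<sigma>) f)"
      using pos(3)[of "int (Suc n)" m f] Suc.prems by simp
    also have "L (hh (int n)) (X (m + \<sigma>) f) = (\<Sum>k<Suc n. X (m + \<sigma> + \<sigma> * int k) (L (hh (int n - int k)) f))"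
      by (rule Suc.IH) (use Suc.prems in simp)
    also have "X m (L (hh (int (Suc n))) f) + \<dots> = (\<Sum>k<Suc (Suc n). X (m + \<sigma> * int k) (L (hh (int (Suc n) - int k)) f))"
      by (subst sum.lessThan_Suc_shift[of _ "Suc n"]) (simp add: algebra_simps)
    finally show ?case .
  qed
  have "smul (of_int i) (L (hh i) (X m f)) = (\<Sum>k<N. L (psum k) (L (hh (i - 1 - int k)) (X m f)))"
    using L_newton[of i N "\<lambda>_. 1" "X m f"] pos(1,2) by (simp add: hh_def)
  also have "\<dots> = (\<Sum>k<N. L (psum k) (X m (L (hh (i - 1 - int k)) f) + L (hh (i - 1 - int k - 1)) (X (m + \<sigma>) f)))"
    by (intro sum.cong refl arg_cong[where f = "L (psum _)"] pos(3)) simp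
  also have "\<dots> = (\<Sum>k<N. X m (L (psum k) (L (hh (i - 1 - int k)) f)))
     + (\<Sum>k<N. L (psum k) (L (hh (i - 1 - 1 - int k)) (X (m + \<sigma>) f)))
     + (\<Sum>k<N. X (m + \<sigma> + \<sigma> * int k) (L (hh (i - 1 - int k)) f))"
    unfolding sum.distrib[symmetric]
    by (intro sum.cong refl) (simp add: L_add_right psum_X algebra_simps)
  also have "(\<Sum>k<N. X (m + \<sigma> + \<sigma> * int k) (L (hh (i - 1 - int k)) f)) = L (hh (i - 1)) (X (m + \<sigma>) f)"
    using expand[of "N - 1" "m + \<sigma>"] pos(1,2) by (simp add: of_nat_diff)
  also have "(\<Sum>k<N. X m (L (psum k) (L (hh (i - 1 - int k)) f))) = smul (of_int i) (X m (L (hh i) f))"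
    unfolding X_sum[symmetric] X_smul[symmetric] hh_def by (subst L_newton[of i N]) (use pos(2) in auto)
  also have "(\<Sum>k<N. L (psum k) (L (hh (i - 1 - 1 - int k)) (X (m + \<sigma>) f))) = smul (of_int (i - 1)) (L (hh (i - 1)) (X (m + \<sigma>) f))"
    using L_newton[of "i - 1" N "\<lambda>_. 1" "X (m + \<sigma>) f"] pos(1,2) by (simp add: hh_def)
  finally have "smul (of_int i) (L (hh i) (X m f)) = smul (of_int i) (X m (L (hh i) f) + L (hh (i - 1)) (X (m + \<sigma>) f))"
    by (simp add: smul_simps)
  then show ?case by (rule smul_of_int_cancel[rotated]) (use pos(1) in simp)
qed

end

section \<open>Evaluation and Jing operators\<close>

definition monval :: "(nat \<Rightarrow> qt) \<Rightarrow> (nat \<Rightarrow>\<^sub>0 nat) \<Rightarrow> qt" where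
  "monval \<pi> m = (\<Prod>k\<in>Poly_Mapping.keys m. \<pi> k ^ Poly_Mapping.lookup m k)"

definition evp :: "(nat \<Rightarrow> qt) \<Rightarrow> sym \<Rightarrow> qt" where
  "evp \<pi> f = (\<Sum>m\<in>Poly_Mapping.keys f. Poly_Mapping.lookup f m * monval \<pi> m)"

lemma ev_conv: "ev n f x = evp (\<lambda>k. \<Sum>i<n. x i ^ Suc k) f"
  by (simp add: ev_def evp_def monval_def)

lemma monval_conv: "finite A \<Longrightarrow> Poly_Mapping.keys m \<subseteq> A \<Longrightarrow> monval \<pi> m = (\<Prod>k\<in>A. \<pi> k ^ Poly_Mapping.lookup m k)"
  unfolding monval_def by (rule prod.mono_neutral_left) (auto simp: in_keys_iff)

lemma monval_add: "monval \<pi> (m + m') = monval \<pi> m * monval \<pi> m'"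
proof -
  let ?A = "Poly_Mapping.keys m \<union> Poly_Mapping.keys m'"
  have "monval \<pi> (m + m') = (\<Prod>k\<in>?A. \<pi> k ^ Poly_Mapping.lookup (m + m') k)"
    by (rule monval_conv) (use keys_add[of m m'] in auto)
  also have "\<dots> = (\<Prod>k\<in>?A. \<pi> k ^ Poly_Mapping.lookup m k) * (\<Prod>k\<in>?A. \<pi> k ^ Poly_Mapping.lookup m' k)"
    by (simp add: lookup_add power_add prod.distrib)
  also have "\<dots> = monval \<pi> m * monval \<pi> m'"
    by (simp add: monval_conv[of ?A])
  finally show ?thesis .
qed

lemma evp_conv: "finite A \<Longrightarrow> Poly_Mapping.keys f \<subseteq> A \<Longrightarrow>
   evp \<pi> f = (\<Sum>m\<in>A. Poly_Mapping.lookup f m * monval \<pi> m)"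
  unfolding evp_def by (rule sum.mono_neutral_left) (auto simp: in_keys_iff)

lemma evp_add: "evp \<pi> (f + g) = evp \<pi> f + evp \<pi> g"
proof -
  let ?A = "Poly_Mapping.keys f \<union> Poly_Mapping.keys g"
  have "evp \<pi> (f + g) = (\<Sum>m\<in>?A. Poly_Mapping.lookup (f + g) m * monval \<pi> m)"
    by (rule evp_conv) (use keys_add[of f g] in auto)
  then show ?thesis
    by (simp add: evp_conv[of ?A] lookup_add ring_distribs sum.distrib)
qed

lemma evp_smul: "evp \<pi> (smul c f) = c * evp \<pi> f"
proof -
  have "evp \<pi> (smul c f) = (\<Sum>m\<in>Poly_Mapping.keys f. Poly_Mapping.lookup (smul c f) m * monval \<pi> m)"
    by (rule evp_conv) (auto simp: in_keys_iff)
  then show ?thesis by (simp add: evp_def sum_distrib_left mult.assoc)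
qed

lemma evp_zero [simp]: "evp \<pi> 0 = 0"
  by (simp add: evp_def)

lemma evp_one [simp]: "evp \<pi> 1 = 1"
  by (subst evp_conv[of "{0}"]) (auto simp: lookup_one_sym monval_def)

lemma evp_psum: "evp \<pi> (psum k * f) = \<pi> k * evp \<pi> f"
proof -
  let ?s = "\<lambda>m. Poly_Mapping.single k (1::nat) + m"
  have sub: "Poly_Mapping.keys (psum k * f) \<subseteq> ?s ` Poly_Mapping.keys f"
    using keys_mult[of "psum k" f] by (auto simp: psum_def)
  have "evp \<pi> (psum k * f) = (\<Sum>m\<in>?s ` Poly_Mapping.keys f. Poly_Mapping.lookup (psum k * f) m * monval \<pi> m)"
    by (rule evp_conv) (use sub in auto)
  also have "\<dots> = (\<Sum>m\<in>Poly_Mapping.keys f. Poly_Mapping.lookup (psum k * f) (?s m) * monval \<pi> (?s m))"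
    by (subst sum.reindex) (auto simp: inj_on_def)
  also have "\<dots> = (\<Sum>m\<in>Poly_Mapping.keys f. \<pi> k * (Poly_Mapping.lookup f m * monval \<pi> m))"
    by (intro sum.cong refl) (simp add: lookup_psum_mult lookup_add monval_add, simp add: monval_def)
  finally show ?thesis by (simp add: evp_def sum_distrib_left)
qed

lemma evp_sum: "evp \<pi> (\<Sum>i\<in>A. f i) = (\<Sum>i\<in>A. evp \<pi> (f i))"
  by (induction A rule: infinite_finite_induct) (simp_all add: evp_add)

lemma evp_diff: "evp \<pi> (f - g) = evp \<pi> f - evp \<pi> g"
  using evp_add[of \<pi> "f - g" g] by simp

text \<open>Numbers satisfying Newton's identity for the prescribed values of the power sums are the
  values of \<open>nw\<close>. This is how \<open>ee\<close> and \<open>qq\<close> get explicit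
  values.\<close>

lemma evp_nw:
  assumes y0: "y 0 = 1"
    and y: "\<And>r. of_nat (Suc r) * y (Suc r) = (\<Sum>k\<le>r. c k * \<pi> k * y (r - k))"
  shows "evp \<pi> (nw c (int r)) = y r"
proof (induction r rule: less_induct)
  case (less r)
  show ?case
  proof (cases r)
    case 0
    then show ?thesis using y0 by simp
  next
    case (Suc n)
    have "of_nat (Suc n) * evp \<pi> (nw c (int r)) = evp \<pi> (smul (of_int (int r)) (nw c (int r)))"
      by (simp only: evp_smul Suc of_int_of_nat_eq)
    also have "\<dots> = (\<Sum>k<r. c k * (\<pi> k * evp \<pi> (nw c (int r - 1 - int k))))"
      by (subst nw_newton[of _ r]) (simp_all add: evp_sum evp_smul evp_psum)
    also have "\<dots> = (\<Sum>k\<le>n. c k * \<pi> k * y (n - k))"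
    proof (rule sum.cong)
      fix k assume "k \<in> {..n}"
      then have k: "int r - 1 - int k = int (n - k)" "n - k < r" using Suc by auto
      show "c k * (\<pi> k * evp \<pi> (nw c (int r - 1 - int k))) = c k * \<pi> k * y (n - k)"
        unfolding k(1) less.IH[OF k(2)] by (simp add: mult.assoc)
    qed (use Suc in auto)
    also have "\<dots> = of_nat (Suc n) * y r" using y[of n] Suc by simp
    finally show ?thesis by (simp del: of_nat_Suc)
  qed
qed

text \<open>Sets instead of tuples: the letters are distinct, as the denominators a - b require, and
  deleting a letter is set difference.\<close>

definition evA :: "qt set \<Rightarrow> sym \<Rightarrow> qt" where
  "evA A = evp (\<lambda>k. \<Sum>a\<in>A. a ^ Suc k)"

lemma ev_evA: "inj_on x {..<n} \<Longrightarrow> ev n f x = evA (x ` {..<n}) f"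
  unfolding ev_conv evA_def by (simp add: sum.reindex)

lemmas evA_simps = evp_add[of "\<lambda>k. \<Sum>a\<in>A. a ^ Suc k" for A, folded evA_def]
  evp_smul[of "\<lambda>k. \<Sum>a\<in>A. a ^ Suc k" for A, folded evA_def]
  evp_one[of "\<lambda>k. \<Sum>a\<in>A. a ^ Suc k" for A, folded evA_def]
  evp_zero[of "\<lambda>k. \<Sum>a\<in>A. a ^ Suc k" for A, folded evA_def]
  evp_psum[of "\<lambda>k. \<Sum>a\<in>A. a ^ Suc k" for A, folded evA_def]
  evp_sum[of "\<lambda>k. \<Sum>a\<in>A. a ^ Suc k" for A, folded evA_def]
  evp_diff[of "\<lambda>k. \<Sum>a\<in>A. a ^ Suc k" for A, folded evA_def]

text \<open>Each factor p_n extends the range of nonvanishing indices by at most n. Hence letter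
  substitutions and Jing operators are finite sums on each \<open>f\<close>.\<close>

lemma perp_nw_finite: "\<exists>N. \<forall>i\<ge>int N. perp (nw c i) f = 0"
proof (induction f rule: sym_induct)
  case one
  show ?case by (rule exI[of _ 1]) (auto simp: perp_nw_one)
next
  case (add f g)
  then obtain N M where "\<forall>i\<ge>int N. perp (nw c i) f = 0" "\<forall>i\<ge>int M. perp (nw c i) g = 0" by blast
  then show ?case by (intro exI[of _ "N + M"]) (simp add: perp_add_right)
next
  case (smul a f)
  then show ?case by (simp add: perp_smul_right) metis
next
  case (psum k f)
  then obtain N where "\<forall>i\<ge>int N. perp (nw c i) f = 0" by blast
  then show ?case by (intro exI[of _ "N + Suc k"]) (simp add: perp_nw_psum)
qed

text \<open>By \<open>perp_qq_psum\<close> the series on the right sends p_n to p_n + u^n, which is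
  the effect of one more letter. Quantifying over all large \<open>M\<close> expresses an infinite
  sum with finitely many nonzero terms.\<close>

lemma evA_insert:
  assumes "finite A" "u \<notin> A"
  shows "\<exists>N. \<forall>M\<ge>N. evA (insert u A) f = (\<Sum>k<M. evA A (perp (qq (int k)) f) * u ^ k)"
proof (induction f rule: sym_induct)
  case one
  have "evA A (perp (qq (int k)) 1) * u ^ k = (if k = 0 then 1 else 0)" for k
    by (simp add: qq_def perp_nw_one evA_simps)
  then show ?case by (intro exI[of _ 1]) (auto simp: evA_simps)
next
  case (add f g)
  then obtain N N' where "\<forall>M\<ge>N. evA (insert u A) f = (\<Sum>k<M. evA A (perp (qq (int k)) f) * u ^ k)"
    "\<forall>M\<ge>N'. evA (insert u A) g = (\<Sum>k<M. evA A (perp (qq (int k)) g) * u ^ k)" by blast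
  then have "evA (insert u A) f = (\<Sum>k<M. evA A (perp (qq (int k)) f) * u ^ k)"
      "evA (insert u A) g = (\<Sum>k<M. evA A (perp (qq (int k)) g) * u ^ k)" if "M \<ge> N + N'" for M
    using that by (meson add_leD1 add_leD2)+
  then have "evA (insert u A) (f + g) = (\<Sum>k<M. evA A (perp (qq (int k)) (f + g)) * u ^ k)" if "M \<ge> N + N'" for M
    using that by (simp add: evA_simps perp_add_right sum.distrib ring_distribs)
  then show ?case by blast
next
  case (smul a f)
  then obtain N where "\<forall>M\<ge>N. evA (insert u A) f = (\<Sum>k<M. evA A (perp (qq (int k)) f) * u ^ k)" by blast
  then show ?case
    by (intro exI[of _ N]) (simp add: evA_simps perp_smul_right sum_distrib_left mult.assoc)
next
  case (psum n f)
  then obtain N where N: "\<forall>M\<ge>N. evA (insert u A) f = (\<Sum>k<M. evA A (perp (qq (int k)) f) * u ^ k)" by blast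
  show ?case
  proof (intro exI[of _ "N + Suc n"] allI impI)
    fix M assume M: "M \<ge> N + Suc n"
    have "(\<Sum>k<M. evA A (perp (qq (int k - 1 - int n)) f) * u ^ k) = (\<Sum>k\<in>{Suc n..<M}. evA A (perp (qq (int k - 1 - int n)) f) * u ^ k)"
      by (rule sum.mono_neutral_right) (auto simp: evA_simps)
    also have "\<dots> = (\<Sum>k<M - Suc n. evA A (perp (qq (int k)) f) * u ^ (k + Suc n))"
      by (rule sum.reindex_bij_witness[of _ "\<lambda>k. k + Suc n" "\<lambda>k. k - Suc n"]) (use M in \<open>auto simp: of_nat_diff algebra_simps\<close>)
    also have "\<dots> = u ^ Suc n * evA (insert u A) f"
    proof -
      have "M - Suc n \<ge> N" using M by simp
      then show ?thesis using N by (simp add: power_add sum_distrib_left mult_ac)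
    qed
    finally have *: "(\<Sum>k<M. evA A (perp (qq (int k - 1 - int n)) f) * u ^ k) = u ^ Suc n * evA (insert u A) f" .
    have "(\<Sum>k<M. evA A (perp (qq (int k)) (psum n * f)) * u ^ k) =
      (\<Sum>a\<in>A. a ^ Suc n) * (\<Sum>k<M. evA A (perp (qq (int k)) f) * u ^ k) + (\<Sum>k<M. evA A (perp (qq (int k - 1 - int n)) f) * u ^ k)"
      unfolding perp_qq_psum evA_simps
      by (simp only: ring_distribs sum.distrib sum_distrib_left mult.assoc)
    also have "(\<Sum>k<M. evA A (perp (qq (int k)) f) * u ^ k) = evA (insert u A) f"
      using N[rule_format, of M] M by simp
    finally show "evA (insert u A) (psum n * f) = (\<Sum>k<M. evA A (perp (qq (int k)) (psum n * f)) * u ^ k)"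
      unfolding * evA_simps using assms by (simp add: ring_distribs add.commute)
  qed
qed

text \<open>
  For fixed $A$, the value of $f$ on $A \cup \{u\}$ is a polynomial in $u$ whose coefficients are the
  values of \<open>perp (qq k) f\<close> on $A$, and it vanishes for infinitely many $u$.
\<close>
lemma vanish_perp_qq:
  assumes f: "\<And>A. finite A \<Longrightarrow> evA A f = 0" and A: "finite A"
  shows "evA A (perp (qq (int k)) f) = 0"
proof -
  obtain N0 where N0: "\<forall>i\<ge>int N0. perp (qq i) f = 0"
    using perp_nw_finite unfolding qq_def by blast
  define p where "p = (\<Sum>k<N0. monom (evA A (perp (qq (int k)) f)) k)"
  have "poly p u = 0" if u: "u \<notin> A" for u
  proof -
    obtain N where N: "\<forall>M\<ge>N. evA (insert u A) f = (\<Sum>k<M. evA A (perp (qq (int k)) f) * u ^ k)"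
      using evA_insert[OF A u] by blast
    have "poly p u = (\<Sum>k<N0. evA A (perp (qq (int k)) f) * u ^ k)"
      by (simp add: p_def poly_sum poly_monom)
    also have "\<dots> = (\<Sum>k<N0 + N. evA A (perp (qq (int k)) f) * u ^ k)"
      by (rule sum.mono_neutral_left) (use N0 in \<open>auto simp: evA_simps\<close>)
    also have "\<dots> = evA (insert u A) f" using N[rule_format, of "N0 + N"] by simp
    finally show ?thesis using f A by simp
  qed
  then have "- A \<subseteq> {u. poly p u = 0}" by auto
  moreover have "infinite (- A)" using A infinite_UNIV_char_0[where 'a = qt] by (simp add: Compl_eq_Diff_UNIV)
  ultimately have "p = 0" using poly_roots_finite finite_subset by blast
  then have "coeff p k = 0" by simp
  then show ?thesis
  proof (cases "k < N0")
    case True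
    then show ?thesis using \<open>coeff p k = 0\<close>
      by (simp add: p_def coeff_sum)
  next
    case False
    then show ?thesis using N0 by (simp add: evA_simps)
  qed
qed

text \<open>Newton's identity for the adjoints of \<open>qq\<close> expresses \<open>pd n f\<close>
  through \<open>perp (qq (n+1)) f\<close> and \<open>pd k\<close> for k < n of functions that
  vanish on alphabets as well. The coefficient 1 - t^(n+1) of \<open>pd n f\<close> is
  nonzero.\<close>

lemma vanish_pd:
  assumes "\<And>A. finite A \<Longrightarrow> evA A f = 0" and "finite A"
  shows "evA A (pd n f) = 0"
  using assms
proof (induction n arbitrary: f A rule: less_induct)
  case (less n)
  have "smul (of_int (int (Suc n))) (perp (qq (int (Suc n))) f) =
     (\<Sum>k<Suc n. smul (1 - tt ^ Suc k) (pd k (perp (qq (int (Suc n) - 1 - int k)) f)))"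
    unfolding qq_def by (rule perp_nw_newton) simp
  then have "evA A (smul (of_int (int (Suc n))) (perp (qq (int (Suc n))) f)) =
     evA A (\<Sum>k<Suc n. smul (1 - tt ^ Suc k) (pd k (perp (qq (int (Suc n) - 1 - int k)) f)))"
    by simp
  then have "of_int (int (Suc n)) * evA A (perp (qq (int (Suc n))) f) =
     (\<Sum>k<n. (1 - tt ^ Suc k) * evA A (pd k (perp (qq (int (Suc n) - 1 - int k)) f))) + (1 - tt ^ Suc n) * evA A (pd n f)"
    by (simp only: evA_simps sum.lessThan_Suc) simp
  moreover have "evA A (perp (qq (int (Suc n))) f) = 0"
    by (rule vanish_perp_qq) (use less.prems in auto)
  moreover have "(\<Sum>k<n. (1 - tt ^ Suc k) * evA A (pd k (perp (qq (int (Suc n) - 1 - int k)) f))) = 0"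
  proof (intro sum.neutral ballI)
    fix k assume k: "k \<in> {..<n}"
    then have *: "int (Suc n) - 1 - int k = int (n - k)" by (simp add: of_nat_diff)
    have "evA A (pd k (perp (qq (int (n - k))) f)) = 0"
      using k less.prems(2) by (intro less.IH vanish_perp_qq[OF less.prems(1)]) auto
    then show "(1 - tt ^ Suc k) * evA A (pd k (perp (qq (int (Suc n) - 1 - int k)) f)) = 0"
      unfolding * by (rule arg_cong[where f = "(*) _", THEN trans, OF _ mult_zero_right])
  qed
  ultimately have "(1 - tt ^ Suc n) * evA A (pd n f) = 0" by (simp only: mult_zero_right add_0)
  then show ?case using one_minus_tt_power[of "Suc n"] by (simp only: mult_eq_0_iff zero_less_Suc) blast
qed

text \<open>Functions vanishing on all finite alphabets are stable under every \<open>pd n\<close>,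
  and the empty alphabet reads off the constant term. By adjunction the pairing with every monomial
  is zero.\<close>

lemma vanish_imp_zero:
  assumes "\<And>A. finite A \<Longrightarrow> evA A f = 0"
  shows "f = 0"
proof (rule hall_eqI)
  fix h
  have "hall h f = 0" using assms
  proof (induction h arbitrary: f rule: sym_induct)
    case one
    have mv: "monval (\<lambda>k. 0) m = (if m = 0 then 1 else 0)" for m
      by (auto simp: monval_def in_keys_iff poly_mapping_eq_iff fun_eq_iff)
    have "evA {} f = (\<Sum>m\<in>Poly_Mapping.keys f. Poly_Mapping.lookup f m * (if m = 0 then 1 else 0))"
      by (simp add: evA_def evp_def mv)
    also have "\<dots> = Poly_Mapping.lookup f 0" by (simp add: if_distrib in_keys_iff cong: if_cong)
    finally show ?case using one[of "{}"] by (simp add: hall_one)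
  next
    case (psum k h)
    have "hall h (pd k f) = 0" by (rule psum.IH) (rule vanish_pd[OF psum.prems])
    then show ?case by (simp add: hall_psum)
  qed (simp_all add: hall_add_left hall_smul_left)
  then show "hall f h = hall 0 h" by (simp add: hall_sym)
qed

lemma evA_eqI: "(\<And>A. finite A \<Longrightarrow> evA A f = evA A g) \<Longrightarrow> f = g"
  using vanish_imp_zero[of "f - g"] by (simp add: evA_simps)

section \<open>Jing operators and their commutation with power sums\<close>

definition jing_bound :: "sym \<Rightarrow> nat" where
  "jing_bound f = (LEAST N. \<forall>i\<ge>int N. perp (qinv i) f = 0)"

text \<open>Here $f[X - v] = \sum_k v^k$ \<open>perp (qinv k) f\<close>.\<close>
definition jing :: "int \<Rightarrow> sym \<Rightarrow> sym" where
  "jing m f = (\<Sum>k<jing_bound f. qq (m + int k) * perp (qinv (int k)) f)"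

lemma jing_bound: "i \<ge> int (jing_bound f) \<Longrightarrow> perp (qinv i) f = 0"
proof -
  have "\<exists>N. \<forall>i\<ge>int N. perp (qinv i) f = 0" unfolding qinv_def by (rule perp_nw_finite)
  then have "\<forall>i\<ge>int (jing_bound f). perp (qinv i) f = 0"
    unfolding jing_bound_def by (rule LeastI_ex)
  then show "i \<ge> int (jing_bound f) \<Longrightarrow> perp (qinv i) f = 0" by blast
qed

text \<open>Any larger cut-off gives the same value, so operators on different arguments can be
  compared over one range.\<close>

lemma jing_conv:
  assumes "jing_bound f \<le> N"
  shows "jing m f = (\<Sum>k<N. qq (m + int k) * perp (qinv (int k)) f)"
  unfolding jing_def
  by (rule sum.mono_neutral_left) (use assms in \<open>auto intro: jing_bound\<close>)

lemma jing_add: "jing m (f + g) = jing m f + jing m g"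
proof -
  define N where "N = jing_bound f + jing_bound g + jing_bound (f + g)"
  have "jing m (f + g) = (\<Sum>k<N. qq (m + int k) * perp (qinv (int k)) (f + g))"
    "jing m f = (\<Sum>k<N. qq (m + int k) * perp (qinv (int k)) f)"
    "jing m g = (\<Sum>k<N. qq (m + int k) * perp (qinv (int k)) g)"
    by (rule jing_conv, simp add: N_def)+
  then show ?thesis by (simp add: perp_add_right ring_distribs sum.distrib)
qed

lemma jing_smul: "jing m (smul c f) = smul c (jing m f)"
proof -
  define N where "N = jing_bound f + jing_bound (smul c f)"
  have "jing m (smul c f) = (\<Sum>k<N. qq (m + int k) * perp (qinv (int k)) (smul c f))"
    "jing m f = (\<Sum>k<N. qq (m + int k) * perp (qinv (int k)) f)"
    by (rule jing_conv, simp add: N_def)+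
  then show ?thesis by (simp add: perp_smul_right smul_mult_right sym.scale_sum_right)
qed

lemma jing_one: "jing m 1 = qq m"
proof -
  have "jing m 1 = (\<Sum>k<Suc (jing_bound 1). qq (m + int k) * perp (qinv (int k)) 1)"
    by (rule jing_conv) simp
  also have "\<dots> = (\<Sum>k<Suc (jing_bound 1). if k = 0 then qq m else 0)"
    by (intro sum.cong) (auto simp: qinv_def perp_nw_one)
  finally show ?thesis by simp
qed

text \<open>The substitution X - 1/u turns p_n into p_n - u^(-n), and the factor u^(-n) moves the
  coefficient index from m to m + n.\<close>

lemma jing_psum: "jing m (psum n * f) = psum n * jing m f - jing (m + int (Suc n)) f"
proof -
  define N where "N = jing_bound f + jing_bound (psum n * f) + Suc n"
  have 1: "jing m (psum n * f) = (\<Sum>k<N. qq (m + int k) * perp (qinv (int k)) (psum n * f))"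
    by (rule jing_conv) (simp add: N_def)
  have 2: "jing m f = (\<Sum>k<N. qq (m + int k) * perp (qinv (int k)) f)"
    by (rule jing_conv) (simp add: N_def)
  have 3: "jing (m + int (Suc n)) f = (\<Sum>k<N - Suc n. qq (m + int (Suc n) + int k) * perp (qinv (int k)) f)"
    by (rule jing_conv) (simp add: N_def)
  have "(\<Sum>k<N. qq (m + int k) * perp (qinv (int k - 1 - int n)) f) = (\<Sum>k\<in>{Suc n..<N}. qq (m + int k) * perp (qinv (int k - 1 - int n)) f)"
    by (rule sum.mono_neutral_right) auto
  also have "\<dots> = jing (m + int (Suc n)) f"
    unfolding 3
    by (rule sum.reindex_bij_witness[of _ "\<lambda>k. k + Suc n" "\<lambda>k. k - Suc n"]) (auto simp: of_nat_diff algebra_simps)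
  finally have 4: "(\<Sum>k<N. qq (m + int k) * perp (qinv (int k - 1 - int n)) f) = jing (m + int (Suc n)) f" .
  show ?thesis
    unfolding 1 2 4[symmetric] perp_qinv_psum
    by (simp add: ring_distribs sum_subtractf sum_distrib_left mult_ac)
qed

text \<open>The adjoint of p_n is a derivation that commutes with the substitution X - 1/u and
  multiplies Q(u) by u^n, see \<open>pd_qq\<close>. The induction checks this by comparing the
  commutators of both sides with the power sums.\<close>

lemma pd_jing: "pd k (jing m f) = jing m (pd k f) + jing (m + (- 1) * int (Suc k)) f"
proof (induction f arbitrary: m rule: sym_induct)
  case one
  have "jing m 0 = 0" using jing_smul[of m 0 0] by simp
  then show ?case by (simp add: jing_one pd_qq algebra_simps)
next
  case (add f g)
  then show ?case by (simp add: jing_add pd_add)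
next
  case (smul c f)
  then show ?case by (simp add: jing_smul pd_smul sym.scale_right_distrib)
next
  case (psum n f)
  have eq: "m + - 1 * int (Suc k) + int (Suc n) = m + int (Suc n) + - 1 * int (Suc k)" by simp
  have d: "pd k (f - g) = pd k f - pd k g" for f g
    using perp_diff_right[of "psum k" f g] by (simp add: perp_psum)
  have "pd k (jing m (psum n * f)) = psum n * pd k (jing m f) + (if k = n then smul (zn n) (jing m f) else 0) - pd k (jing (m + int (Suc n)) f)"
    by (simp only: jing_psum d pd_psum)
  also have "\<dots> = psum n * (jing m (pd k f) + jing (m + - 1 * int (Suc k)) f) + (if k = n then smul (zn n) (jing m f) else 0)
     - (jing (m + int (Suc n)) (pd k f) + jing (m + int (Suc n) + - 1 * int (Suc k)) f)"
    unfolding psum.IH ..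
  also have "\<dots> = (psum n * jing m (pd k f) - jing (m + int (Suc n)) (pd k f)) + (if k = n then jing m (smul (zn n) f) else 0)
     + (psum n * jing (m + - 1 * int (Suc k)) f - jing (m + - 1 * int (Suc k) + int (Suc n)) f)"
    unfolding eq jing_smul by (simp only: ring_distribs) auto
  also have "\<dots> = jing m (pd k (psum n * f)) + jing (m + - 1 * int (Suc k)) (psum n * f)"
    unfolding jing_psum[symmetric] by (cases "k = n") (simp_all add: pd_psum jing_add)
  finally show ?case .
qed

interpretation jing_perp: shift_commutation perp jing "-1"
  by unfold_locales
     (simp_all only: perp_add_left perp_smul_left perp_add_right perp_one perp_mult jing_add jing_smul perp_psum pd_jing)

interpretation jing_times: shift_commutation "(*)" jing 1
  by unfold_locales (simp_all add: ring_distribs smul_mult_left mult.assoc jing_add jing_smul jing_psum)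

section \<open>Symmetrization over finite sets\<close>

text \<open>The parameter stays free because s = t leads to Hall-Littlewood and s = 0 to Schur
  polynomials.\<close>

definition hlfac :: "'a::field \<Rightarrow> 'a set \<Rightarrow> 'a \<Rightarrow> 'a" where
  "hlfac s A a = (\<Prod>b\<in>A - {a}. (a - s * b) / (a - b))"

lemma hlfac_insert:
  assumes "finite A" "c \<notin> A" "a \<in> A"
  shows "hlfac s (insert c A) a = hlfac s A a * ((a - s * c) / (a - c))"
proof -
  have "insert c A - {a} = insert c (A - {a})" using assms by auto
  then show ?thesis using assms by (simp add: hlfac_def mult.commute)
qed

lemma hlfac_insert_new: "c \<notin> A \<Longrightarrow> hlfac s (insert c A) c = (\<Prod>a\<in>A. (c - s * a) / (c - a))"
  by (simp add: hlfac_def)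

text \<open>Partial fractions of the product of (1 + s a v) / (1 + a v), cleared of denominators.\<close>
lemma prod_partial_fractions:
  fixes A :: "'a::field set"
  assumes "finite A"
  shows "(\<Prod>a\<in>A. 1 + s * a * v) =
    s ^ card A * (\<Prod>a\<in>A. 1 + a * v) + (1 - s) * (\<Sum>a\<in>A. hlfac s A a * (\<Prod>c\<in>A - {a}. 1 + c * v))"
  using assms
proof (induction A arbitrary: v rule: finite_induct)
  case empty
  show ?case by simp
next
  case (insert c A)
  define E where "E = (\<Prod>a\<in>A. 1 + a * v)"
  define Em where "Em a = (\<Prod>b\<in>A - {a}. 1 + b * v)" for a
  have E: "E = (1 + a * v) * Em a" if "a \<in> A" for a
    unfolding E_def Em_def using that insert.hyps(1) by (simp add: prod.remove)
  \<comment> \<open>The induction hypothesis at \<open>v = - 1 / c\<close>, the zero of the new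
    factor 1 + c v, gives the weight of the new letter. For \<open>c = 0\<close> there is no such
    point and the weight is computed directly.\<close>
  have W: "hlfac s (insert c A) c = s ^ card A + (1 - s) * (\<Sum>a\<in>A. hlfac s A a * (c / (c - a)))"
  proof (cases "c = 0")
    case True
    have "(\<Prod>a\<in>A. (c - s * a) / (c - a)) = (\<Prod>a\<in>A. s)"
      by (rule prod.cong) (use True insert.hyps in \<open>auto\<close>)
    then show ?thesis using True insert.hyps by (simp add: hlfac_insert_new)
  next
    case False
    have ne: "c - a \<noteq> 0" if "a \<in> A" for a using that insert.hyps by auto
    define P where "P = (\<Prod>a\<in>A. 1 + a * (- 1 / c))"
    have f: "1 + a * (- 1 / c) = (c - a) / c" "1 + s * a * (- 1 / c) = (c - s * a) / c" for a
      using False by (simp_all add: field_simps)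
    have P0: "P \<noteq> 0" unfolding P_def f using ne False insert.hyps by simp
    have Pa: "P = (c - a) / c * (\<Prod>b\<in>A - {a}. 1 + b * (- 1 / c))" if "a \<in> A" for a
      unfolding P_def f using that insert.hyps(1) by (simp add: prod.remove)
    have "hlfac s (insert c A) c = (\<Prod>a\<in>A. 1 + s * a * (- 1 / c)) / P"
      using insert.hyps False unfolding hlfac_insert_new[OF insert.hyps(2)] P_def f
      by (simp flip: prod_dividef)
    also have "\<dots> = s ^ card A + (1 - s) * (\<Sum>a\<in>A. hlfac s A a * (c / (c - a)))"
    proof -
      have "hlfac s A a * (\<Prod>b\<in>A - {a}. 1 + b * (- 1 / c)) = hlfac s A a * (c / (c - a)) * P" if "a \<in> A" for a
        using ne[OF that] False by (simp add: Pa[OF that])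
      then have "(\<Sum>a\<in>A. hlfac s A a * (\<Prod>b\<in>A - {a}. 1 + b * (- 1 / c))) = (\<Sum>a\<in>A. hlfac s A a * (c / (c - a))) * P"
        by (simp add: sum_distrib_right)
      then show ?thesis
        using P0 unfolding insert.IH[of "- 1 / c"] P_def[symmetric] by (simp add: field_simps)
    qed
    finally show ?thesis .
  qed
  \<comment> \<open>Through \<open>W\<close> each old letter receives a share of the weight of
    \<open>c\<close>; with its own term this combines to the new factor 1 + s c v.\<close>
  have key: "hlfac s (insert c A) a * ((1 + c * v) * Em a) + (1 - s) * (hlfac s A a * (c / (c - a))) * E
      = hlfac s A a * ((1 + s * c * v) * Em a)" if "a \<in> A" for a
  proof -
    have ne: "a - c \<noteq> 0" "c - a \<noteq> 0" using that insert.hyps by auto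
    have "(a - s * c) / (a - c) * (1 + c * v) + (1 - s) * (c / (c - a)) * (1 + a * v) = 1 + s * c * v"
    proof -
      have *: "c / (c - a) = - c / (a - c)" using ne by (simp add: field_simps)
      have "(a - s * c) / (a - c) * (1 + c * v) + (1 - s) * (c / (c - a)) * (1 + a * v) =
         ((a - s * c) * (1 + c * v) - (1 - s) * c * (1 + a * v)) / (a - c)"
        unfolding * by (simp only: divide_inverse ring_distribs mult_ac mult_minus_left mult_minus_right) simp
      also have "(a - s * c) * (1 + c * v) - (1 - s) * c * (1 + a * v) = (1 + s * c * v) * (a - c)"
        by (simp add: algebra_simps)
      finally show ?thesis using ne by simp
    qed
    then have "hlfac s A a * ((1 + s * c * v) * Em a) =
       hlfac s A a * (((a - s * c) / (a - c) * (1 + c * v) + (1 - s) * (c / (c - a)) * (1 + a * v)) * Em a)"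
      by simp
    also have "\<dots> = hlfac s (insert c A) a * ((1 + c * v) * Em a) + (1 - s) * (hlfac s A a * (c / (c - a))) * E"
      unfolding E[OF that] hlfac_insert[OF insert.hyps that] by (simp only: ring_distribs mult_ac)
    finally show ?thesis by simp
  qed
  have 1: "(\<Sum>a\<in>insert c A. hlfac s (insert c A) a * (\<Prod>b\<in>insert c A - {a}. 1 + b * v)) =
     hlfac s (insert c A) c * E + (\<Sum>a\<in>A. hlfac s (insert c A) a * ((1 + c * v) * Em a))"
  proof -
    have "(\<Prod>b\<in>insert c A - {a}. 1 + b * v) = (1 + c * v) * Em a" if "a \<in> A" for a
    proof -
      have "insert c A - {a} = insert c (A - {a})" using that insert.hyps by auto
      then show ?thesis using insert.hyps by (simp add: Em_def)
    qed
    then show ?thesis using insert.hyps by (simp add: E_def)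
  qed
  have "s ^ card (insert c A) * (\<Prod>a\<in>insert c A. 1 + a * v) + (1 - s) * (\<Sum>a\<in>insert c A. hlfac s (insert c A) a * (\<Prod>b\<in>insert c A - {a}. 1 + b * v))
    = s ^ card A * ((s * (1 + c * v) + (1 - s)) * E) + (1 - s) * ((\<Sum>a\<in>A. (1 - s) * (hlfac s A a * (c / (c - a))) * E)
      + (\<Sum>a\<in>A. hlfac s (insert c A) a * ((1 + c * v) * Em a)))"
    unfolding 1 W using insert.hyps
    by (simp add: E_def[symmetric] ring_distribs sum_distrib_left sum_distrib_right mult_ac)
  also have "\<dots> = s ^ card A * ((1 + s * c * v) * E) + (1 - s) * (\<Sum>a\<in>A. hlfac s A a * ((1 + s * c * v) * Em a))"
  proof -
    have "s * (1 + c * v) + (1 - s) = 1 + s * c * v" by (simp add: algebra_simps)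
    moreover have "(\<Sum>a\<in>A. (1 - s) * (hlfac s A a * (c / (c - a))) * E)
      + (\<Sum>a\<in>A. hlfac s (insert c A) a * ((1 + c * v) * Em a)) = (\<Sum>a\<in>A. hlfac s A a * ((1 + s * c * v) * Em a))"
      unfolding sum.distrib[symmetric] using key by (intro sum.cong refl) (simp only: add.commute)
    ultimately show ?thesis by simp
  qed
  also have "\<dots> = (1 + s * c * v) * (s ^ card A * E + (1 - s) * (\<Sum>a\<in>A. hlfac s A a * Em a))"
  proof -
    have "(\<Sum>a\<in>A. hlfac s A a * ((1 + s * c * v) * Em a)) = (1 + s * c * v) * (\<Sum>a\<in>A. hlfac s A a * Em a)"
      unfolding sum_distrib_left by (simp only: mult.left_commute)
    then show ?thesis by (simp only:) (simp add: algebra_simps)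
  qed
  also have "\<dots> = (\<Prod>a\<in>insert c A. 1 + s * a * v)"
    using insert by (simp add: E_def Em_def)
  finally show ?case by simp
qed

lemma sum_hlfac:
  fixes A :: "'a::field set"
  assumes "finite A"
  shows "s ^ card A + (1 - s) * (\<Sum>a\<in>A. hlfac s A a) = 1"
  using prod_partial_fractions[OF assms, of s 0] by simp

text \<open>The coefficient of u^m in the partial fraction expansion of prod (1 - t a u) / (1 - a
  u), that is, the value of q_m. The constant \<open>tt ^ card A\<close> of the expansion is visible
  only for m = 0.\<close>

definition wval :: "nat \<Rightarrow> qt set \<Rightarrow> qt" where
  "wval m A = (if m = 0 then tt ^ card A else 0) + (1 - tt) * (\<Sum>a\<in>A. a ^ m * hlfac tt A a)"

lemma wval_0: "finite A \<Longrightarrow> wval 0 A = 1"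
  by (simp add: wval_def sum_hlfac)

text \<open>Coefficient form of (1 - c u) W(A + c) = (1 - t c u) W(A). The factor a - c cancels the
  denominator of the new weight and removes the term of \<open>c\<close> itself.\<close>

lemma wval_insert:
  assumes "finite A" "c \<notin> A"
  shows "wval (Suc m) (insert c A) - c * wval m (insert c A) = wval (Suc m) A - tt * c * wval m A"
proof -
  have "(\<Sum>a\<in>insert c A. a ^ Suc m * hlfac tt (insert c A) a) - c * (\<Sum>a\<in>insert c A. a ^ m * hlfac tt (insert c A) a) =
      (\<Sum>a\<in>insert c A. (a - c) * (a ^ m * hlfac tt (insert c A) a))"
    by (simp add: sum_distrib_left sum_subtractf ring_distribs mult_ac)
  also have "\<dots> = (\<Sum>a\<in>A. (a - c) * (a ^ m * hlfac tt (insert c A) a))"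
    using assms by simp
  also have "\<dots> = (\<Sum>a\<in>A. (a - tt * c) * (a ^ m * hlfac tt A a))"
  proof (rule sum.cong[OF refl])
    fix a assume a: "a \<in> A"
    then have "a - c \<noteq> 0" using assms by auto
    then show "(a - c) * (a ^ m * hlfac tt (insert c A) a) = (a - tt * c) * (a ^ m * hlfac tt A a)"
      by (simp add: hlfac_insert[OF assms a])
  qed
  also have "\<dots> = (\<Sum>a\<in>A. a ^ Suc m * hlfac tt A a) - tt * c * (\<Sum>a\<in>A. a ^ m * hlfac tt A a)"
    by (simp add: sum_distrib_left sum_subtractf ring_distribs mult_ac)
  finally have *: "(\<Sum>a\<in>insert c A. a ^ Suc m * hlfac tt (insert c A) a) - c * (\<Sum>a\<in>insert c A. a ^ m * hlfac tt (insert c A) a) =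
     (\<Sum>a\<in>A. a ^ Suc m * hlfac tt A a) - tt * c * (\<Sum>a\<in>A. a ^ m * hlfac tt A a)" .
  have "wval (Suc m) (insert c A) - c * wval m (insert c A) =
    (1 - tt) * ((\<Sum>a\<in>insert c A. a ^ Suc m * hlfac tt (insert c A) a) - c * (\<Sum>a\<in>insert c A. a ^ m * hlfac tt (insert c A) a))
     - c * (if m = 0 then tt ^ Suc (card A) else 0)"
    unfolding wval_def using assms by (simp only: ring_distribs card_insert_disjoint if_False nat.simps) (simp add: algebra_simps)
  also have "\<dots> = wval (Suc m) A - tt * c * wval m A"
    unfolding * wval_def by (simp add: algebra_simps)
  finally show ?thesis .
qed

text \<open>Logarithmic derivative of the product: a letter c contributes c / (1 - c u) - t c / (1 -
  t c u), with coefficients (1 - t^n) c^n.\<close>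

lemma wval_newton:
  assumes "finite A"
  shows "of_nat (Suc r) * wval (Suc r) A = (\<Sum>k\<le>r. (1 - tt ^ Suc k) * (\<Sum>a\<in>A. a ^ Suc k) * wval (r - k) A)"
proof -
  define W where "W A = Abs_fps (\<lambda>m. wval m A)" for A
  define C where "C A = Abs_fps (\<lambda>k. (1 - tt ^ Suc k) * (\<Sum>a\<in>A. a ^ Suc k))" for A :: "qt set"
  define L where "L c = 1 - fps_const c * fps_X" for c :: qt
  define G where "G c = Abs_fps (\<lambda>k. c ^ Suc k)" for c :: qt
  have LG: "L c * G c = fps_const c" for c
  proof (rule fps_ext)
    fix n show "fps_nth (L c * G c) n = fps_nth (fps_const c) n"
      by (cases n) (simp_all add: L_def G_def ring_distribs mult.assoc)
  qed
  have dL: "fps_deriv (L c) = - fps_const c" for c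
    by (simp add: L_def)
  have L0: "L c \<noteq> 0" for c
  proof
    assume "L c = 0"
    then have "fps_nth (L c) 0 = 0" by simp
    then show False by (simp add: L_def)
  qed
  have "fps_deriv (W A) = C A * W A" using assms
  proof (induction A rule: finite_induct)
    case empty
    have "W {} = 1" unfolding W_def by (rule fps_ext) (simp add: wval_def)
    then show ?case by (simp add: C_def)  (simp add: fps_eq_iff)
  next
    case (insert c A)
    have rec: "L c * W (insert c A) = L (tt * c) * W A"
    proof (rule fps_ext)
      fix n show "fps_nth (L c * W (insert c A)) n = fps_nth (L (tt * c) * W A) n"
        using insert.hyps wval_insert[OF insert.hyps]
        by (cases n) (simp_all add: L_def W_def ring_distribs mult.assoc wval_0)
    qed
    have Cc: "C (insert c A) = C A + (G c - G (tt * c))"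
      using insert.hyps by (intro fps_ext) (simp add: C_def G_def algebra_simps power_mult_distrib)
    have "fps_deriv (L c * W (insert c A)) = fps_deriv (L (tt * c) * W A)" by (simp only: rec)
    then have d: "L c * fps_deriv (W (insert c A)) - fps_const c * W (insert c A)
       = L (tt * c) * (C A * W A) - fps_const (tt * c) * W A"
      by (simp add: dL insert.IH algebra_simps del: fps_const_neg)
    \<comment> \<open>Multiplying by both linear factors avoids dividing power series; they are
      cancelled at the end.\<close>
    have "L (tt * c) * L c * fps_deriv (W (insert c A)) =
       L (tt * c) * (fps_const c * W (insert c A)) + L (tt * c) * (L c * fps_deriv (W (insert c A)) - fps_const c * W (insert c A))"
      by (simp add: algebra_simps)
    also have "\<dots> = L (tt * c) * (fps_const c * W (insert c A)) + L (tt * c) * C A * (L (tt * c) * W A) - fps_const (tt * c) * (L (tt * c) * W A)"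
      unfolding d by (simp add: algebra_simps del: fps_const_neg)
    also have "\<dots> = L (tt * c) * (L c * G c * W (insert c A)) + L (tt * c) * C A * (L c * W (insert c A)) - L (tt * c) * G (tt * c) * (L c * W (insert c A))"
      unfolding LG rec ..
    also have "\<dots> = L (tt * c) * L c * (C (insert c A) * W (insert c A))"
      unfolding Cc by (simp add: algebra_simps)
    finally show ?case using L0 by (metis mult_cancel_left no_zero_divisors)
  qed
  then have "fps_nth (fps_deriv (W A)) r = fps_nth (C A * W A) r" by simp
  then show ?thesis by (simp add: W_def C_def fps_mult_nth atLeast0AtMost)
qed

lemma evA_qq:
  assumes "finite A"
  shows "evA A (qq (int m)) = wval m A"
  unfolding evA_def qq_def
  by (rule evp_nw) (use assms in \<open>simp_all only: wval_0 wval_newton\<close>)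

text \<open>For f = 1 this is \<open>wval\<close>. Multiplying \<open>f\<close> by p_n preserves the
  formula, because deleting \<open>a\<close> lowers the value of p_n by a^n, and this matches the
  shift from m to m + n in \<open>jing_psum\<close>.\<close>

lemma evA_jing:
  assumes "finite A"
  shows "evA A (jing (int m) f) = (if m = 0 then tt ^ card A * evA A f else 0)
     + (1 - tt) * (\<Sum>a\<in>A. a ^ m * hlfac tt A a * evA (A - {a}) f)"
proof (induction f arbitrary: m rule: sym_induct)
  case one
  show ?case by (simp add: jing_one evA_qq assms wval_def evA_simps)
next
  case (add f g)
  then show ?case by (simp add: jing_add evA_simps ring_distribs sum.distrib)
next
  case (smul c f)
  then show ?case by (simp add: jing_smul evA_simps ring_distribs sum_distrib_left mult_ac)
next
  case (psum n f)
  have r: "(\<Sum>b\<in>A - {a}. b ^ Suc n) = (\<Sum>b\<in>A. b ^ Suc n) - a ^ Suc n" if "a \<in> A" for a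
    using assms that by (simp add: sum_diff1)
  have "evA A (jing (int m) (psum n * f)) =
     (\<Sum>b\<in>A. b ^ Suc n) * evA A (jing (int m) f) - evA A (jing (int (m + Suc n)) f)"
    by (simp only: jing_psum evA_simps of_nat_add)
  also have "\<dots> = (if m = 0 then tt ^ card A * ((\<Sum>b\<in>A. b ^ Suc n) * evA A f) else 0)
     + (1 - tt) * (\<Sum>a\<in>A. a ^ m * hlfac tt A a * (((\<Sum>b\<in>A. b ^ Suc n) - a ^ Suc n) * evA (A - {a}) f))"
    unfolding psum.IH
    by (simp add: ring_distribs sum_distrib_left sum_subtractf sum_negf power_add mult_ac)
  also have "(\<Sum>a\<in>A. a ^ m * hlfac tt A a * (((\<Sum>b\<in>A. b ^ Suc n) - a ^ Suc n) * evA (A - {a}) f)) =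
    (\<Sum>a\<in>A. a ^ m * hlfac tt A a * evA (A - {a}) (psum n * f))"
    by (intro sum.cong refl) (simp only: evA_simps r)
  finally show ?case by (simp only: evA_simps)
qed

lemma sum_antisym_pairs:
  fixes g :: "'a \<Rightarrow> 'a \<Rightarrow> 'b::{idom, ring_char_0}"
  assumes "finite A" and "\<And>a b. a \<in> A \<Longrightarrow> b \<in> A \<Longrightarrow> a \<noteq> b \<Longrightarrow> g a b = - g b a"
  shows "(\<Sum>a\<in>A. \<Sum>b\<in>A - {a}. g a b) = 0"
proof -
  define h where "h a b = (if a = b then 0 else g a b)" for a b
  have "(\<Sum>a\<in>A. \<Sum>b\<in>A - {a}. g a b) = (\<Sum>a\<in>A. \<Sum>b\<in>A. h a b)"
  proof (rule sum.cong[OF refl])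
    fix a assume "a \<in> A"
    have "(\<Sum>b\<in>A - {a}. g a b) = (\<Sum>b\<in>A - {a}. h a b)"
      by (intro sum.cong) (auto simp: h_def)
    also have "\<dots> = (\<Sum>b\<in>A. h a b)"
      by (rule sum.mono_neutral_left) (use assms(1) in \<open>auto simp: h_def\<close>)
    finally show "(\<Sum>b\<in>A - {a}. g a b) = (\<Sum>b\<in>A. h a b)" .
  qed
  also have "(\<Sum>a\<in>A. \<Sum>b\<in>A. h a b) = 0"
  proof -
    have "(\<Sum>a\<in>A. \<Sum>b\<in>A. h a b) = (\<Sum>b\<in>A. \<Sum>a\<in>A. h a b)" by (rule sum.swap)
    also have "\<dots> = (\<Sum>b\<in>A. \<Sum>a\<in>A. - h b a)"
      by (intro sum.cong refl) (auto simp: h_def intro: assms(2))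
    also have "\<dots> = - (\<Sum>a\<in>A. \<Sum>b\<in>A. h a b)" by (simp add: sum_negf)
    finally show ?thesis by (simp add: eq_neg_iff_add_eq_0 flip: mult_2)
  qed
  finally show ?thesis .
qed

text \<open>On an alphabet both sides are double sums over pairs of letters. The difference has the
  summand a^m b^m (b - t a) \<open>F a b\<close>, and \<open>F a b\<close> contains (a - t b) / (a -
  b), so it is antisymmetric.\<close>

lemma jing_straighten: "jing (int m) (jing (int m + 1) f) = smul tt (jing (int m + 1) (jing (int m) f))"
proof (rule evA_eqI)
  fix A :: "qt set" assume A: "finite A"
  have i: "int m + 1 = int (Suc m)" by simp
  define F where "F a b = hlfac tt A a * hlfac tt (A - {a}) b * evA (A - {a} - {b}) f" for a b
  define c where "c = (if m = 0 then tt ^ card A * ((1 - tt) * (\<Sum>a\<in>A. a ^ Suc m * hlfac tt A a * evA (A - {a}) f)) else 0)"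
  have l: "evA A (jing (int m) (jing (int m + 1) f)) = c + (1 - tt) * (1 - tt) * (\<Sum>a\<in>A. \<Sum>b\<in>A - {a}. a ^ m * b ^ Suc m * F a b)"
    unfolding i evA_jing[OF A] c_def
    using A by (simp add: evA_jing[of "A - {_}"] evA_jing[OF A, of "Suc m"] F_def sum_distrib_left mult_ac del: of_nat_Suc)
  have "evA A (jing (int m + 1) (jing (int m) f)) = (1 - tt) * (\<Sum>a\<in>A. a ^ Suc m * hlfac tt A a * evA (A - {a}) (jing (int m) f))"
    unfolding i evA_jing[OF A] by simp
  also have "(\<Sum>a\<in>A. a ^ Suc m * hlfac tt A a * evA (A - {a}) (jing (int m) f)) =
     (if m = 0 then tt ^ (card A - 1) * (\<Sum>a\<in>A. a ^ Suc m * hlfac tt A a * evA (A - {a}) f) else 0)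
       + (1 - tt) * (\<Sum>a\<in>A. \<Sum>b\<in>A - {a}. a ^ Suc m * b ^ m * F a b)"
  proof -
    have "a ^ Suc m * hlfac tt A a * evA (A - {a}) (jing (int m) f) =
       (if m = 0 then tt ^ (card A - 1) * (a ^ Suc m * hlfac tt A a * evA (A - {a}) f) else 0)
       + (1 - tt) * (\<Sum>b\<in>A - {a}. a ^ Suc m * b ^ m * F a b)" if "a \<in> A" for a
      using A that by (simp add: evA_jing[of "A - {_}"] F_def sum_distrib_left ring_distribs mult_ac)
    then show ?thesis by (cases "m = 0") (simp_all add: sum.distrib sum_distrib_left)
  qed
  finally have r0: "evA A (jing (int m + 1) (jing (int m) f)) =
     (1 - tt) * ((if m = 0 then tt ^ (card A - 1) * (\<Sum>a\<in>A. a ^ Suc m * hlfac tt A a * evA (A - {a}) f) else 0)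
       + (1 - tt) * (\<Sum>a\<in>A. \<Sum>b\<in>A - {a}. a ^ Suc m * b ^ m * F a b))" .
  \<comment> \<open>The exceptional terms for m = 0 agree: \<open>jing 0\<close> sees
    \<open>card A\<close> letters when applied last and one letter less when applied first, and
    \<open>tt\<close> makes up for it.\<close>
  have c': "c = tt * ((1 - tt) * (if m = 0 then tt ^ (card A - 1) * (\<Sum>a\<in>A. a ^ Suc m * hlfac tt A a * evA (A - {a}) f) else 0))"
  proof (cases "A = {}")
    case False
    then have "card A \<noteq> 0" using A by simp
    then have "tt ^ card A = tt * tt ^ (card A - 1)" by (simp add: power_eq_if)
    then show ?thesis by (simp only: c_def) (simp add: mult_ac)
  qed (simp add: c_def)
  have r: "tt * evA A (jing (int m + 1) (jing (int m) f)) =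
     c + (1 - tt) * (1 - tt) * (tt * (\<Sum>a\<in>A. \<Sum>b\<in>A - {a}. a ^ Suc m * b ^ m * F a b))"
    unfolding r0 c' by (simp only: ring_distribs(1) mult_ac)
  have "(\<Sum>a\<in>A. \<Sum>b\<in>A - {a}. a ^ m * b ^ m * (b - tt * a) * F a b) = 0"
  proof (rule sum_antisym_pairs[OF A])
    fix a b assume ab: "a \<in> A" "b \<in> A" "a \<noteq> b"
    define B where "B = A - {a} - {b}"
    define e where "e a = (\<Prod>c\<in>B. (a - tt * c) / (a - c))" for a
    have B: "A - {a} = insert b B" "A - {b} = insert a B" "a \<notin> B" "b \<notin> B" "finite B" "A - {b} - {a} = B"
      using ab A by (auto simp: B_def)
    have h: "hlfac tt A a = (a - tt * b) / (a - b) * e a" "hlfac tt (A - {a}) b = e b"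
      "hlfac tt A b = (b - tt * a) / (b - a) * e b" "hlfac tt (A - {b}) a = e a"
      using B by (simp_all add: hlfac_def e_def)
    have "(a - tt * b) / (a - b) = - ((a - tt * b) / (b - a))" "a - b \<noteq> 0" "b - a \<noteq> 0"
      using ab by (simp_all add: field_simps)
    then show "a ^ m * b ^ m * (b - tt * a) * F a b = - (b ^ m * a ^ m * (a - tt * b) * F b a)"
      unfolding F_def h B_def[symmetric] B(6) by (simp add: mult_ac)
  qed
  then have "(\<Sum>a\<in>A. \<Sum>b\<in>A - {a}. a ^ m * b ^ Suc m * F a b) = tt * (\<Sum>a\<in>A. \<Sum>b\<in>A - {a}. a ^ Suc m * b ^ m * F a b)"
    by (simp add: ring_distribs sum_subtractf sum_distrib_left mult_ac)
  then show "evA A (jing (int m) (jing (int m + 1) f)) = evA A (smul tt (jing (int m + 1) (jing (int m) f)))"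
    unfolding evA_simps l r by simp
qed

section \<open>Identification of the symmetric functions\<close>

definition esym :: "'a::comm_ring_1 set \<Rightarrow> nat \<Rightarrow> 'a" where
  "esym A r = coeff (\<Prod>a\<in>A. [:1, a:]) r"

lemma esym_remove:
  assumes "finite A" "a \<in> A"
  shows "esym A (Suc r) = esym (A - {a}) (Suc r) + a * esym (A - {a}) r"
proof -
  have "(\<Prod>a\<in>A. [:1, a:]) = [:1, a:] * (\<Prod>a\<in>A - {a}. [:1, a:])"
    using assms by (simp add: prod.remove)
  then show ?thesis by (simp add: esym_def)
qed

lemma coeff_prod_scaled:
  "finite A \<Longrightarrow> coeff (\<Prod>a\<in>A. [:1, s * a:]) r = s ^ r * coeff (\<Prod>a\<in>A. [:1, a :: 'a::comm_ring_1:]) r"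
proof (induction A arbitrary: r rule: finite_induct)
  case empty
  then show ?case by (cases r) simp_all
next
  case (insert a A)
  then show ?case by (cases r) (simp_all add: algebra_simps)
qed

text \<open>The coefficient of v^(r+1) in \<open>prod_partial_fractions\<close>; after
  \<open>esym_remove\<close>, \<open>sum_hlfac\<close> absorbs the term with
  \<open>s ^ card A\<close>.\<close>

lemma sum_hlfac_esym:
  fixes A :: "'a::{field,ring_char_0} set"
  assumes A: "finite A"
  shows "(1 - s) * (\<Sum>a\<in>A. a * hlfac s A a * esym (A - {a}) r) = (1 - s ^ Suc r) * esym A (Suc r)"
proof -
  have "(\<Prod>a\<in>A. [:1, s * a:]) = smult (s ^ card A) (\<Prod>a\<in>A. [:1, a:])
     + smult (1 - s) (\<Sum>a\<in>A. smult (hlfac s A a) (\<Prod>c\<in>A - {a}. [:1, c:]))"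
  proof (rule poly_eq_poly_eq_iff[THEN iffD1], rule ext)
    fix v
    show "poly (\<Prod>a\<in>A. [:1, s * a:]) v = poly (smult (s ^ card A) (\<Prod>a\<in>A. [:1, a:])
     + smult (1 - s) (\<Sum>a\<in>A. smult (hlfac s A a) (\<Prod>c\<in>A - {a}. [:1, c:]))) v"
      using prod_partial_fractions[OF A, of s v]
      by (simp add: poly_prod poly_sum mult.commute[of v])
  qed
  then have "coeff (\<Prod>a\<in>A. [:1, s * a:]) (Suc r) = coeff (smult (s ^ card A) (\<Prod>a\<in>A. [:1, a:])
     + smult (1 - s) (\<Sum>a\<in>A. smult (hlfac s A a) (\<Prod>c\<in>A - {a}. [:1, c:]))) (Suc r)"
    by simp
  then have "s ^ Suc r * esym A (Suc r) = s ^ card A * esym A (Suc r) + (1 - s) * (\<Sum>a\<in>A. hlfac s A a * esym (A - {a}) (Suc r))"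
    unfolding coeff_prod_scaled[OF A] by (simp add: esym_def coeff_sum)
  also have "(\<Sum>a\<in>A. hlfac s A a * esym (A - {a}) (Suc r)) = (\<Sum>a\<in>A. hlfac s A a * esym A (Suc r) - a * hlfac s A a * esym (A - {a}) r)"
    by (intro sum.cong refl) (simp add: esym_remove[OF A] algebra_simps)
  also have "\<dots> = (\<Sum>a\<in>A. hlfac s A a) * esym A (Suc r) - (\<Sum>a\<in>A. a * hlfac s A a * esym (A - {a}) r)"
    by (simp add: sum_subtractf sum_distrib_right)
  finally have "s ^ Suc r * esym A (Suc r) = (s ^ card A + (1 - s) * (\<Sum>a\<in>A. hlfac s A a)) * esym A (Suc r)
     - (1 - s) * (\<Sum>a\<in>A. a * hlfac s A a * esym (A - {a}) r)"
    by (simp add: algebra_simps)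
  then show ?thesis unfolding sum_hlfac[OF A] by (simp add: algebra_simps)
qed

section \<open>Elementary symmetric polynomials\<close>

lemma elem_n_coeff: "elem_n r n x = coeff (\<Prod>i<n. [:1, x i:]) r"
proof -
  have "(\<Prod>i<n. [:1, x i:]) = (\<Prod>i<n. monom (x i) 1 + 1)"
    by (intro prod.cong refl) (simp add: monom_altdef one_pCons)
  also have "\<dots> = (\<Sum>X\<in>Pow {..<n}. (\<Prod>i\<in>X. monom (x i) 1) * (\<Prod>i\<in>{..<n} - X. 1))"
    by (rule prod_add) simp
  also have "\<dots> = (\<Sum>X\<in>Pow {..<n}. monom (\<Prod>i\<in>X. x i) (card X))"
  proof (intro sum.cong refl)
    fix X assume "X \<in> Pow {..<n}"
    then have "finite X" by (auto intro: finite_subset)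
    then have "(\<Prod>i\<in>X. monom (x i) 1) = monom (\<Prod>i\<in>X. x i) (card X)"
      by (induction X rule: finite_induct) (simp_all add: mult_monom)
    then show "(\<Prod>i\<in>X. monom (x i) 1) * (\<Prod>i\<in>{..<n} - X. 1) = monom (\<Prod>i\<in>X. x i) (card X)" by simp
  qed
  finally have "coeff (\<Prod>i<n. [:1, x i:]) r = (\<Sum>X\<in>Pow {..<n}. if card X = r then \<Prod>i\<in>X. x i else 0)"
    by (simp add: coeff_sum)
  also have "\<dots> = (\<Sum>X\<in>{X \<in> Pow {..<n}. card X = r}. \<Prod>i\<in>X. x i)"
    by (subst sum.inter_filter) simp_all
  also have "{X \<in> Pow {..<n}. card X = r} = {X. X \<subseteq> {..<n} \<and> card X = r}" by auto
  finally show ?thesis by (simp add: elem_n_def)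
qed

lemma elem_n_inj: "inj_on x {..<n} \<Longrightarrow> elem_n r n x = esym (x ` {..<n}) r"
  unfolding elem_n_coeff esym_def by (simp add: prod.reindex)

text \<open>Logarithmic derivative of prod (1 + x_i u), one variable at a time. Tuples with repeated
  entries are included because \<open>elem\<close> is specified on them too.\<close>

lemma elem_n_newton:
  "of_nat (Suc r) * elem_n (Suc r) n x = (\<Sum>k\<le>r. (- 1) ^ k * (\<Sum>i<n. x i ^ Suc k) * elem_n (r - k) n x)"
proof -
  define E where "E n = Abs_fps (\<lambda>r. elem_n r n x)" for n
  define C where "C n = Abs_fps (\<lambda>k. (- 1) ^ k * (\<Sum>i<n. x i ^ Suc k))" for n
  have "fps_deriv (E n) = C n * E n"
  proof (induction n)
    case 0
    have "E 0 = 1" by (rule fps_ext) (simp add: E_def elem_n_coeff)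
    moreover have "C 0 = 0" by (rule fps_ext) (simp add: C_def)
    ultimately show ?case by simp
  next
    case (Suc n)
    define c where "c = x n"
    define G where "G = Abs_fps (\<lambda>k. (- 1) ^ k * c ^ Suc k)"
    have E: "E (Suc n) = (1 + fps_const c * fps_X) * E n"
    proof (rule fps_ext)
      fix m show "fps_nth (E (Suc n)) m = fps_nth ((1 + fps_const c * fps_X) * E n) m"
        by (cases m) (simp_all add: E_def elem_n_coeff c_def ring_distribs mult.assoc mult.commute[of _ "[:1, x n:]"])
    qed
    have G: "G * (1 + fps_const c * fps_X) = fps_const c"
    proof (rule fps_ext)
      fix m show "fps_nth (G * (1 + fps_const c * fps_X)) m = fps_nth (fps_const c) m"
        by (cases m) (simp_all add: G_def ring_distribs mult.left_commute[of _ "fps_const c"] mult.commute[of _ "fps_X"] mult.left_commute)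
    qed
    have C: "C (Suc n) = C n + G"
      by (rule fps_ext) (simp add: C_def G_def c_def ring_distribs)
    have "fps_deriv (E (Suc n)) = fps_const c * E n + (1 + fps_const c * fps_X) * (C n * E n)"
      unfolding E by (simp add: Suc.IH algebra_simps)
    also have "\<dots> = G * (1 + fps_const c * fps_X) * E n + (1 + fps_const c * fps_X) * (C n * E n)"
      by (simp only: G)
    also have "\<dots> = C (Suc n) * E (Suc n)"
      unfolding E C by (simp add: algebra_simps)
    finally show ?case .
  qed
  then have "fps_nth (fps_deriv (E n)) r = fps_nth (C n * E n) r" by simp
  then show ?thesis by (simp add: E_def C_def fps_mult_nth atLeast0AtMost)
qed

lemma ev_ee: "ev n (ee (int r)) x = elem_n r n x"
  unfolding ev_conv ee_def
proof (rule evp_nw)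
  show "elem_n 0 n x = 1"
    unfolding elem_n_coeff poly_0_coeff_0[symmetric] by (simp add: poly_prod)
qed (rule elem_n_newton)

lemma ev_eqI:
  assumes "\<And>n x. inj_on x {..<n} \<Longrightarrow> ev n f x = ev n g x"
  shows "f = g"
proof (rule evA_eqI)
  fix A :: "qt set" assume "finite A"
  then obtain h where h: "bij_betw h {0..<card A} A" using ex_bij_betw_nat_finite by blast
  then have "inj_on h {..<card A}" "h ` {..<card A} = A"
    by (auto simp: bij_betw_def atLeast0LessThan)
  then show "evA A f = evA A g" using assms[of h "card A"] by (simp add: ev_evA)
qed

text \<open>Injective tuples separate symmetric functions, so the descriptions of \<open>HLP\<close>
  and \<open>schur\<close> are unique and a function with the right values is the one
  described.\<close>

lemma the_ev_eqI:
  assumes "\<And>n x. inj_on x {..<n} \<Longrightarrow> ev n f x = F n x"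
  shows "(THE f. \<forall>n x. inj_on x {..<n} \<longrightarrow> ev n f x = F n x) = f"
  using assms by (intro the_equality) (auto intro!: ev_eqI)

lemma elem_ee: "elem r = ee (int r)"
  unfolding elem_def by (rule the_equality) (auto intro!: ev_eqI simp: ev_ee)

text \<open>Symmetrization organized by the letter that carries the first exponent: its factors with
  all other remaining letters form \<open>hlfac\<close>. This is the shape of
  \<open>evA_jing\<close>.\<close>

fun hlsym :: "'a::field \<Rightarrow> nat list \<Rightarrow> 'a set \<Rightarrow> 'a" where
  "hlsym s [] A = 1"
| "hlsym s (m # ms) A = (\<Sum>a\<in>A. a ^ m * hlfac s A a * hlsym s ms (A - {a}))"

text \<open>Splitting the permutations by the image \<open>b\<close> of the first index
  \<open>k\<close> gives one step of \<open>hlsym\<close>. Downward induction on \<open>k\<close>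
  keeps all index positions unchanged.\<close>

lemma hlsym_symmetrization:
  assumes "inj_on x {k..<n}" "k \<le> n"
  shows "(\<Sum>w | w permutes {k..<n}. (\<Prod>i\<in>{k..<n}. x (w i) ^ \<alpha> i) *
     (\<Prod>i\<in>{k..<n}. \<Prod>j\<in>{i<..<n}. (x (w i) - s * x (w j)) / (x (w i) - x (w j)))) =
     hlsym s (map \<alpha> [k..<n]) (x ` {k..<n})"
  using assms(2,1)
proof (induction k arbitrary: x rule: inc_induct)
  case base
  have "{w. w permutes {n..<n}} = {id}" by auto
  then show ?case by simp
next
  case (step k)
  define S where "S = {Suc k..<n}"
  have kS: "{k..<n} = insert k S" "k \<notin> S" "finite S" using step by (auto simp: S_def)
  define F where "F x w = (\<Prod>i\<in>{k..<n}. x (w i) ^ \<alpha> i) *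
     (\<Prod>i\<in>{k..<n}. \<Prod>j\<in>{i<..<n}. (x (w i) - s * x (w j)) / (x (w i) - x (w j)))" for x :: "nat \<Rightarrow> 'a" and w
  define F' where "F' x w = (\<Prod>i\<in>S. x (w i) ^ \<alpha> i) *
     (\<Prod>i\<in>S. \<Prod>j\<in>{i<..<n}. (x (w i) - s * x (w j)) / (x (w i) - x (w j)))" for x :: "nat \<Rightarrow> 'a" and w
  have "(\<Sum>w | w permutes {k..<n}. F x w) = (\<Sum>b\<in>insert k S. \<Sum>q | q permutes S. F x (transpose k b \<circ> q))"
    unfolding kS(1) by (rule sum_over_permutations_insert) (use kS in auto)
  also have "\<dots> = (\<Sum>b\<in>{k..<n}. x b ^ \<alpha> k * hlfac s (x ` {k..<n}) (x b) * hlsym s (map \<alpha> [Suc k..<n]) (x ` {k..<n} - {x b}))"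
    unfolding kS(1)[symmetric]
  proof (rule sum.cong[OF refl])
    fix b assume b: "b \<in> {k..<n}"
    \<comment> \<open>The transposition is absorbed into the variables; beyond \<open>k\<close> the
      tuple \<open>x'\<close> runs over the letters of \<open>x\<close> other than
      \<open>x b\<close>.\<close>
    define x' where "x' = x \<circ> transpose k b"
    have tr: "transpose k b ` {k..<n} = {k..<n}" using b by simp
    have inj: "inj_on x' {k..<n}"
      unfolding x'_def by (rule comp_inj_on) (use tr step.prems in auto)
    have x'k: "x' k = x b" by (simp add: x'_def)
    have im: "x' ` {k..<n} = x ` {k..<n}" unfolding x'_def image_comp[symmetric] tr ..
    have injS: "inj_on x' S" by (rule inj_on_subset[OF inj]) (use kS in auto)
    have imS: "x' ` S = x ` {k..<n} - {x b}"
    proof -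
      have "x' ` S = x' ` {k..<n} - {x' k}"
        using inj kS by (auto simp: inj_on_def)
      then show ?thesis by (simp add: im x'k)
    qed
    have "F x (transpose k b \<circ> q) = x b ^ \<alpha> k * hlfac s (x ` {k..<n}) (x b) * F' x' q" if q: "q permutes S" for q
    proof -
      have qk: "q k = k" using q kS by (auto intro: permutes_not_in)
      have "{k<..<n} = S" by (auto simp: S_def)
      then have "F x (transpose k b \<circ> q) = x b ^ \<alpha> k * (\<Prod>j\<in>S. (x b - s * x' (q j)) / (x b - x' (q j))) * F' x' q"
        unfolding F_def F'_def kS(1) using kS qk by (simp add: x'_def mult_ac)
      also have "(\<Prod>j\<in>S. (x b - s * x' (q j)) / (x b - x' (q j))) = (\<Prod>j\<in>S. (x b - s * x' j) / (x b - x' j))"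
        by (rule prod.permute[OF q, unfolded o_def, symmetric])
      also have "\<dots> = (\<Prod>c\<in>x' ` S. (x b - s * c) / (x b - c))"
        by (simp add: prod.reindex[OF injS])
      also have "\<dots> = hlfac s (x ` {k..<n}) (x b)"
        by (simp add: imS hlfac_def)
      finally show ?thesis .
    qed
    then have "(\<Sum>q | q permutes S. F x (transpose k b \<circ> q)) =
      x b ^ \<alpha> k * hlfac s (x ` {k..<n}) (x b) * (\<Sum>q | q permutes S. F' x' q)"
      by (simp add: sum_distrib_left)
    also have "(\<Sum>q | q permutes S. F' x' q) = hlsym s (map \<alpha> [Suc k..<n]) (x' ` S)"
      unfolding F'_def S_def by (rule step.IH) (use injS in \<open>simp add: S_def\<close>)
    finally show "(\<Sum>q | q permutes S. F x (transpose k b \<circ> q)) =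
      x b ^ \<alpha> k * hlfac s (x ` {k..<n}) (x b) * hlsym s (map \<alpha> [Suc k..<n]) (x ` {k..<n} - {x b})"
      unfolding imS .
  qed
  also have "\<dots> = (\<Sum>a\<in>x ` {k..<n}. a ^ \<alpha> k * hlfac s (x ` {k..<n}) a * hlsym s (map \<alpha> [Suc k..<n]) (x ` {k..<n} - {a}))"
    by (simp add: sum.reindex[OF step.prems])
  also have "\<dots> = hlsym s (map \<alpha> [k..<n]) (x ` {k..<n})"
    using step.hyps by (simp add: upt_conv_Cons)
  finally show ?case by (simp add: F_def)
qed

text \<open>\<open>vfac\<close> with a free parameter; at s = 0 it is 1, so Schur polynomials need
  no normalization.\<close>

definition qfact :: "'a::field \<Rightarrow> nat \<Rightarrow> 'a" where
  "qfact s m = (\<Prod>i\<in>{1..m}. (1 - s ^ i) / (1 - s))"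

lemma qfact_0 [simp]: "qfact s 0 = 1" and qfact_Suc: "qfact s (Suc m) = qfact s m * ((1 - s ^ Suc m) / (1 - s))"
  by (simp_all add: qfact_def)

lemma vfac_qfact: "vfac = qfact tt"
  by (simp add: fun_eq_iff vfac_def qfact_def)

lemma qfact_0_left: "qfact 0 m = 1"
  by (induction m) (simp_all add: qfact_Suc)

lemma hlsym_zeros:
  "s \<noteq> 1 \<Longrightarrow> finite A \<Longrightarrow> card A = m \<Longrightarrow> hlsym s (replicate m 0) A = qfact s m"
proof (induction m arbitrary: A)
  case (Suc m)
  have "(1 - s) * (\<Sum>a\<in>A. hlfac s A a) = 1 - s ^ Suc m"
    using sum_hlfac[OF Suc.prems(2), of s] Suc.prems(3) by (simp add: algebra_simps)
  then have *: "(\<Sum>a\<in>A. hlfac s A a) = (1 - s ^ Suc m) / (1 - s)"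
    using Suc.prems(1) by (simp add: field_simps)
  have "hlsym s (replicate (Suc m) 0) A = (\<Sum>a\<in>A. hlfac s A a * qfact s m)"
    using Suc by simp
  then show ?case unfolding qfact_Suc *[symmetric] by (simp add: sum_distrib_left mult.commute)
qed simp

text \<open>The zeros contribute a constant, the one that \<open>vla\<close> divides out; this makes
  the Hall-Littlewood polynomials stable in the number of variables.\<close>

lemma hlsym_append_zeros:
  "s \<noteq> 1 \<Longrightarrow> finite A \<Longrightarrow> card A = length la + m \<Longrightarrow> hlsym s (la @ replicate m 0) A = hlsym s la A * qfact s m"
proof (induction la arbitrary: A)
  case (Cons a la)
  have "hlsym s (la @ replicate m 0) (A - {a}) = hlsym s la (A - {a}) * qfact s m" if "a \<in> A" for a
    using Cons that by simp
  then show ?case by (simp add: sum_distrib_right mult.assoc)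
qed (simp add: hlsym_zeros)

lemma hlsym_eq_0: "finite A \<Longrightarrow> card A < length la \<Longrightarrow> hlsym s la A = 0"
proof (induction la arbitrary: A)
  case (Cons a la)
  show ?case
  proof (cases "A = {}")
    case False
    then have "hlsym s la (A - {a}) = 0" if "a \<in> A" for a
      using Cons that by (cases "card A") auto
    then show ?thesis by simp
  qed simp
qed simp

lemma hlsym_ones:
  fixes s :: "'a::{field,ring_char_0}"
  shows "s \<noteq> 1 \<Longrightarrow> finite A \<Longrightarrow> hlsym s (replicate r 1) A = qfact s r * esym A r"
proof (induction r arbitrary: A)
  case 0
  have "esym A 0 = 1" unfolding esym_def poly_0_coeff_0[symmetric] by (simp add: poly_prod)
  then show ?case by simp
next
  case (Suc r)
  have "hlsym s (replicate (Suc r) 1) A = qfact s r * (\<Sum>a\<in>A. a * hlfac s A a * esym (A - {a}) r)"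
    using Suc by (simp add: sum_distrib_left mult_ac)
  also have "(\<Sum>a\<in>A. a * hlfac s A a * esym (A - {a}) r) = (1 - s ^ Suc r) / (1 - s) * esym A (Suc r)"
    using sum_hlfac_esym[OF Suc.prems(2), of s r] Suc.prems(1) by (simp add: field_simps)
  finally show ?case by (simp add: qfact_Suc)
qed

lemma map_part_upt: "length la \<le> n \<Longrightarrow> map (part la) [0..<n] = la @ replicate (n - length la) 0"
  by (rule nth_equalityI) (auto simp: part_def nth_append)

section \<open>Hall-Littlewood functions as words in Jing operators\<close>

definition QQ :: "nat list \<Rightarrow> sym" where "QQ la = foldr (\<lambda>m. jing (int m)) la 1"

lemma QQ_simps [simp]: "QQ [] = 1" "QQ (m # la) = jing (int m) (QQ la)"
  by (simp_all add: QQ_def)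

text \<open>Positive parts avoid the exceptional term of \<open>evA_jing\<close>; each operator
  contributes 1 - t and one step of \<open>hlsym\<close>.\<close>

lemma evA_QQ:
  "finite A \<Longrightarrow> (\<And>m. m \<in> set la \<Longrightarrow> m > 0) \<Longrightarrow> evA A (QQ la) = (1 - tt) ^ length la * hlsym tt la A"
proof (induction la arbitrary: A)
  case (Cons m la)
  then have "evA (A - {a}) (QQ la) = (1 - tt) ^ length la * hlsym tt la (A - {a})" for a by simp
  moreover have "m \<noteq> 0" using Cons.prems(2)[of m] by simp
  ultimately show ?case using Cons.prems(1) by (simp add: evA_jing sum_distrib_left mult_ac)
qed (simp add: evA_simps)

text \<open>The normalization v_la without the factor for zero parts, which alone depends on the
  number of variables.\<close>

definition vprod :: "nat list \<Rightarrow> qt" where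
  "vprod la = (\<Prod>j\<in>{1..part la 0}. vfac (mult la j))"

lemma vfac_neq_0 [simp]: "vfac m \<noteq> 0"
  by (auto simp: vfac_def tt_power_neq_1 Suc_le_eq)

lemma HL_n_hlsym:
  assumes "inj_on x {..<n}"
  shows "HL_n la n x = hlsym tt la (x ` {..<n}) / vprod la"
proof (cases "length la \<le> n")
  case True
  have c: "card (x ` {..<n}) = length la + (n - length la)"
    using True by (simp add: card_image[OF assms])
  have "HL_n la n x = 1 / vla la n * hlsym tt (map (part la) [0..<n]) (x ` {0..<n})"
    unfolding HL_n_def using True assms
    by (subst hlsym_symmetrization[symmetric]) (simp_all add: atLeast0LessThan)
  also have "\<dots> = 1 / vla la n * (hlsym tt la (x ` {..<n}) * vfac (n - length la))"
    unfolding map_part_upt[OF True] vfac_qfact atLeast0LessThan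
    by (subst hlsym_append_zeros[OF _ _ c]) simp_all
  also have "\<dots> = hlsym tt la (x ` {..<n}) / vprod la"
    by (simp add: vla_def vprod_def)
  finally show ?thesis .
next
  case False
  then show ?thesis
    by (simp add: HL_n_def) (subst hlsym_eq_0, simp_all add: card_image[OF assms])
qed

lemma part_0_bounds: "is_partition la \<Longrightarrow> set la \<subseteq> {1..part la 0}"
  by (cases la) (auto simp: is_partition_def part_def Suc_le_eq)

lemma vprod_bfun:
  assumes "is_partition la"
  shows "bfun la = vprod la * (1 - tt) ^ length la"
proof -
  have v: "vfac m * (1 - tt) ^ m = (\<Prod>i\<in>{1..m}. 1 - tt ^ i)" for m
    by (induction m) (simp_all add: vfac_def)
  have "vprod la * (\<Prod>j\<in>{1..part la 0}. (1 - tt) ^ mult la j) = bfun la"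
    by (simp add: vprod_def bfun_def v flip: prod.distrib)
  moreover have "(\<Prod>j\<in>{1..part la 0}. (1 - tt) ^ mult la j) = (1 - tt) ^ length la"
    unfolding power_sum[symmetric] mult_def
    using sum_count_set[OF part_0_bounds[OF assms]] by simp
  ultimately show ?thesis by simp
qed

lemma bfun_neq_0 [simp]: "bfun la \<noteq> 0"
  by (auto simp: bfun_def tt_power_neq_1 Suc_le_eq)

lemma HLP_QQ:
  assumes "is_partition la"
  shows "HLP la = smul (1 / bfun la) (QQ la)"
  unfolding HLP_def
proof (rule the_ev_eqI)
  fix n and x :: "nat \<Rightarrow> qt" assume x: "inj_on x {..<n}"
  have "\<And>m. m \<in> set la \<Longrightarrow> m > 0" using assms by (auto simp: is_partition_def)
  then show "ev n (smul (1 / bfun la) (QQ la)) x = HL_n la n x"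
    by (simp add: ev_evA[OF x] evA_simps evA_QQ HL_n_hlsym[OF x] vprod_bfun[OF assms])
qed

lemma HLQ_QQ: "is_partition la \<Longrightarrow> HLQ la = QQ la"
  by (simp add: HLQ_def HLP_QQ)

lemma count_list_replicate_same: "count_list (replicate r a) a = r"
  by (induction r) simp_all

lemma is_partition_ones [simp]: "is_partition (replicate r 1)"
  by (simp add: is_partition_def sorted_wrt_iff_nth_less)

lemma HLP_ones: "HLP (replicate r 1) = ee (int r)"
  unfolding HLP_def
proof (rule the_ev_eqI)
  fix n and x :: "nat \<Rightarrow> qt" assume x: "inj_on x {..<n}"
  have "vprod (replicate r 1) = qfact tt r"
    by (cases r) (simp_all add: vprod_def part_def mult_def count_list_replicate_same vfac_qfact)
  moreover have "qfact tt r \<noteq> 0" using vfac_neq_0[of r] unfolding vfac_qfact .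
  ultimately show "ev n (ee (int r)) x = HL_n (replicate r 1) n x"
    by (simp only: ev_ee elem_n_inj[OF x] HL_n_hlsym[OF x]) (simp add: hlsym_ones[unfolded One_nat_def])
qed

section \<open>Vandermonde products and the Schur function of a column\<close>

definition vand :: "nat \<Rightarrow> (nat \<Rightarrow> 'a::field) \<Rightarrow> 'a" where
  "vand n x = (\<Prod>i<n. \<Prod>j\<in>{i<..<n}. x i - x j)"

lemma vand_pairs: "vand n x = (\<Prod>(i, j)\<in>{(i, j). i < j \<and> j < n}. x i - x j)"
proof -
  have "vand n x = (\<Prod>(i, j)\<in>Sigma {..<n} (\<lambda>i. {i<..<n}). x i - x j)"
    unfolding vand_def by (rule prod.Sigma) auto
  also have "Sigma {..<n} (\<lambda>i. {i<..<n}) = {(i, j). i < j \<and> j < n}" by auto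
  finally show ?thesis .
qed

lemma vand_adjacent:
  assumes "Suc k < n"
  shows "vand n (x \<circ> transpose k (Suc k)) = - vand n x"
proof -
  let ?t = "transpose k (Suc k)"
  define S where "S = {(i, j). i < j \<and> j < n} - {(k, Suc k)}"
  have "{(i, j). i < j \<and> j < n} \<subseteq> {..<n} \<times> {..<n}" by auto
  then have fin: "finite {(i, j). i < j \<and> j < n}" by (rule finite_subset) simp
  have S: "{(i, j). i < j \<and> j < n} = insert (k, Suc k) S" "finite S" "(k, Suc k) \<notin> S"
    using assms fin by (auto simp: S_def)
  have mem: "(?t i, ?t j) \<in> S" if "(i, j) \<in> S" for i j
    using that assms by (auto simp: S_def transpose_def split: if_splits)
  have "(\<Prod>(i, j)\<in>S. (x \<circ> ?t) i - (x \<circ> ?t) j) = (\<Prod>(i, j)\<in>S. x i - x j)"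
    by (rule prod.reindex_bij_witness[of _ "\<lambda>(i, j). (?t i, ?t j)" "\<lambda>(i, j). (?t i, ?t j)"])
       (auto intro: mem)
  then show ?thesis unfolding vand_pairs S(1) using S(2,3) by (simp add: algebra_simps)
qed

text \<open>Induction on the distance: exchanging a and b + 1 is the adjacent exchange of b and b +
  1 conjugated by the exchange of a and b, so three signs multiply to -1.\<close>

lemma vand_transpose:
  assumes "a < b" "b < n"
  shows "vand n (x \<circ> transpose a b) = - vand n x"
proof -
  have "a < a + d + 1 \<Longrightarrow> a + d + 1 < n \<Longrightarrow> vand n (x \<circ> transpose a (a + d + 1)) = - vand n x" for d x
  proof (induction d arbitrary: x)
    case 0
    then show ?case using vand_adjacent[of a n x] by (simp add: comp_def)
  next
    case (Suc d)
    let ?b = "a + d + 1"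
    have "transpose a (Suc ?b) = transpose a ?b \<circ> transpose ?b (Suc ?b) \<circ> transpose a ?b"
      by (rule transpose_comp_triple[symmetric]) auto
    then have "vand n (x \<circ> transpose a (Suc ?b)) = vand n (((x \<circ> transpose a ?b) \<circ> transpose ?b (Suc ?b)) \<circ> transpose a ?b)"
      by (simp only: o_assoc)
    also have "\<dots> = - vand n ((x \<circ> transpose a ?b) \<circ> transpose ?b (Suc ?b))"
      by (rule Suc.IH) (use Suc.prems in auto)
    also have "\<dots> = vand n (x \<circ> transpose a ?b)"
      by (subst vand_adjacent) (use Suc.prems in auto)
    also have "\<dots> = - vand n x"
      by (rule Suc.IH) (use Suc.prems in auto)
    finally show ?case by (simp add: comp_def)
  qed
  from this[of "b - a - 1" x] assms show ?thesis by simp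
qed

lemma vand_permutes:
  assumes "w permutes {..<n}"
  shows "vand n (x \<circ> w) = of_int (sign w) * vand n x"
  using assms finite_lessThan[of n]
proof (induction w arbitrary: x rule: permutes_induct)
  case (swap a b p)
  have ab: "a < n" "b < n" "a \<noteq> b" and p: "p permutes {..<n}" using swap.hyps by auto
  have t: "vand n (x \<circ> transpose a b) = - vand n x"
  proof (cases "a < b")
    case True
    then show ?thesis using vand_transpose ab by blast
  next
    case False
    then have "vand n (x \<circ> transpose b a) = - vand n x" using vand_transpose ab by (metis linorder_neqE_nat)
    then show ?thesis by (simp only: transpose_commute)
  qed
  have "permutation p" using p by (meson finite_lessThan permutation_permutes)
  then have sg: "sign (transpose a b \<circ> p) = - sign p"
    using ab(3) by (simp add: sign_compose sign_swap_id permutation_swap_id)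
  have "vand n (x \<circ> (transpose a b \<circ> p)) = of_int (sign p) * vand n (x \<circ> transpose a b)"
    unfolding o_assoc by (rule swap.IH)
  then show ?case unfolding sg t by (simp only: of_int_minus mult_minus_left mult_minus_right)
qed (simp_all add: sign_id)

lemma vand_neq_0:
  assumes "inj_on x {..<n}"
  shows "vand n x \<noteq> 0"
proof -
  have "x i \<noteq> x j" if "i < j" "j < n" for i j
    using that inj_onD[OF assms, of i j] by auto
  then show ?thesis by (simp add: vand_def)
qed

text \<open>At s = 0 the weights are x_(w i) / (x_(w i) - x_(w j)). The numerators supply the
  exponents n - 1 - i, and the denominators form the Vandermonde product of the permuted variables,
  which differs by the sign of w.\<close>

lemma alt_hlsym:
  assumes x: "inj_on x {..<n}"
  shows "alt n (\<lambda>i. \<alpha> i + (n - 1 - i)) x = vand n x * hlsym 0 (map \<alpha> [0..<n]) (x ` {..<n})"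
proof -
  have v0: "vand n x \<noteq> 0" using x by (rule vand_neq_0)
  have "hlsym 0 (map \<alpha> [0..<n]) (x ` {..<n}) = (\<Sum>w | w permutes {..<n}. (\<Prod>i<n. x (w i) ^ \<alpha> i) *
     (\<Prod>i<n. \<Prod>j\<in>{i<..<n}. (x (w i) - 0 * x (w j)) / (x (w i) - x (w j))))"
    using hlsym_symmetrization[of x 0 n \<alpha> 0] x by (simp add: atLeast0LessThan)
  also have "\<dots> = (\<Sum>w | w permutes {..<n}. of_int (sign w) * (\<Prod>i<n. x (w i) ^ (\<alpha> i + (n - 1 - i))) / vand n x)"
  proof (intro sum.cong refl)
    fix w assume "w \<in> {w. w permutes {..<n}}"
    then have w: "w permutes {..<n}" by simp
    have "(\<Prod>i<n. \<Prod>j\<in>{i<..<n}. (x (w i) - 0 * x (w j)) / (x (w i) - x (w j))) = (\<Prod>i<n. x (w i) ^ (n - 1 - i)) / vand n (x \<circ> w)"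
      by (simp add: vand_def prod_dividef)
    also have "\<dots> = of_int (sign w) * (\<Prod>i<n. x (w i) ^ (n - 1 - i)) / vand n x"
      unfolding vand_permutes[OF w] by (auto simp: sign_def)
    finally have *: "(\<Prod>i<n. \<Prod>j\<in>{i<..<n}. (x (w i) - 0 * x (w j)) / (x (w i) - x (w j))) = \<dots>" .
    show "(\<Prod>i<n. x (w i) ^ \<alpha> i) * (\<Prod>i<n. \<Prod>j\<in>{i<..<n}. (x (w i) - 0 * x (w j)) / (x (w i) - x (w j)))
      = of_int (sign w) * (\<Prod>i<n. x (w i) ^ (\<alpha> i + (n - 1 - i))) / vand n x"
      unfolding * by (simp only: power_add prod.distrib) (simp add: mult_ac)
  qed
  also have "\<dots> = alt n (\<lambda>i. \<alpha> i + (n - 1 - i)) x / vand n x"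
    by (simp add: alt_def sum_divide_distrib)
  finally show ?thesis using v0 by simp
qed

lemma schur_ones: "schur (replicate r 1) = ee (int r)"
  unfolding schur_def
proof (rule the_ev_eqI)
  fix n and x :: "nat \<Rightarrow> qt" assume x: "inj_on x {..<n}"
  define A where "A = x ` {..<n}"
  have A: "finite A" "card A = n" using card_image[OF x] by (simp_all add: A_def)
  have v0: "vand n x \<noteq> 0" using x by (rule vand_neq_0)
  \<comment> \<open>Zero exponents give the denominator of the Schur quotient.\<close>
  have "map (\<lambda>_. 0) [0..<n] = replicate n (0::nat)" by (simp add: map_replicate_const)
  then have d: "alt n (\<lambda>i. n - 1 - i) x = vand n x"
    using alt_hlsym[OF x, of "\<lambda>_. 0"] A by (simp add: hlsym_zeros qfact_0_left flip: A_def)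
  show "ev n (ee (int r)) x = schur_n (replicate r 1) n x"
  proof (cases "r \<le> n")
    case True
    have "hlsym 0 (map (part (replicate r 1)) [0..<n]) A = hlsym 0 (replicate r 1 @ replicate (n - r) 0) A"
      using map_part_upt[of "replicate r 1" n] True by simp
    also have "\<dots> = hlsym 0 (replicate r 1) A"
      using hlsym_append_zeros[of 0 A "replicate r 1" "n - r"] A True by (simp add: qfact_0_left)
    also have "\<dots> = esym A r"
      using hlsym_ones[of 0 A r] A by (simp add: qfact_0_left)
    finally have e: "hlsym 0 (map (part (replicate r 1)) [0..<n]) (x ` {..<n}) = esym A r"
      unfolding A_def .
    show ?thesis using True v0
      unfolding schur_n_def d alt_hlsym[OF x, of "part (replicate r 1)"] e
      by (simp add: ev_ee elem_n_inj[OF x] A_def)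
  next
    case False
    \<comment> \<open>More parts than variables: the elementary polynomial is an empty sum, matching
      the default 0 of \<open>schur_n\<close>.\<close>
    have e: "{S. S \<subseteq> {..<n} \<and> card S = r} = {}"
    proof -
      have "card S \<le> n" if "S \<subseteq> {..<n}" for S using card_mono[OF finite_lessThan that] by simp
      then show ?thesis using False by auto
    qed
    show ?thesis unfolding schur_n_def ev_ee elem_n_def e using False by simp
  qed
qed

section \<open>Partitions and q-binomial coefficients\<close>

definition phi :: "nat \<Rightarrow> qt" where "phi m = (\<Prod>i\<in>{1..m}. 1 - tt ^ i)"

lemma phi_0 [simp]: "phi 0 = 1" and phi_Suc: "phi (Suc m) = phi m * (1 - tt ^ Suc m)"
  by (simp_all add: phi_def)

lemma phi_neq_0 [simp]: "phi m \<noteq> 0"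
  by (auto simp: phi_def tt_power_neq_1 Suc_le_eq)

lemma qbinom_phi:
  assumes "b \<le> a"
  shows "qbinom a b = phi a / (phi b * phi (a - b))"
proof -
  have "phi a = (\<Prod>i<b. 1 - tt ^ (a - i)) * phi (a - b)"
    using assms
  proof (induction b)
    case (Suc b)
    then have "a - b = Suc (a - Suc b)" by simp
    then have "phi (a - b) = (1 - tt ^ (a - b)) * phi (a - Suc b)"
      by (metis phi_Suc mult.commute)
    then show ?case using Suc by simp
  qed simp
  then show ?thesis by (simp add: qbinom_def phi_def[of b])
qed

lemma qbinom_0 [simp]: "qbinom a 0 = 1"
  by (simp add: qbinom_def)

lemma qbinom_self [simp]: "qbinom a a = 1"
  by (simp add: qbinom_phi)

text \<open>The numerator contains the factor with index \<open>a\<close>, which is 1 - t^0.\<close>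

lemma qbinom_eq_0: "a < b \<Longrightarrow> qbinom a b = 0"
  unfolding qbinom_def by (auto intro!: bexI[of _ a])

lemma qbinom_pascal: "qbinom (Suc a) (Suc b) = qbinom a b + tt ^ Suc b * qbinom a (Suc b)"
proof (cases "b < a")
  case True
  define A B C where "A = phi a" "B = phi b" "C = phi (a - Suc b)"
  define x y where "x = tt ^ Suc b" "y = tt ^ (a - b)"
  have ab: "a - b = Suc (a - Suc b)" using True by simp
  have c: "phi (a - b) = C * (1 - y)" using phi_Suc[of "a - Suc b"] by (simp only: A_B_C_def x_y_def ab)
  have a: "phi (Suc a) = A * (1 - x * y)"
    using True by (simp add: phi_Suc A_B_C_def x_y_def flip: power_add power_Suc)
  have b: "phi (Suc b) = B * (1 - x)" by (simp add: phi_Suc A_B_C_def x_y_def)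
  have nz: "B \<noteq> 0" "C \<noteq> 0" "1 - x \<noteq> 0" "1 - y \<noteq> 0"
    using True by (simp_all add: A_B_C_def x_y_def tt_power_neq_1 del: power_Suc)
  have "qbinom (Suc a) (Suc b) = A * (1 - x * y) / (B * (1 - x) * (C * (1 - y)))"
    using True by (simp add: qbinom_phi a b c)
  also have "\<dots> = A / (B * (C * (1 - y))) + x * (A / (B * (1 - x) * C))"
    using nz by (simp add: divide_simps) (simp add: algebra_simps)
  also have "\<dots> = qbinom a b + x * qbinom a (Suc b)"
    using True by (simp add: qbinom_phi b c flip: A_B_C_def)
  finally show ?thesis by (simp add: x_y_def)
next
  case False
  then show ?thesis by (cases "a = b") (simp_all add: qbinom_eq_0)
qed

section \<open>Passing e_r through powers of Jing operators\<close>

abbreviation J :: "nat \<Rightarrow> sym \<Rightarrow> sym" where "J m \<equiv> jing (int m)"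

lemma J_sum: "J m (\<Sum>i\<in>A. f i) = (\<Sum>i\<in>A. J m (f i))"
  by (rule jing_perp.X_sum)

lemma J_pow_add: "(J m ^^ k) (f + g) = (J m ^^ k) f + (J m ^^ k) g"
  by (induction k) (simp_all add: jing_add)

lemma J_pow_smul: "(J m ^^ k) (smul c f) = smul c ((J m ^^ k) f)"
  by (induction k) (simp_all add: jing_smul)

lemma J_pow_0 [simp]: "(J m ^^ k) 0 = 0"
  using J_pow_smul[of k m 0 0] by simp

lemma J_pow_sum: "(J m ^^ k) (\<Sum>i\<in>A. f i) = (\<Sum>i\<in>A. (J m ^^ k) (f i))"
  by (induction A rule: infinite_finite_induct) (simp_all add: J_pow_add)

lemma J_straighten: "J m (J (Suc m) f) = smul tt (J (Suc m) (J m f))"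
  using jing_straighten[of m f] by (simp add: add.commute)

lemma J_straighten_pow: "J m ((J (Suc m) ^^ k) f) = smul (tt ^ k) ((J (Suc m) ^^ k) (J m f))"
  by (induction k) (simp_all add: J_straighten jing_smul del: of_nat_Suc)

lemma ee_J: "ee r * J m f = J m (ee r * f) + J (Suc m) (ee (r - 1) * f)"
  using jing_times.ee_X[of r "int m" f] by (simp add: add.commute)

lemma perp_hh_J: "perp (hh r) (J (Suc m) f) = J (Suc m) (perp (hh r) f) + perp (hh (r - 1)) (J m f)"
  using jing_perp.hh_X[of r "int (Suc m)" f] by simp

text \<open>Merges the two sums of a Pascal step; the side conditions say that coefficients outside
  the triangle vanish.\<close>

lemma sum_atMost_shift_two:
  fixes T :: "nat \<Rightarrow> sym"
  assumes "\<And>i. i \<le> k \<Longrightarrow> c (Suc i) = a (Suc i) + b i" "c 0 = a 0" "a (Suc k) = 0"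
  shows "(\<Sum>i\<le>k. smul (a i) (T i)) + (\<Sum>i\<le>k. smul (b i) (T (Suc i))) = (\<Sum>i\<le>Suc k. smul (c i) (T i))"
proof -
  have "(\<Sum>i\<le>Suc k. smul (c i) (T i)) = smul (c 0) (T 0) + (\<Sum>i\<le>k. smul (c (Suc i)) (T (Suc i)))"
    by (rule sum.atMost_Suc_shift)
  also have "(\<Sum>i\<le>k. smul (c (Suc i)) (T (Suc i))) = (\<Sum>i\<le>k. smul (a (Suc i)) (T (Suc i))) + (\<Sum>i\<le>k. smul (b i) (T (Suc i)))"
    unfolding sum.distrib[symmetric] by (intro sum.cong refl) (simp add: assms(1) sym.scale_left_distrib)
  also have "smul (c 0) (T 0) + \<dots> = (smul (a 0) (T 0) + (\<Sum>i\<le>k. smul (a (Suc i)) (T (Suc i)))) + (\<Sum>i\<le>k. smul (b i) (T (Suc i)))"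
    by (simp add: assms(2) add.assoc)
  also have "smul (a 0) (T 0) + (\<Sum>i\<le>k. smul (a (Suc i)) (T (Suc i))) = (\<Sum>i\<le>Suc k. smul (a i) (T i))"
    by (rule sum.atMost_Suc_shift[symmetric])
  also have "\<dots> = (\<Sum>i\<le>k. smul (a i) (T i))" using assms(3) by simp
  finally show ?thesis by simp
qed

text \<open>The function e raises \<open>i\<close> of the \<open>k\<close> factors. A new leading
  \<open>J m\<close> that is not raised must pass the \<open>i\<close> raised factors, at the cost
  of t^i; this is the weight in Pascal's rule.\<close>

lemma ee_J_pow:
  "ee r * (J m ^^ k) f = (\<Sum>i\<le>k. smul (qbinom k i) ((J (Suc m) ^^ i) ((J m ^^ (k - i)) (ee (r - int i) * f))))"
proof (induction k arbitrary: r)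
  case (Suc k)
  define T where "T i = (J (Suc m) ^^ i) ((J m ^^ (Suc k - i)) (ee (r - int i) * f))" for i
  have "ee r * (J m ^^ Suc k) f = J m (ee r * (J m ^^ k) f) + J (Suc m) (ee (r - 1) * (J m ^^ k) f)"
    by (simp add: ee_J)
  also have "J m (ee r * (J m ^^ k) f) = (\<Sum>i\<le>k. smul (tt ^ i * qbinom k i) (T i))"
    unfolding Suc.IH J_sum T_def
    by (intro sum.cong refl) (simp add: jing_smul J_straighten_pow Suc_diff_le mult.commute[of "tt ^ _"] del: of_nat_Suc)
  also have "J (Suc m) (ee (r - 1) * (J m ^^ k) f) = (\<Sum>i\<le>k. smul (qbinom k i) (T (Suc i)))"
    unfolding Suc.IH J_sum T_def
    by (intro sum.cong refl) (simp add: jing_smul algebra_simps)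
  also have "(\<Sum>i\<le>k. smul (tt ^ i * qbinom k i) (T i)) + \<dots> = (\<Sum>i\<le>Suc k. smul (qbinom (Suc k) i) (T i))"
    by (rule sum_atMost_shift_two) (simp_all add: qbinom_pascal qbinom_eq_0)
  finally show ?case by (simp add: T_def)
qed simp

lemma QQ_append_replicate: "QQ (replicate k m @ la) = (J m ^^ k) (QQ la)"
  by (induction k) simp_all

section \<open>Conjugates, multiplicities and sizes of partitions\<close>

lemma conj_filter: "conj la j = length (filter (\<lambda>x. j \<le> x) la)"
  by (simp add: conj_def length_filter_conv_card)

lemma conj_append: "conj (la @ mu) j = conj la j + conj mu j"
  by (simp add: conj_filter)

lemma conj_replicate: "conj (replicate k m) j = (if j \<le> m then k else 0)"
  by (simp add: conj_filter)

lemma conj_Nil [simp]: "conj [] j = 0"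
  by (simp add: conj_filter)

lemma conj_eq_0: "(\<And>x. x \<in> set la \<Longrightarrow> x < j) \<Longrightarrow> conj la j = 0"
  by (auto simp: conj_filter filter_empty_conv not_le)

lemma conj_parts:
  assumes "j > 0"
  shows "conj la j = card {i. j \<le> part la i}"
proof -
  have "{i. j \<le> part la i} = {i. i < length la \<and> j \<le> la ! i}"
    using assms by (auto simp: part_def split: if_splits)
  then show ?thesis by (simp add: conj_def)
qed

lemma finite_parts: "j > 0 \<Longrightarrow> finite {i. j \<le> part la i}"
  by (rule finite_subset[of _ "{..<length la}"]) (auto simp: part_def split: if_splits)

lemma conj_mult: "conj la j = conj la (Suc j) + mult la j"
  by (induction la) (auto simp: conj_filter mult_def)

lemma mult_append: "mult (la @ mu) j = mult la j + mult mu j"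
  by (simp add: mult_def)

lemma mult_replicate: "mult (replicate k m) j = (if j = m then k else 0)"
  by (induction k) (auto simp: mult_def)

lemma mult_eq_0: "j \<notin> set la \<Longrightarrow> mult la j = 0"
  by (simp add: mult_def)

lemma conj_mono: "subpart mu la \<Longrightarrow> j > 0 \<Longrightarrow> conj mu j \<le> conj la j"
  unfolding conj_parts by (rule card_mono) (auto simp: finite_parts subpart_def intro: order_trans)

text \<open>A row of length at least j + 1 had length at least j before the strip was added.\<close>

lemma conj_vertical_strip: "vertical_strip la mu \<Longrightarrow> j > 0 \<Longrightarrow> conj la (Suc j) \<le> conj mu j"
  unfolding conj_parts[OF zero_less_Suc] conj_parts
  by (rule card_mono) (auto simp: finite_parts vertical_strip_def, metis Suc_eq_plus1 not_less_eq_eq order_trans)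

lemma part_append: "part (la @ mu) i = (if i < length la then la ! i else part mu (i - length la))"
  by (auto simp: part_def nth_append)

lemma part_replicate: "part (replicate k m) i = (if i < k then m else 0)"
  by (auto simp: part_def)

lemma part_ge_length [simp]: "length la \<le> i \<Longrightarrow> part la i = 0"
  by (simp add: part_def)

lemma part_pos: "is_partition la \<Longrightarrow> i < length la \<longleftrightarrow> part la i > 0"
  by (auto simp: part_def is_partition_def)

lemma part_mono: "is_partition la \<Longrightarrow> i \<le> j \<Longrightarrow> part la j \<le> part la i"
  by (cases "i = j") (auto simp: part_def is_partition_def sorted_wrt_iff_nth_less)

lemma part_le_hd: "is_partition la \<Longrightarrow> x \<in> set la \<Longrightarrow> x \<le> part la 0"
  using part_0_bounds by fastforce

lemma psize_parts: "length la \<le> n \<Longrightarrow> psize la = (\<Sum>i<n. part la i)"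
proof -
  assume n: "length la \<le> n"
  have "psize la = (\<Sum>i<length la. la ! i)"
    by (simp add: psize_def sum_list_sum_nth atLeast0LessThan)
  also have "\<dots> = (\<Sum>i<length la. part la i)" by (simp add: part_def)
  also have "\<dots> = (\<Sum>i<n. part la i)"
    by (rule sum.mono_neutral_left) (use n in auto)
  finally show ?thesis .
qed

lemma psize_mono: "subpart mu la \<Longrightarrow> psize mu \<le> psize la"
  using psize_parts[of mu "length mu + length la"] psize_parts[of la "length mu + length la"]
  by (auto simp: subpart_def intro!: sum_mono)

lemma psize_append: "psize (la @ mu) = psize la + psize mu"
  by (simp add: psize_def)

lemma psize_replicate: "psize (replicate k m) = k * m"
  by (simp add: psize_def sum_list_replicate)

lemma length_le_psize: "is_partition la \<Longrightarrow> length la \<le> psize la"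
  unfolding psize_def is_partition_def
  by (induction la) (auto simp: Suc_le_eq)

lemma finite_partitions: "finite {la. is_partition la \<and> psize la \<le> n}"
proof (rule finite_subset)
  show "{la. is_partition la \<and> psize la \<le> n} \<subseteq> {xs. set xs \<subseteq> {..n} \<and> length xs \<le> n}"
  proof
    fix la assume "la \<in> {la. is_partition la \<and> psize la \<le> n}"
    then have la: "is_partition la" "psize la \<le> n" by auto
    have "x \<le> n" if "x \<in> set la" for x
      using member_le_sum_list[OF that] la(2) by (simp add: psize_def)
    then show "la \<in> {xs. set xs \<subseteq> {..n} \<and> length xs \<le> n}"
      using length_le_psize[OF la(1)] la(2) by auto
  qed
qed (rule finite_lists_length_le, simp)

lemma is_partition_append:
  "is_partition (la @ mu) \<longleftrightarrow> is_partition la \<and> is_partition mu \<and> (\<forall>x\<in>set la. \<forall>y\<in>set mu. y \<le> x)"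
  by (auto simp: is_partition_def sorted_wrt_append)

lemma is_partition_replicate: "is_partition (replicate k m) \<longleftrightarrow> k = 0 \<or> m > 0"
  by (auto simp: is_partition_def sorted_wrt_iff_nth_less)

lemma is_partition_Nil [simp]: "is_partition []"
  by (simp add: is_partition_def)

text \<open>Equal parts form one block, because \<open>ee_J_pow\<close> acts on a power of a single
  operator.\<close>

lemma partition_block_induct [consumes 1, case_names Nil block]:
  assumes "is_partition la" and "P []"
    and "\<And>k m la. k > 0 \<Longrightarrow> is_partition la \<Longrightarrow> (\<And>x. x \<in> set la \<Longrightarrow> x \<le> m) \<Longrightarrow> P la \<Longrightarrow> P (replicate k (Suc m) @ la)"
  shows "P la"
  using assms(1)
proof (induction la rule: length_induct)
  case (1 la)
  show ?case
  proof (cases la)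
    case Nil
    then show ?thesis using assms(2) by simp
  next
    case (Cons a xs)
    define t where "t = dropWhile (\<lambda>x. x = a) la"
    define k where "k = length (takeWhile (\<lambda>x. x = a) la)"
    have "takeWhile (\<lambda>x. x = a) la = replicate k a"
      unfolding k_def by (rule replicate_length_same[symmetric]) (auto dest: set_takeWhileD)
    then have la: "la = replicate k a @ t"
      using takeWhile_dropWhile_id[of "\<lambda>x. x = a" la] by (simp add: t_def)
    have k: "k > 0" by (simp add: k_def Cons)
    have p: "is_partition t" "\<forall>y\<in>set t. y \<le> a" "a > 0"
      using "1.prems" k unfolding la by (auto simp: is_partition_append is_partition_replicate)
    have "y < a" if "y \<in> set t" for y
    proof -
      have "t \<noteq> []" using that by auto
      then have "hd t \<noteq> a" unfolding t_def by (rule hd_dropWhile)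
      moreover have "hd t \<le> a" using p(2) \<open>t \<noteq> []\<close> by simp
      moreover have "y \<le> hd t" using part_le_hd[OF p(1) that] \<open>t \<noteq> []\<close> by (simp add: part_def hd_conv_nth)
      ultimately show ?thesis by simp
    qed
    moreover obtain m where "a = Suc m" using p(3) by (cases a) auto
    moreover have "P t"
    proof -
      have "length t < length la" using k by (subst la) simp
      then show ?thesis using "1.IH" p(1) by blast
    qed
    ultimately have "P (replicate k (Suc m) @ t)"
      using p(1) k by (intro assms(3)) (simp_all add: less_Suc_eq_le)
    then show ?thesis using la \<open>a = Suc m\<close> by simp
  qed
qed

lemma two_valued_sorted:
  "sorted_wrt (\<ge>) xs \<Longrightarrow> set xs \<subseteq> {m, Suc m} \<Longrightarrow>
    xs = replicate (mult xs (Suc m)) (Suc m) @ replicate (length xs - mult xs (Suc m)) m"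
proof (induction xs)
  case (Cons a xs)
  have IH: "xs = replicate (mult xs (Suc m)) (Suc m) @ replicate (length xs - mult xs (Suc m)) m"
    using Cons by simp
  show ?case
  proof (cases "a = Suc m")
    case True
    then show ?thesis using IH by (simp add: mult_def)
  next
    case False
    then have a: "a = m" "\<forall>x\<in>set xs. x \<le> m" using Cons.prems by auto
    then have "mult xs (Suc m) = 0" by (intro mult_eq_0) auto
    then show ?thesis using IH a by (simp add: mult_def)
  qed
qed (simp add: mult_def)

section \<open>Pieri rules for vertical strips\<close>

lemma jing_pow_zero: "(jing m ^^ i) 0 = 0"
  by (induction i) (simp_all add: jing_perp.X_0)

text \<open>The block of \<open>k\<close> rows of length \<open>m\<close> after adding a box to
  \<open>i\<close> of them; in a partition the longer rows come first.\<close>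

definition pre :: "nat \<Rightarrow> nat \<Rightarrow> nat \<Rightarrow> nat list" where
  "pre m k i = replicate i (Suc m) @ replicate (k - i) m"

lemma length_pre [simp]: "i \<le> k \<Longrightarrow> length (pre m k i) = k"
  by (simp add: pre_def)

lemma set_pre: "set (pre m k i) \<subseteq> {m, Suc m}"
  by (auto simp: pre_def)

lemma conj_pre: "i \<le> k \<Longrightarrow> conj (pre m k i) j = (if j \<le> m then k else if j = Suc m then i else 0)"
  by (auto simp: pre_def conj_append conj_replicate)

lemma psize_pre: "i \<le> k \<Longrightarrow> psize (pre m k i) = k * m + i"
  by (simp add: pre_def psize_append psize_replicate algebra_simps)

lemma mult_pre: "mult (pre m k i) (Suc m) = i"
  by (simp add: pre_def mult_append mult_replicate)

lemma is_partition_pre: "m > 0 \<Longrightarrow> is_partition (pre m k i)"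
  by (auto simp: pre_def is_partition_append is_partition_replicate)

lemma inj_on_pre: "inj_on (\<lambda>(i, ka). pre m k i @ ka) ({..k} \<times> UNIV)"
proof (rule inj_onI)
  fix x y :: "nat \<times> nat list"
  assume "x \<in> {..k} \<times> UNIV" "y \<in> {..k} \<times> UNIV"
    and e: "(case x of (i, ka) \<Rightarrow> pre m k i @ ka) = (case y of (i, ka) \<Rightarrow> pre m k i @ ka)"
  then obtain i ka i' ka' where xy: "x = (i, ka)" "y = (i', ka')" "i \<le> k" "i' \<le> k" by auto
  then have "pre m k i = pre m k i'" "ka = ka'" using e by (simp_all add: append_eq_append_conv)
  then show "x = y" using xy mult_pre by metis
qed

lemma two_valued_prefix:
  assumes "is_partition ka" "k \<le> length ka" "\<And>i. i < k \<Longrightarrow> part ka i \<in> {m, Suc m}"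
  obtains i where "i \<le> k" "ka = pre m k i @ drop k ka"
proof -
  let ?t = "take k ka"
  have s: "sorted_wrt (\<ge>) ?t"
    using assms(1) unfolding is_partition_def by (metis append_take_drop_id sorted_wrt_append)
  have v: "set ?t \<subseteq> {m, Suc m}"
  proof
    fix x assume "x \<in> set ?t"
    then obtain i where "i < k" "x = ka ! i" using assms(2) by (auto simp: in_set_conv_nth)
    then show "x \<in> {m, Suc m}" using assms(3)[of i] assms(2) by (simp add: part_def)
  qed
  have "?t = pre m k (mult ?t (Suc m))"
    using two_valued_sorted[OF s v] assms(2) by (simp add: pre_def)
  moreover have "mult ?t (Suc m) \<le> k"
    unfolding mult_def using count_le_length[of ?t "Suc m"] assms(2) by simp
  ultimately show ?thesis using that[of "mult ?t (Suc m)"] by (metis append_take_drop_id)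
qed

lemma vertical_strip_append:
  assumes "length rh = length sg"
  shows "vertical_strip (rh @ ka) (sg @ ta) \<longleftrightarrow>
    (\<forall>i<length sg. sg ! i \<le> rh ! i \<and> rh ! i \<le> sg ! i + 1) \<and> vertical_strip ka ta"
proof -
  have split: "(\<forall>i. Q i) \<longleftrightarrow> (\<forall>i<length sg. Q i) \<and> (\<forall>i. Q (length sg + i))" for Q
    by (metis le_add_diff_inverse not_less)
  have eq: "vertical_strip ka ta \<longleftrightarrow> (\<forall>i. part ta i \<le> part ka i \<and> part ka i \<le> part ta i + 1)" for ka ta
    by (auto simp: vertical_strip_def subpart_def)
  show ?thesis unfolding eq
    by (subst split) (simp add: part_append assms)
qed

lemma vertical_strip_part: "vertical_strip ka la \<Longrightarrow> part la i \<le> part ka i \<and> part ka i \<le> Suc (part la i)"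
  by (simp add: vertical_strip_def subpart_def)

lemma vertical_strip_psize: "vertical_strip ka la \<Longrightarrow> psize la \<le> psize ka"
  by (simp add: vertical_strip_def psize_mono)

lemma partition_ones:
  assumes "is_partition mu" "\<And>i. part mu i \<le> 1"
  shows "mu = replicate (psize mu) 1"
proof -
  have "x = 1" if "x \<in> set mu" for x
  proof -
    have "x > 0" using assms(1) that by (simp add: is_partition_def)
    moreover have "x \<le> part mu 0" using assms(1) that by (rule part_le_hd)
    ultimately show ?thesis using assms(2)[of 0] by simp
  qed
  then have "mu = replicate (length mu) 1" by (intro replicate_length_same[symmetric]) auto
  then show ?thesis by (metis mult.right_neutral psize_replicate)
qed

definition VU :: "nat list \<Rightarrow> nat \<Rightarrow> nat list set" where
  "VU la r = {ka. is_partition ka \<and> vertical_strip ka la \<and> psize ka = psize la + r}"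

definition SD :: "nat list \<Rightarrow> nat \<Rightarrow> nat list set" where
  "SD la r = {mu. is_partition mu \<and> subpart mu la \<and> psize la = psize mu + r}"

lemma finite_VU [simp]: "finite (VU la r)"
  by (rule finite_subset[OF _ finite_partitions[of "psize la + r"]]) (auto simp: VU_def)

lemma finite_SD [simp]: "finite (SD la r)"
  by (rule finite_subset[OF _ finite_partitions[of "psize la"]]) (auto simp: SD_def)

text \<open>A vertical strip consists of the \<open>i\<close> lengthened rows of the top block and a
  strip on \<open>ta\<close>. Rows of \<open>ta\<close> grow to at most n + 1, so every combination
  is a partition. The bound by \<open>r\<close> keeps \<open>r - i\<close> a true
  difference.\<close>

lemma VU_block:
  assumes "k > 0" "is_partition ta" "\<And>x. x \<in> set ta \<Longrightarrow> x \<le> n"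
  shows "VU (replicate k (Suc n) @ ta) r =
     (\<lambda>(i, ka). pre (Suc n) k i @ ka) ` (SIGMA i:{i. i \<le> k \<and> i \<le> r}. VU ta (r - i))"
    (is "?L = ?R")
proof
  show "?R \<subseteq> ?L"
  proof clarify
    fix i ka assume i: "i \<le> k" "i \<le> r" and ka: "ka \<in> VU ta (r - i)"
    have p: "is_partition ka" and v: "vertical_strip ka ta" and s: "psize ka = psize ta + (r - i)"
      using ka by (auto simp: VU_def)
    have "part ta 0 \<le> n" using assms(3) by (cases ta) (auto simp: part_def)
    then have le: "y \<le> Suc n" if "y \<in> set ka" for y
      using part_le_hd[OF p that] vertical_strip_part[OF v, of 0] by simp
    have "y \<le> x" if "x \<in> set (pre (Suc n) k i)" "y \<in> set ka" for x y
      using le[OF that(2)] set_pre[of "Suc n" k i] that(1) by fastforce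
    then have "is_partition (pre (Suc n) k i @ ka)"
      using p by (simp add: is_partition_append is_partition_pre)
    moreover have "Suc n \<le> pre (Suc n) k i ! j \<and> pre (Suc n) k i ! j \<le> Suc n + 1" if "j < k" for j
    proof -
      have "pre (Suc n) k i ! j \<in> {Suc n, Suc (Suc n)}"
        by (rule subsetD[OF set_pre nth_mem]) (use that i in simp)
      then show ?thesis by auto
    qed
    then have "vertical_strip (pre (Suc n) k i @ ka) (replicate k (Suc n) @ ta)"
      using v i by (subst vertical_strip_append) simp_all
    ultimately show "pre (Suc n) k i @ ka \<in> ?L"
      using i s by (simp add: VU_def psize_append psize_pre psize_replicate)
  qed
next
  show "?L \<subseteq> ?R"
  proof
    fix ka assume "ka \<in> ?L"
    then have p: "is_partition ka" and v: "vertical_strip ka (replicate k (Suc n) @ ta)"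
      and s: "psize ka = psize (replicate k (Suc n) @ ta) + r" by (auto simp: VU_def)
    have b: "Suc n \<le> part ka i \<and> part ka i \<le> Suc (Suc n)" if "i < k" for i
      using vertical_strip_part[OF v, of i] that by (simp add: part_append)
    from b[of "k - 1"] have "part ka (k - 1) > 0" using assms(1) by simp
    then have len: "k \<le> length ka" using part_pos[OF p, of "k - 1"] by simp
    obtain i where i: "i \<le> k" and ka: "ka = pre (Suc n) k i @ drop k ka"
    proof (rule two_valued_prefix[OF p len])
      show "part ka i \<in> {Suc n, Suc (Suc n)}" if "i < k" for i using b[OF that] by auto
    qed
    have v': "vertical_strip (drop k ka) ta"
      using v vertical_strip_append[of "pre (Suc n) k i" "replicate k (Suc n)" "drop k ka" ta] i ka by simp
    have p': "is_partition (drop k ka)" using p ka is_partition_append by metis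
    have "psize ka = k * Suc n + i + psize (drop k ka)"
      using i by (subst ka) (simp add: psize_append psize_pre)
    then have "i + psize (drop k ka) = psize ta + r" using s by (simp add: psize_append psize_replicate)
    moreover have "psize ta \<le> psize (drop k ka)" by (rule vertical_strip_psize[OF v'])
    ultimately have "i \<le> r" "drop k ka \<in> VU ta (r - i)" using v' p' by (simp_all add: VU_def)
    then show "ka \<in> ?R" using i ka by (intro image_eqI[of _ _ "(i, drop k ka)"]) auto
  qed
qed

text \<open>The coefficient of Q_ka in e_r Q_la: the factor for \<open>j\<close> counts choices of
  rows of length j to be lengthened. The denominator belongs to the newly created rows, since
  Q_(1^s) = \<open>phi s\<close> e_s.\<close>

definition cU :: "nat list \<Rightarrow> nat list \<Rightarrow> qt" where
  "cU ka la = (\<Prod>j\<in>{1..part la 0}. qbinom (mult la j) (conj ka (Suc j) - conj la (Suc j))) / phi (conj ka 1 - conj la 1)"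

lemma cU_range:
  assumes "is_partition la" "is_partition ka" "vertical_strip ka la" "part la 0 \<le> n"
  shows "cU ka la = (\<Prod>j\<in>{1..n}. qbinom (mult la j) (conj ka (Suc j) - conj la (Suc j))) / phi (conj ka 1 - conj la 1)"
proof -
  have "qbinom (mult la j) (conj ka (Suc j) - conj la (Suc j)) = 1" if "j > part la 0" for j
  proof -
    have "conj ka (Suc j) = 0"
      by (rule conj_eq_0) (use part_le_hd[OF assms(2)] vertical_strip_part[OF assms(3), of 0] that in fastforce)
    then show ?thesis by simp
  qed
  then show ?thesis unfolding cU_def
    by (intro arg_cong2[where f = "(/)"] prod.mono_neutral_left) (use assms(4) in auto)
qed

text \<open>The lengthened rows are visible only in column n + 2. In the columns up to n + 1 the
  block adds \<open>k\<close> to both conjugates, so only the factor for parts n + 1 is new.\<close>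

lemma cU_block:
  assumes "k > 0" "is_partition ta" "\<And>x. x \<in> set ta \<Longrightarrow> x \<le> n" "i \<le> k" "ka \<in> VU ta r"
  shows "cU (pre (Suc n) k i @ ka) (replicate k (Suc n) @ ta) = qbinom k i * cU ka ta"
proof -
  have p: "is_partition ka" and v: "vertical_strip ka ta" using assms(5) by (auto simp: VU_def)
  have ta: "part ta 0 \<le> n" using assms(3) by (cases ta) (auto simp: part_def)
  have le: "y \<le> Suc n" if "y \<in> set ka" for y
    using part_le_hd[OF p that] vertical_strip_part[OF v, of 0] ta by simp
  have z: "mult ta (Suc n) = 0" "conj ta (Suc (Suc n)) = 0" "conj ka (Suc (Suc n)) = 0"
    using assms(3) le by (force intro: mult_eq_0 conj_eq_0 simp: less_Suc_eq_le)+
  have h: "part (replicate k (Suc n) @ ta) 0 = Suc n" using assms(1) by (simp add: part_append)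
  show ?thesis
    unfolding cU_def[of "pre (Suc n) k i @ ka"] h cU_range[OF assms(2) p v ta]
    using assms(4) z
    by (simp add: prod.nat_ivl_Suc' mult_append mult_replicate conj_append conj_replicate conj_pre)
qed

lemma QQ_ones: "QQ (replicate r 1) = smul (phi r) (ee (int r))"
proof -
  have "bfun (replicate r 1) = phi r"
    by (cases r) (simp_all add: bfun_def part_def mult_def count_list_replicate_same phi_def)
  then have "ee (int r) = smul (1 / phi r) (QQ (replicate r 1))"
    using HLP_ones[of r] HLP_QQ[OF is_partition_ones[of r]] by simp
  then show ?thesis by simp
qed

text \<open>Blocks are passed one by one with \<open>ee_J_pow\<close>; what remains of e at the end
  meets 1 and becomes a column.\<close>

lemma pieri_ee_QQ:
  assumes "is_partition la"
  shows "ee (int r) * QQ la = (\<Sum>ka\<in>VU la r. smul (cU ka la) (QQ ka))"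
  using assms
proof (induction la arbitrary: r rule: partition_block_induct)
  case Nil
  have "VU [] r = {replicate r 1}"
  proof (intro equalityI subsetI)
    fix ka assume "ka \<in> VU [] r"
    then have "is_partition ka" "vertical_strip ka []" "psize ka = r"
      by (auto simp: VU_def psize_def)
    then show "ka \<in> {replicate r 1}"
      using partition_ones[of ka] vertical_strip_part[of ka "[]"] by (auto simp: part_def)
  qed (auto simp: VU_def vertical_strip_def subpart_def part_replicate psize_replicate is_partition_ones[unfolded One_nat_def] psize_def part_def sum_list_replicate)
  moreover have "cU (replicate r 1) [] = 1 / phi r"
    by (simp add: cU_def part_def conj_replicate)
  ultimately show ?case by (simp add: QQ_ones[unfolded One_nat_def])
next
  case (block k n ta)
  let ?la = "replicate k (Suc n) @ ta"
  let ?I = "{i. i \<le> k \<and> i \<le> r}"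
  have pre_QQ: "(J (Suc (Suc n)) ^^ i) ((J (Suc n) ^^ (k - i)) (QQ ka)) = QQ (pre (Suc n) k i @ ka)" for i ka
    unfolding pre_def append_assoc QQ_append_replicate ..
  have z: "i > r \<Longrightarrow> ee (int r - int i) = 0" for i by simp
  have "ee (int r) * QQ ?la = (\<Sum>i\<le>k. smul (qbinom k i) ((J (Suc (Suc n)) ^^ i) ((J (Suc n) ^^ (k - i)) (ee (int r - int i) * QQ ta))))"
    unfolding QQ_append_replicate by (rule ee_J_pow)
  also have "\<dots> = (\<Sum>i\<in>?I. smul (qbinom k i) ((J (Suc (Suc n)) ^^ i) ((J (Suc n) ^^ (k - i)) (ee (int r - int i) * QQ ta))))"
    proof (rule sum.mono_neutral_right)
    show "\<forall>i\<in>{..k} - ?I. smul (qbinom k i) ((J (Suc (Suc n)) ^^ i) ((J (Suc n) ^^ (k - i)) (ee (int r - int i) * QQ ta))) = 0"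
    proof
      fix i assume "i \<in> {..k} - ?I"
      then have "ee (int r - int i) = 0" by (intro z) auto
      then show "smul (qbinom k i) ((J (Suc (Suc n)) ^^ i) ((J (Suc n) ^^ (k - i)) (ee (int r - int i) * QQ ta))) = 0" by (simp add: jing_pow_zero)
    qed
  qed auto
  also have "\<dots> = (\<Sum>i\<in>?I. \<Sum>ka\<in>VU ta (r - i). smul (cU (pre (Suc n) k i @ ka) ?la) (QQ (pre (Suc n) k i @ ka)))"
  proof (rule sum.cong[OF refl])
    fix i assume i: "i \<in> ?I"
    then have *: "int r - int i = int (r - i)" by (simp add: of_nat_diff)
    show "smul (qbinom k i) ((J (Suc (Suc n)) ^^ i) ((J (Suc n) ^^ (k - i)) (ee (int r - int i) * QQ ta))) =
      (\<Sum>ka\<in>VU ta (r - i). smul (cU (pre (Suc n) k i @ ka) ?la) (QQ (pre (Suc n) k i @ ka)))"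
      unfolding * block.IH J_pow_sum J_pow_smul pre_QQ sym.scale_sum_right
      by (intro sum.cong refl) (use i block.hyps in \<open>simp add: cU_block\<close>)
  qed
  also have "\<dots> = (\<Sum>(i, ka)\<in>(SIGMA i:?I. VU ta (r - i)). smul (cU (pre (Suc n) k i @ ka) ?la) (QQ (pre (Suc n) k i @ ka)))"
    by (rule sum.Sigma) auto
  also have "\<dots> = (\<Sum>ka\<in>VU ?la r. smul (cU ka ?la) (QQ ka))"
  proof -
    have VB: "VU ?la r = (\<lambda>(i, ka). pre (Suc n) k i @ ka) ` (SIGMA i:?I. VU ta (r - i))"
      by (rule VU_block) (use block.hyps in auto)
    have inj: "inj_on (\<lambda>(i, ka). pre (Suc n) k i @ ka) (SIGMA i:?I. VU ta (r - i))"
      by (rule inj_on_subset[OF inj_on_pre]) auto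
    show ?thesis unfolding VB by (subst sum.reindex[OF inj]) (simp add: case_prod_unfold)
  qed
  finally show ?case .
qed

lemma vs_range:
  assumes "vertical_strip la mu" "part la 0 \<le> n" "is_partition la"
  shows "vs la mu = (\<Prod>j\<in>{1..n}. qbinom (mult la j) (conj la j - conj mu j))"
proof -
  have e: "conj la j - conj la (j + 1) = mult la j" for j using conj_mult[of la j] by simp
  have "qbinom (mult la j) (conj la j - conj mu j) = 1" if "j > part la 0" for j
  proof -
    have "conj la j = 0" by (rule conj_eq_0) (use part_le_hd[OF assms(3)] that in fastforce)
    then show ?thesis by simp
  qed
  then show ?thesis unfolding vs_def if_P[OF assms(1)] e
    by (intro prod.mono_neutral_left) (use assms(2) in auto)
qed

section \<open>The adjoint Pieri rule for complete symmetric functions\<close>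

lemma conj_Cons: "conj (a # la) j = (if j \<le> a then 1 else 0) + conj la j"
  by (simp add: conj_filter)

lemma mult_Cons: "mult (a # la) j = (if j = a then 1 else 0) + mult la j"
  by (simp add: mult_def)

lemma part_Cons_0 [simp]: "part (a # la) 0 = a"
  by (simp add: part_def)

lemma part_Cons_Suc [simp]: "part (a # la) (Suc i) = part la i"
  by (simp add: part_def)

lemma part_Nil [simp]: "part [] i = 0"
  by (simp add: part_def)

lemma psize_Nil [simp]: "psize [] = 0" and psize_Cons [simp]: "psize (a # la) = a + psize la"
  by (simp_all add: psize_def)

lemma sk_range:
  assumes "is_partition la" "is_partition mu" "subpart mu la" "part la 0 \<le> n"
  shows "sk la mu = tt ^ (\<Sum>j\<in>{1..n}. (conj la j - conj mu j) choose 2) *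
     (\<Prod>j\<in>{1..n}. qbinom (conj la j - conj mu (Suc j)) (mult mu j))"
proof -
  have z: "conj la j = 0" "mult mu j = 0" if "j > part la 0" for j
  proof -
    show "conj la j = 0" by (rule conj_eq_0) (use part_le_hd[OF assms(1)] that in fastforce)
    have "j \<notin> set mu"
      using part_le_hd[OF assms(2), of j] that assms(3) unfolding subpart_def by (metis le_trans not_le)
    then show "mult mu j = 0" by (rule mult_eq_0)
  qed
  have "(\<Sum>j\<in>{1..part la 0}. (conj la j - conj mu j) choose 2) = (\<Sum>j\<in>{1..n}. (conj la j - conj mu j) choose 2)"
    by (rule sum.mono_neutral_left) (use assms(4) z in auto)
  moreover have "(\<Prod>j\<in>{1..part la 0}. qbinom (conj la j - conj mu (Suc j)) (mult mu j)) =
     (\<Prod>j\<in>{1..n}. qbinom (conj la j - conj mu (Suc j)) (mult mu j))"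
    by (rule prod.mono_neutral_left) (use assms(4) z in auto)
  ultimately show ?thesis by (simp add: sk_def)
qed

lemma Suc_choose_two: "Suc k choose 2 = k + (k choose 2)"
  using binomial_Suc_Suc[of k 1] by (simp add: numeral_2_eq_2)

text \<open>A block of k + 1 rows of length n + 1, followed by \<open>ta\<close>, with one box
  removed from the last row of the block. For n = 0 that row disappears, and \<open>ta\<close> is
  empty under the assumptions made below.\<close>

definition shrink :: "nat \<Rightarrow> nat \<Rightarrow> nat list \<Rightarrow> nat list" where
  "shrink k n ta = replicate k (Suc n) @ (if n = 0 then [] else n # ta)"

context
  fixes k n :: nat and ta :: "nat list"
  assumes ta: "is_partition ta" and ta_le: "\<And>x. x \<in> set ta \<Longrightarrow> x \<le> n"
begin

lemma ta_Nil: "n = 0 \<Longrightarrow> ta = []"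
  using ta ta_le by (cases ta) (auto simp: is_partition_def)

lemma part_shrink: "part (shrink k n ta) i = (if i < k then Suc n else if i = k then n else part ta (i - Suc k))"
proof (cases "n = 0")
  case True
  then show ?thesis using ta_Nil by (simp add: shrink_def part_replicate)
next
  case False
  show ?thesis
  proof (cases "i < k")
    case True
    then show ?thesis using False by (simp add: shrink_def part_append)
  next
    case ge: False
    then obtain d where "i = k + d" using le_Suc_ex not_less by blast
    then show ?thesis using False by (cases d) (simp_all add: shrink_def part_append)
  qed
qed

lemma part_blocks: "part (replicate (Suc k) (Suc n) @ ta) i = (if i < Suc k then Suc n else part ta (i - Suc k))"
  by (simp add: part_append del: replicate_Suc)

lemma conj_shrink: "0 < j \<Longrightarrow> conj (shrink k n ta) j = (if j \<le> n then conj (replicate (Suc k) (Suc n) @ ta) j else conj (replicate k (Suc n)) j + conj ta j)"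
  using ta_Nil by (auto simp: shrink_def conj_append conj_replicate conj_Cons)

lemma is_partition_blocks: "is_partition (replicate k (Suc n) @ ta)" "is_partition (replicate (Suc k) (Suc n) @ ta)"
  "is_partition (shrink k n ta)"
proof -
  have *: "y \<le> Suc n" if "y \<in> set ta" for y using ta_le[OF that] by simp
  show "is_partition (replicate k (Suc n) @ ta)" "is_partition (replicate (Suc k) (Suc n) @ ta)"
    using ta * by (auto simp: is_partition_append is_partition_replicate simp del: replicate_Suc)
  have "is_partition (n # ta)" if "n > 0"
    using ta ta_le that by (auto simp: is_partition_def)
  then show "is_partition (shrink k n ta)"
    using * by (auto simp: shrink_def is_partition_append is_partition_replicate)
qed

lemma psize_shrink: "Suc (psize (shrink k n ta)) = psize (replicate (Suc k) (Suc n) @ ta)"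
  using ta_Nil by (auto simp: shrink_def psize_append psize_replicate)

text \<open>The two outer shapes differ only in row \<open>k\<close>, so \<open>mu\<close> fails to
  fit exactly when its rows 0 to \<open>k\<close> all have length n + 1.\<close>

lemma subpart_shrink:
  assumes mu: "is_partition mu" "subpart mu (replicate (Suc k) (Suc n) @ ta)"
  shows "subpart mu (shrink k n ta) \<longleftrightarrow> conj mu (Suc n) \<le> k"
proof
  assume "subpart mu (shrink k n ta)"
  then have "conj mu (Suc n) \<le> conj (shrink k n ta) (Suc n)" by (rule conj_mono) simp
  also have "\<dots> = k"
    using ta_le by (simp add: conj_shrink conj_replicate) (rule conj_eq_0, auto simp: less_Suc_eq_le)
  finally show "conj mu (Suc n) \<le> k" .
next
  assume c: "conj mu (Suc n) \<le> k"
  have pk: "part mu k \<le> n"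
  proof (rule ccontr)
    assume "\<not> part mu k \<le> n"
    then have "{..k} \<subseteq> {i. Suc n \<le> part mu i}"
      using part_mono[OF mu(1)] by (fastforce simp: Suc_le_eq)
    then have "card {..k} \<le> conj mu (Suc n)"
      unfolding conj_parts[OF zero_less_Suc] by (rule card_mono[OF finite_parts, rotated]) simp
    then show False using c by simp
  qed
  show "subpart mu (shrink k n ta)"
    unfolding subpart_def part_shrink
  proof
    fix i
    have "part mu i \<le> part (replicate (Suc k) (Suc n) @ ta) i" using mu(2) by (simp only: subpart_def)
    then show "part mu i \<le> (if i < k then Suc n else if i = k then n else part ta (i - Suc k))"
      unfolding part_blocks using pk by (auto split: if_splits)
  qed
qed

text \<open>Columns up to n contribute the same \<open>E\<close> and \<open>R\<close> for all three
  shapes. In column n + 1 the claim is Pascal's rule for \<open>qbinom (Suc k) p\<close>; the powers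
  of t agree because binomial(k+1-p, 2) + p = binomial(k-p, 2) + k.\<close>

lemma sk_recursion:
  assumes mu: "is_partition mu" "subpart mu (replicate (Suc k) (Suc n) @ ta)"
  shows "sk (replicate (Suc k) (Suc n) @ ta) mu =
     (if part mu 0 = Suc n then sk (replicate k (Suc n) @ ta) (tl mu) else 0) +
     (if subpart mu (shrink k n ta) then tt ^ k * sk (shrink k n ta) mu else 0)"
proof -
  let ?la = "replicate (Suc k) (Suc n) @ ta"
  let ?nu = "replicate k (Suc n) @ ta"
  let ?N = "Suc n"
  define p where "p = conj mu ?N"
  define E where "E = (\<Sum>j\<in>{1..n}. (conj ?la j - conj mu j) choose 2)"
  define R where "R = (\<Prod>j\<in>{1..n}. qbinom (conj ?la j - conj mu (Suc j)) (mult mu j))"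
  have mu0: "part mu 0 \<le> ?N"
    using mu(2)[unfolded subpart_def, rule_format, of 0] unfolding part_blocks by simp
  have mu_le: "x \<le> ?N" if "x \<in> set mu" for x
    using part_le_hd[OF mu(1) that] mu0 by simp
  have z: "conj ta ?N = 0" "conj mu (Suc ?N) = 0"
    by (rule conj_eq_0, use ta_le in \<open>simp add: less_Suc_eq_le\<close>, rule conj_eq_0, use mu_le in \<open>simp add: less_Suc_eq_le\<close>)
  have multN: "mult mu ?N = p" using conj_mult[of mu ?N] z by (simp add: p_def)
  have laN: "conj ?la ?N = Suc k" using z by (simp add: conj_append conj_replicate del: replicate_Suc)
  have pk: "p \<le> Suc k" using conj_mono[OF mu(2), of ?N] laN by (simp add: p_def)
  have S1: "(\<Sum>j\<in>{1..?N}. f j) = f ?N + (\<Sum>j\<in>{1..n}. f j)" for f :: "nat \<Rightarrow> nat"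
    by simp
  have P1: "(\<Prod>j\<in>{1..?N}. f j) = f ?N * (\<Prod>j\<in>{1..n}. f j)" for f :: "nat \<Rightarrow> qt"
    by (simp add: prod.nat_ivl_Suc')
  have h: "part ?la 0 \<le> ?N" unfolding part_blocks by simp
  have la: "sk ?la mu = tt ^ (((Suc k - p) choose 2) + E) * (qbinom (Suc k) p * R)"
    unfolding sk_range[OF is_partition_blocks(2) mu h] S1 P1 laN multN z p_def[symmetric] E_def[symmetric] R_def[symmetric]
    by simp
  have hd_iff: "part mu 0 = ?N \<longleftrightarrow> p > 0"
  proof
    assume "part mu 0 = ?N"
    then have "0 \<in> {i. ?N \<le> part mu i}" by simp
    moreover have "finite {i. ?N \<le> part mu i}" by (rule finite_parts) simp
    ultimately have "card {i. ?N \<le> part mu i} > 0" using card_gt_0_iff by blast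
    then show "p > 0" unfolding p_def conj_parts[OF zero_less_Suc] .
  next
    assume p: "p > 0"
    show "part mu 0 = ?N"
    proof (rule ccontr)
      assume "part mu 0 \<noteq> ?N"
      then have lt: "part mu 0 < ?N" using mu0 by simp
      have "p = 0" unfolding p_def
      proof (rule conj_eq_0)
        fix x assume "x \<in> set mu"
        then show "x < ?N" using part_le_hd[OF mu(1)] lt by (meson le_less_trans)
      qed
      then show False using p by simp
    qed
  qed
  have A: "sk ?nu (tl mu) = tt ^ (((Suc k - p) choose 2) + E) * (qbinom k (p - 1) * R)" if hd: "part mu 0 = ?N"
  proof -
    obtain mt where mu_eq: "mu = ?N # mt" using hd by (cases mu) auto
    have tlp: "is_partition mt" using mu(1) by (simp add: mu_eq is_partition_def)
    have sub: "subpart mt ?nu"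
      unfolding subpart_def
    proof
      fix i
      have "part mu (Suc i) \<le> part ?la (Suc i)" using mu(2) unfolding subpart_def by blast
      then show "part mt i \<le> part ?nu i" by (simp add: mu_eq)
    qed
    \<comment> \<open>Deleting the common first row lowers both conjugates by one in these columns,
      so their differences stay the same.\<close>
    have c: "conj mu j = Suc (conj mt j)" "conj ?la j = Suc (conj ?nu j)" if "j \<le> ?N" for j
      using that by (simp_all add: mu_eq conj_Cons)
    have m: "mult mt j = mult mu j" if "j \<le> n" for j
      using that by (simp add: mu_eq mult_Cons)
    have mN: "mult mt ?N = p - 1" using multN by (simp add: mu_eq mult_Cons)
    have nuN: "conj ?nu ?N = k" using c(2)[of ?N] laN by simp
    have tN: "conj mt ?N = p - 1" using c(1)[of ?N] by (simp add: p_def)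
    have tN': "conj mt (Suc ?N) = 0" using z(2) by (simp add: mu_eq conj_Cons)
    have p: "p > 0" using hd hd_iff by simp
    have e: "(\<Sum>j\<in>{1..n}. (conj ?nu j - conj mt j) choose 2) = E"
      unfolding E_def by (intro sum.cong refl) (simp only: c atLeastAtMost_iff le_SucI diff_Suc_Suc)
    have r: "(\<Prod>j\<in>{1..n}. qbinom (conj ?nu j - conj mt (Suc j)) (mult mt j)) = R"
      unfolding R_def by (intro prod.cong refl) (simp only: c m atLeastAtMost_iff le_SucI Suc_le_mono diff_Suc_Suc)
    have nu0: "part ?nu 0 \<le> ?N"
      using ta_le by (cases k; cases ta) (auto simp: le_SucI)
    have kp: "k - (p - 1) = Suc k - p" using p pk by simp
    have "sk ?nu mt = tt ^ (((Suc k - p) choose 2) + E) * (qbinom k (p - 1) * R)"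
      unfolding sk_range[OF is_partition_blocks(1) tlp sub nu0] S1 P1 nuN tN tN' mN e r kp by simp
    then show ?thesis by (simp add: mu_eq)
  qed
  have sub_iff: "subpart mu (shrink k n ta) \<longleftrightarrow> p \<le> k"
    unfolding p_def by (rule subpart_shrink[OF mu])
  have B: "sk (shrink k n ta) mu = tt ^ (((k - p) choose 2) + E) * (qbinom k p * R)" if "p \<le> k"
  proof -
    have sub: "subpart mu (shrink k n ta)" using that sub_iff by simp
    have sN: "conj (shrink k n ta) ?N = k" using z(1) by (simp add: conj_shrink conj_replicate)
    have e: "(\<Sum>j\<in>{1..n}. (conj (shrink k n ta) j - conj mu j) choose 2) = E"
      unfolding E_def by (intro sum.cong refl) (simp add: conj_shrink)
    have r: "(\<Prod>j\<in>{1..n}. qbinom (conj (shrink k n ta) j - conj mu (Suc j)) (mult mu j)) = R"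
      unfolding R_def by (intro prod.cong refl) (simp add: conj_shrink)
    have s0: "part (shrink k n ta) 0 \<le> ?N" by (simp add: part_shrink)
    show ?thesis
      unfolding sk_range[OF is_partition_blocks(3) mu(1) sub s0] S1 P1 sN multN z p_def[symmetric] e r by simp
  qed
  show ?thesis
  proof (cases "p \<le> k")
    case True
    have s: "subpart mu (shrink k n ta)" using True sub_iff by simp
    have e: "((Suc k - p) choose 2) = (k - p) + ((k - p) choose 2)"
      using True by (simp add: Suc_diff_le Suc_choose_two)
    have t: "tt ^ k = tt ^ (k - p) * tt ^ p" using True by (simp flip: power_add)
    show ?thesis
    proof (cases p)
      case 0
      then have "part mu 0 \<noteq> ?N" using hd_iff by simp
      then show ?thesis unfolding la B[OF True] e using s 0 by (simp add: power_add mult_ac)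
    next
      case (Suc p')
      then have hd: "part mu 0 = ?N" using hd_iff by simp
      have q: "qbinom (Suc k) p = qbinom k (p - 1) + tt ^ p * qbinom k p"
        unfolding Suc by (simp only: qbinom_pascal diff_Suc_1)
      show ?thesis unfolding if_P[OF hd] if_P[OF s] la A[OF hd] B[OF True] e t q
        by (simp only: power_add ring_distribs mult_ac)
    qed
  next
    \<comment> \<open>Here \<open>p = Suc k\<close>: \<open>mu\<close> does not fit into the shrunk
      shape, and both remaining q-binomials are 1.\<close>
    case False
    then have "p = Suc k" using pk by simp
    moreover have "part mu 0 = ?N" using False hd_iff by simp
    ultimately show ?thesis unfolding la using A False sub_iff by simp
  qed
qed

lemma SD_head: "{mu \<in> SD (replicate (Suc k) (Suc n) @ ta) r. part mu 0 = Suc n} = (#) (Suc n) ` SD (replicate k (Suc n) @ ta) r"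
proof (intro equalityI subsetI)
  fix mu assume a: "mu \<in> {mu \<in> SD (replicate (Suc k) (Suc n) @ ta) r. part mu 0 = Suc n}"
  then have p: "is_partition mu" and s: "subpart mu (replicate (Suc k) (Suc n) @ ta)" and
    z: "psize (replicate (Suc k) (Suc n) @ ta) = psize mu + r" and h: "part mu 0 = Suc n" by (auto simp: SD_def)
  obtain mt where e: "mu = Suc n # mt" using h by (cases mu) auto
  have "is_partition mt" using p by (simp add: e is_partition_def)
  moreover have "part mt i \<le> part (replicate k (Suc n) @ ta) i" for i
    using s[unfolded subpart_def, rule_format, of "Suc i"] by (simp add: e)
  moreover have "psize (replicate k (Suc n) @ ta) = psize mt + r"
    using z by (simp add: e)
  ultimately show "mu \<in> (#) (Suc n) ` SD (replicate k (Suc n) @ ta) r"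
    using e by (intro image_eqI[of _ _ mt]) (simp_all add: SD_def subpart_def)
next
  fix mu assume "mu \<in> (#) (Suc n) ` SD (replicate k (Suc n) @ ta) r"
  then obtain nu where mu: "mu = Suc n # nu" and nu: "is_partition nu" "subpart nu (replicate k (Suc n) @ ta)"
    "psize (replicate k (Suc n) @ ta) = psize nu + r" by (auto simp: SD_def)
  have le: "x \<le> Suc n" if "x \<in> set nu" for x
  proof -
    have "part nu 0 \<le> part (replicate k (Suc n) @ ta) 0" using nu(2) by (simp add: subpart_def)
    also have "\<dots> \<le> Suc n" using ta_le by (cases k; cases ta) (auto simp: le_SucI)
    finally show ?thesis using part_le_hd[OF nu(1) that] by simp
  qed
  have "is_partition mu" using nu(1) le unfolding mu by (simp add: is_partition_def)
  moreover have "part mu i \<le> part (replicate (Suc k) (Suc n) @ ta) i" for i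
    using nu(2) unfolding mu subpart_def by (cases i) simp_all
  ultimately show "mu \<in> {mu \<in> SD (replicate (Suc k) (Suc n) @ ta) r. part mu 0 = Suc n}"
    using nu(3) mu by (simp add: SD_def subpart_def)
qed

text \<open>The shrunk shape has one box less, so for r = 0 nothing of the full size fits into
  it.\<close>

lemma SD_shrink: "{mu \<in> SD (replicate (Suc k) (Suc n) @ ta) r. subpart mu (shrink k n ta)} = (if r = 0 then {} else SD (shrink k n ta) (r - 1))"
proof -
  have "subpart (shrink k n ta) (replicate (Suc k) (Suc n) @ ta)"
    unfolding subpart_def part_shrink part_blocks by auto
  then have sub: "subpart mu (replicate (Suc k) (Suc n) @ ta)" if "subpart mu (shrink k n ta)" for mu
    using that by (auto simp: subpart_def intro: order_trans)
  show ?thesis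
  proof (cases r)
    case 0
    have "psize mu \<le> psize (shrink k n ta)" if "subpart mu (shrink k n ta)" for mu
      using that by (rule psize_mono)
    then have "\<not> subpart mu (shrink k n ta)" if "psize mu = Suc (psize (shrink k n ta))" for mu
      using that by (metis Suc_n_not_le_n)
    then show ?thesis using 0 unfolding SD_def psize_shrink[symmetric] by auto
  next
    case (Suc r')
    then show ?thesis using sub unfolding SD_def psize_shrink[symmetric] by auto
  qed
qed

text \<open>\<open>J n\<close> passes \<open>k\<close> operators \<open>J (Suc n)\<close>, each
  costing t. For n = 0 it then meets 1 and gives q_0 = 1, in accordance with the deleted
  row.\<close>

lemma J_shrink: "J n (QQ (replicate k (Suc n) @ ta)) = smul (tt ^ k) (QQ (shrink k n ta))"
  using ta_Nil unfolding shrink_def QQ_append_replicate J_straighten_pow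
  by (auto simp: jing_one)

end

lemma partition_block_cases:
  assumes "is_partition la"
  obtains "la = []" | k n ta where "la = replicate (Suc k) (Suc n) @ ta" "is_partition ta" "\<And>x. x \<in> set ta \<Longrightarrow> x \<le> n"
proof -
  have "la = [] \<or> (\<exists>k n ta. la = replicate (Suc k) (Suc n) @ ta \<and> is_partition ta \<and> (\<forall>x\<in>set ta. x \<le> n))"
    using assms
  proof (induction la rule: partition_block_induct)
    case (block k m la)
    then obtain k' where "k = Suc k'" using gr0_conv_Suc by blast
    then show ?case using block.hyps by blast
  qed simp
  then show ?thesis using that by blast
qed

text \<open>Only the first part is moved. The second term of the commutation rule lowers it to n,
  possibly out of order; \<open>J_shrink\<close> restores the order and gives a smaller shape that
  need not be a tail of \<open>la\<close>, hence the induction on size. \<open>sk_recursion\<close>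
  adds the two contributions.\<close>

lemma pieri_perp_hh_QQ:
  "is_partition la \<Longrightarrow> perp (hh (int r)) (QQ la) = (\<Sum>mu\<in>SD la r. smul (sk la mu) (QQ mu))"
proof (induction "psize la" arbitrary: la r rule: less_induct)
  case less
  show ?case
  proof (cases rule: partition_block_cases[OF less.prems])
    case 1
    have "SD [] r = (if r = 0 then {[]} else {})"
    proof -
      have "mu \<in> SD [] r \<longleftrightarrow> r = 0 \<and> mu = []" for mu
        using length_le_psize[of mu] by (auto simp: SD_def subpart_def)
      then show ?thesis by auto
    qed
    then show ?thesis by (simp add: 1 hh_def perp_nw_one sk_def part_def)
  next
    case (2 k n ta)
    let ?la = "replicate (Suc k) (Suc n) @ ta"
    let ?nu = "replicate k (Suc n) @ ta"
    let ?sh = "shrink k n ta"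
    note c = 2(2,3)
    have nu: "is_partition ?nu" and sh: "is_partition ?sh" by (rule is_partition_blocks[OF c], assumption)+
    have lt: "psize ?nu < psize la" "psize ?sh < psize la"
      using psize_shrink[OF c, of k] unfolding 2(1) by (simp, linarith)
    have "perp (hh (int r)) (QQ la) = J (Suc n) (perp (hh (int r)) (QQ ?nu)) + perp (hh (int r - 1)) (J n (QQ ?nu))"
      unfolding 2(1) replicate_Suc append_Cons QQ_simps by (rule perp_hh_J)
    also have "J (Suc n) (perp (hh (int r)) (QQ ?nu)) = (\<Sum>nu\<in>SD ?nu r. smul (sk ?nu nu) (QQ (Suc n # nu)))"
      unfolding less.hyps[OF lt(1) nu] J_sum by (simp add: jing_smul)
    also have "\<dots> = (\<Sum>mu\<in>(#) (Suc n) ` SD ?nu r. smul (sk ?nu (tl mu)) (QQ mu))"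
      by (subst sum.reindex) (auto simp: inj_on_def)
    also have "\<dots> = (\<Sum>mu\<in>{mu \<in> SD ?la r. part mu 0 = Suc n}. smul (sk ?nu (tl mu)) (QQ mu))"
      by (simp only: SD_head[OF c])
    also have "\<dots> = (\<Sum>mu\<in>SD ?la r. smul (if part mu 0 = Suc n then sk ?nu (tl mu) else 0) (QQ mu))"
      by (rule sum.mono_neutral_cong_left) auto
    also have "perp (hh (int r - 1)) (J n (QQ ?nu)) = (\<Sum>mu\<in>(if r = 0 then {} else SD ?sh (r - 1)). smul (tt ^ k * sk ?sh mu) (QQ mu))"
    proof (cases r)
      case (Suc r')
      have e: "int r - 1 = int r'" using Suc by simp
      have js: "J n (QQ ?nu) = smul (tt ^ k) (QQ ?sh)" by (rule J_shrink[OF c])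
      show ?thesis unfolding js perp_smul_right e less.hyps[OF lt(2) sh] sym.scale_sum_right
        using Suc by simp
    qed simp
    also have "\<dots> = (\<Sum>mu\<in>{mu \<in> SD ?la r. subpart mu ?sh}. smul (tt ^ k * sk ?sh mu) (QQ mu))"
      by (simp only: SD_shrink[OF c])
    also have "\<dots> = (\<Sum>mu\<in>SD ?la r. smul (if subpart mu ?sh then tt ^ k * sk ?sh mu else 0) (QQ mu))"
      by (rule sum.mono_neutral_cong_left) auto
    also have "(\<Sum>mu\<in>SD ?la r. smul (if part mu 0 = Suc n then sk ?nu (tl mu) else 0) (QQ mu)) + \<dots> =
       (\<Sum>mu\<in>SD ?la r. smul (sk ?la mu) (QQ mu))"
      unfolding sum.distrib[symmetric] sym.scale_left_distrib[symmetric]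
      by (intro sum.cong refl arg_cong2[where f = smul] sk_recursion[OF c, symmetric]) (auto simp: SD_def)
    finally show ?thesis unfolding 2(1) .
  qed
qed

section \<open>The skew Pieri rule\<close>

lemma bfun_range:
  assumes "is_partition la" "part la 0 \<le> n"
  shows "bfun la = (\<Prod>j\<in>{1..n}. phi (mult la j))"
proof -
  have "mult la j = 0" if "j > part la 0" for j
    by (rule mult_eq_0) (use part_le_hd[OF assms(1), of j] that in auto)
  then show ?thesis unfolding bfun_def phi_def[symmetric]
    by (intro prod.mono_neutral_left) (use assms(2) in auto)
qed

text \<open>Both sides of the last equation are la'_j - ka'_(j+1), the number of rows of length j
  that receive no box.\<close>

lemma strip_conj_bounds:
  assumes "vertical_strip ka la" "j > 0"
  shows "conj la j \<le> conj ka j" "conj ka (Suc j) \<le> conj la j" "conj ka j - conj la j \<le> mult ka j"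
    "conj ka (Suc j) - conj la (Suc j) \<le> mult la j"
    "mult ka j - (conj ka j - conj la j) = mult la j - (conj ka (Suc j) - conj la (Suc j))"
proof -
  have s: "subpart la ka" using assms(1) by (simp add: vertical_strip_def)
  show a: "conj la j \<le> conj ka j" using conj_mono[OF s assms(2)] .
  have b: "conj la (Suc j) \<le> conj ka (Suc j)" using conj_mono[OF s] by simp
  show c: "conj ka (Suc j) \<le> conj la j" by (rule conj_vertical_strip[OF assms])
  show "conj ka j - conj la j \<le> mult ka j" "conj ka (Suc j) - conj la (Suc j) \<le> mult la j"
    "mult ka j - (conj ka j - conj la j) = mult la j - (conj ka (Suc j) - conj la (Suc j))"
    using a b c conj_mult[of ka j] conj_mult[of la j] by linarith+
qed

text \<open>Written with \<open>phi\<close>, \<open>vs\<close> has \<open>phi (d j)\<close> where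
  \<open>cU\<close> has \<open>phi (d (Suc j))\<close>. The index shift leaves
  \<open>phi (d 1)\<close>, the denominator of \<open>cU\<close>, since \<open>d\<close> vanishes
  beyond the largest part; multiplicities give the two b-factors.\<close>

lemma vs_cU:
  assumes "is_partition la" "is_partition ka" "vertical_strip ka la"
  shows "vs ka la = cU ka la * bfun ka / bfun la"
proof -
  define n where "n = part la 0 + part ka 0"
  define d where "d j = conj ka j - conj la j" for j
  have n: "part la 0 \<le> n" "part ka 0 \<le> n" by (simp_all add: n_def)
  note b = strip_conj_bounds[OF assms(3)]
  have "conj ka (Suc n) = 0"
    by (rule conj_eq_0) (use part_le_hd[OF assms(2)] n in fastforce)
  then have dn: "d (Suc n) = 0" by (simp add: d_def)
  have tel: "(\<Prod>j\<in>{1..n}. phi (d j)) = phi (d 1) * (\<Prod>j\<in>{1..n}. phi (d (Suc j)))"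
  proof -
    have "(\<Prod>j\<in>{1..Suc n}. phi (d j)) = phi (d 1) * (\<Prod>j\<in>{Suc 1..Suc n}. phi (d j))"
      by (rule prod.atLeast_Suc_atMost) simp
    also have "(\<Prod>j\<in>{Suc 1..Suc n}. phi (d j)) = (\<Prod>j\<in>{1..n}. phi (d (Suc j)))"
      by (rule prod.shift_bounds_cl_Suc_ivl)
    finally show ?thesis by (simp add: prod.nat_ivl_Suc' dn)
  qed
  have "vs ka la = (\<Prod>j\<in>{1..n}. qbinom (mult ka j) (d j))"
    unfolding d_def by (rule vs_range) (use assms n in auto)
  also have "\<dots> = (\<Prod>j\<in>{1..n}. phi (mult ka j) / (phi (d j) * phi (mult ka j - d j)))"
    by (intro prod.cong refl qbinom_phi) (simp add: d_def b(3))
  also have "\<dots> = bfun ka / ((\<Prod>j\<in>{1..n}. phi (d j)) * (\<Prod>j\<in>{1..n}. phi (mult la j - d (Suc j))))"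
    unfolding bfun_range[OF assms(2) n(2)] prod_dividef prod.distrib
    by (intro arg_cong2[where f = "(/)"] arg_cong2[where f = "(*)"] prod.cong refl) (simp add: d_def b(5))
  finally have v: "vs ka la = bfun ka / (phi (d 1) * (\<Prod>j\<in>{1..n}. phi (d (Suc j))) * (\<Prod>j\<in>{1..n}. phi (mult la j - d (Suc j))))"
    unfolding tel .
  have "cU ka la = (\<Prod>j\<in>{1..n}. qbinom (mult la j) (d (Suc j))) / phi (d 1)"
    unfolding d_def by (rule cU_range) (use assms n in auto)
  also have "(\<Prod>j\<in>{1..n}. qbinom (mult la j) (d (Suc j))) = (\<Prod>j\<in>{1..n}. phi (mult la j) / (phi (d (Suc j)) * phi (mult la j - d (Suc j))))"
    by (intro prod.cong refl qbinom_phi) (simp add: d_def b(4))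
  also have "\<dots> = bfun la / ((\<Prod>j\<in>{1..n}. phi (d (Suc j))) * (\<Prod>j\<in>{1..n}. phi (mult la j - d (Suc j))))"
    unfolding bfun_range[OF assms(1) n(1)] prod_dividef prod.distrib ..
  finally show ?thesis unfolding v by (simp add: mult_ac)
qed

lemma pieri_ee_HLP:
  assumes "is_partition la"
  shows "ee (int r) * HLP la = (\<Sum>ka\<in>VU la r. smul (vs ka la) (HLP ka))"
proof -
  have "ee (int r) * HLP la = (\<Sum>ka\<in>VU la r. smul (cU ka la / bfun la) (QQ ka))"
    unfolding HLP_QQ[OF assms] smul_mult_right pieri_ee_QQ[OF assms] sym.scale_sum_right
    by simp
  also have "\<dots> = (\<Sum>ka\<in>VU la r. smul (vs ka la) (HLP ka))"
    by (intro sum.cong refl) (auto simp: VU_def HLP_QQ vs_cU assms)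
  finally show ?thesis .
qed

section \<open>Spanning by the Q_nu and the skew functions\<close>

lemma perp_ee_annihilates:
  assumes "\<And>nu. is_partition nu \<Longrightarrow> hall f (QQ nu) = 0" "is_partition nu"
  shows "hall (perp (ee (int r)) f) (QQ nu) = 0"
proof -
  have "hall (perp (ee (int r)) f) (QQ nu) = (\<Sum>ka\<in>VU nu r. cU ka nu * hall f (QQ ka))"
    by (simp only: hall_perp pieri_ee_QQ[OF assms(2)] hall_sum_right hall_smul_right)
  also have "\<dots> = 0"
  proof (intro sum.neutral ballI)
    fix ka assume "ka \<in> VU nu r"
    then have "hall f (QQ ka) = 0" by (intro assms(1)) (simp add: VU_def)
    then show "cU ka nu * hall f (QQ ka) = 0" by simp
  qed
  finally show ?thesis .
qed

text \<open>The orthogonal complement of the Q_nu is stable under the adjoints of all e_r. Newton's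
  identity, whose top term has coefficient 1 or -1, transfers this to the adjoints of the power
  sums.\<close>

lemma pd_annihilates:
  assumes "\<And>nu. is_partition nu \<Longrightarrow> hall f (QQ nu) = 0" "is_partition nu"
  shows "hall (pd n f) (QQ nu) = 0"
  using assms
proof (induction n arbitrary: f nu rule: less_induct)
  case (less n)
  have "smul (of_int (int (Suc n))) (perp (ee (int (Suc n))) f) =
     (\<Sum>k<Suc n. smul ((-1) ^ k) (pd k (perp (ee (int (Suc n) - 1 - int k)) f)))"
    unfolding ee_def by (rule perp_nw_newton) simp
  then have "of_int (int (Suc n)) * hall (perp (ee (int (Suc n))) f) (QQ nu) =
     (\<Sum>k<Suc n. (-1) ^ k * hall (pd k (perp (ee (int (Suc n) - 1 - int k)) f)) (QQ nu))"
    by (simp only: hall_smul_left[symmetric] hall_sum_left[symmetric])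
  moreover have "hall (perp (ee (int (Suc n))) f) (QQ nu) = 0"
    by (rule perp_ee_annihilates[OF less.prems])
  moreover have "hall (pd k (perp (ee (int (Suc n) - 1 - int k)) f)) (QQ nu) = 0" if k: "k < n" for k
  proof -
    have e: "int (Suc n) - 1 - int k = int (n - k)" using k by (simp add: of_nat_diff)
    show ?thesis unfolding e
      by (rule less.IH[OF k]) (use perp_ee_annihilates[OF less.prems(1)] less.prems(2) in blast)+
  qed
  ultimately have "(-1) ^ n * hall (pd n f) (QQ nu) = 0"
    by simp
  then show ?case by simp
qed

text \<open>The orthogonal complement is stable under every \<open>pd n\<close> and orthogonal to 1
  = \<open>QQ []\<close>, hence to all monomials in the power sums.\<close>

lemma QQ_spanning:
  assumes "\<And>nu. is_partition nu \<Longrightarrow> hall f (QQ nu) = 0"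
  shows "f = 0"
proof (rule hall_eqI)
  fix h
  have "hall h f = 0" using assms
  proof (induction h arbitrary: f rule: sym_induct)
    case one
    then show ?case using one[of "[]"] by (simp add: hall_sym)
  next
    case (psum k h)
    have "hall h (pd k f) = 0" by (rule psum.IH) (rule pd_annihilates[OF psum.prems])
    then show ?case by (simp add: hall_psum)
  qed (simp_all add: hall_add_left hall_smul_left)
  then show "hall f h = hall 0 h" by (simp add: hall_sym)
qed

lemma skewP_perp:
  assumes "is_partition la" "is_partition mu"
  shows "skewP la mu = perp (QQ mu) (HLP la)"
  unfolding skewP_def
proof (rule the_equality)
  show "\<forall>nu. is_partition nu \<longrightarrow> hall (perp (QQ mu) (HLP la)) (HLQ nu) = hall (HLP la) (HLQ nu * HLQ mu)"
    using assms by (simp add: HLQ_QQ hall_perp mult.commute)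
  fix f assume f: "\<forall>nu. is_partition nu \<longrightarrow> hall f (HLQ nu) = hall (HLP la) (HLQ nu * HLQ mu)"
  have "f - perp (QQ mu) (HLP la) = 0"
  proof (rule QQ_spanning)
    fix nu assume "is_partition nu"
    then show "hall (f - perp (QQ mu) (HLP la)) (QQ nu) = 0"
      using f assms by (simp add: hall_diff HLQ_QQ hall_perp mult.commute)
  qed
  then show "f = perp (QQ mu) (HLP la)" by simp
qed

section \<open>Interchange of e_r with an adjoint\<close>

lemma perp_ee_product:
  "perp (ee (int r)) (f * g) = (\<Sum>j\<le>r. perp (ee (int j)) f * perp (ee (int (r - j))) g)"
proof -
  have "perp (ee (int r)) (f * g) = (\<Sum>j=0..int r. perp (ee j) f * perp (ee (int r - j)) g)"
    unfolding ee_def by (rule perp_nw_mult)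
  also have "\<dots> = (\<Sum>j\<le>r. perp (ee (int j)) f * perp (ee (int (r - j))) g)"
    by (rule sum.reindex_bij_witness[of _ int nat]) (auto simp: nat_diff_distrib of_nat_diff)
  finally show ?thesis .
qed

text \<open>By the Leibniz rule for \<open>perp (ee r)\<close>, and since the signed \<open>hh k\<close> invert the \<open>ee j\<close>.\<close>
lemma times_perp_ee:
  "f * perp (ee (int r)) h = (\<Sum>k\<le>r. smul ((-1) ^ k) (perp (ee (int (r - k))) (perp (hh (int k)) f * h)))"
proof -
  define F where "F k j = smul ((-1) ^ k) (perp (ee (int j)) (perp (hh (int k)) f) * perp (ee (int (r - (k + j)))) h)" for k j
  have "(\<Sum>k\<le>r. smul ((-1) ^ k) (perp (ee (int (r - k))) (perp (hh (int k)) f * h))) = (\<Sum>k\<le>r. \<Sum>j\<le>r - k. F k j)"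
    unfolding perp_ee_product F_def sym.scale_sum_right by (intro sum.cong refl) (simp only: diff_diff_eq)
  also have "\<dots> = (\<Sum>(k, j)\<in>(SIGMA k:{..r}. {..r - k}). F k j)"
    by (rule sum.Sigma) auto
  also have "(SIGMA k:{..r}. {..r - k}) = {(k, j). k + j \<le> r}" by auto
  \<comment> \<open>Collecting by s = k + j turns the inner sum into the convolution
    \<open>ee_hh\<close>, which survives only for s = 0.\<close>
  also have "(\<Sum>(k, j)\<in>{(k, j). k + j \<le> r}. F k j) = (\<Sum>s\<le>r. \<Sum>k\<le>s. F k (s - k))"
    by (rule sum.triangle_reindex_eq)
  also have "\<dots> = (\<Sum>s\<le>r. if s = 0 then f * perp (ee (int r)) h else 0)"
  proof (rule sum.cong[OF refl])
    fix s
    have "(\<Sum>k\<le>s. F k (s - k)) = (\<Sum>k\<le>s. perp (smul ((-1) ^ k) (hh (int k)) * ee (int (s - k))) f) * perp (ee (int (r - s))) h"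
      unfolding sum_distrib_right F_def
      by (intro sum.cong refl) (simp add: perp_mult perp_comm[of "ee _"] perp_smul_left smul_mult_left)
    also have "\<dots> = (if s = 0 then f * perp (ee (int r)) h else 0)"
      unfolding perp_sum_left[symmetric] ee_hh by auto
    finally show "(\<Sum>k\<le>s. F k (s - k)) = (if s = 0 then f * perp (ee (int r)) h else 0)" .
  qed
  finally show ?thesis by simp
qed

text \<open>Pairing with an arbitrary \<open>h\<close> reduces this to \<open>times_perp_ee\<close>,
  with e_r and \<open>f\<close> moved across the scalar product.\<close>

lemma perp_times_ee:
  "perp f g * ee (int r) = (\<Sum>k\<le>r. smul ((-1) ^ k) (perp (perp (hh (int k)) f) (ee (int (r - k)) * g)))"
proof (rule hall_eqI)
  fix h
  have "hall (perp f g * ee (int r)) h = hall (perp f g) (perp (ee (int r)) h)"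
    by (simp add: hall_perp_right mult.commute)
  also have "\<dots> = hall g (f * perp (ee (int r)) h)" by (rule hall_perp)
  also have "\<dots> = (\<Sum>k\<le>r. (-1) ^ k * hall (ee (int (r - k)) * g) (perp (hh (int k)) f * h))"
    unfolding times_perp_ee by (simp add: hall_sum_right hall_smul_right hall_perp_right)
  also have "\<dots> = hall (\<Sum>k\<le>r. smul ((-1) ^ k) (perp (perp (hh (int k)) f) (ee (int (r - k)) * g))) h"
    by (simp add: hall_sum_left hall_smul_left hall_perp)
  finally show "hall (perp f g * ee (int r)) h =
    hall (\<Sum>k\<le>r. smul ((-1) ^ k) (perp (perp (hh (int k)) f) (ee (int (r - k)) * g))) h" .
qed

lemma skew_pieri:
  assumes la: "is_partition la" and mu: "is_partition mu"
  shows "skewP la mu * ee (int r) =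
    (\<Sum>(lp, mm) \<in> {(lp, mm). is_partition lp \<and> is_partition mm \<and> subpart la lp \<and> subpart mm mu \<and>
                              (psize lp - psize la) + (psize mu - psize mm) = r}.
       smul ((-1) ^ (psize mu - psize mm) * vs lp la * sk mu mm) (skewP lp mm))"
proof -
  define g where "g lp mm = smul ((-1) ^ (psize mu - psize mm) * vs lp la * sk mu mm) (skewP lp mm)" for lp mm
  let ?T = "{(lp, mm). is_partition lp \<and> is_partition mm \<and> subpart la lp \<and> subpart mm mu \<and>
                              (psize lp - psize la) + (psize mu - psize mm) = r}"
  \<comment> \<open>The expansion is graded by the number \<open>k\<close> of boxes removed from
    \<open>mu\<close>. The pair determines \<open>k\<close>, so \<open>snd\<close> is injective
    here.\<close>
  let ?V = "SIGMA k:{..r}. VU la (r - k) \<times> SD mu k"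
  have fin: "finite ?T"
  proof (rule finite_subset)
    show "?T \<subseteq> {lp. is_partition lp \<and> psize lp \<le> psize la + r} \<times> {mm. is_partition mm \<and> psize mm \<le> psize mu}"
      by (auto dest!: psize_mono)
  qed (simp add: finite_partitions)
  have "skewP la mu * ee (int r) = (\<Sum>k\<le>r. smul ((-1) ^ k) (perp (\<Sum>mm\<in>SD mu k. smul (sk mu mm) (QQ mm)) (\<Sum>lp\<in>VU la (r - k). smul (vs lp la) (HLP lp))))"
    unfolding skewP_perp[OF la mu] perp_times_ee pieri_perp_hh_QQ[OF mu] pieri_ee_HLP[OF la] ..
  also have "\<dots> = (\<Sum>k\<le>r. \<Sum>(lp, mm)\<in>VU la (r - k) \<times> SD mu k. g lp mm)"
  proof (rule sum.cong[OF refl])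
    fix k
    have "smul ((-1) ^ k) (perp (\<Sum>mm\<in>SD mu k. smul (sk mu mm) (QQ mm)) (\<Sum>lp\<in>VU la (r - k). smul (vs lp la) (HLP lp))) =
      (\<Sum>lp\<in>VU la (r - k). \<Sum>mm\<in>SD mu k. smul ((-1) ^ k * vs lp la * sk mu mm) (perp (QQ mm) (HLP lp)))"
      by (simp add: perp_sum_left perp_sum_right perp_smul_left perp_smul_right sym.scale_sum_right mult_ac)
    also have "\<dots> = (\<Sum>lp\<in>VU la (r - k). \<Sum>mm\<in>SD mu k. g lp mm)"
      by (intro sum.cong refl) (auto simp: g_def VU_def SD_def skewP_perp)
    finally show "smul ((-1) ^ k) (perp (\<Sum>mm\<in>SD mu k. smul (sk mu mm) (QQ mm)) (\<Sum>lp\<in>VU la (r - k). smul (vs lp la) (HLP lp))) =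
      (\<Sum>(lp, mm)\<in>VU la (r - k) \<times> SD mu k. g lp mm)"
      by (simp add: sum.cartesian_product)
  qed
  also have "\<dots> = (\<Sum>(k, lp, mm)\<in>?V. g lp mm)"
    by (subst sum.Sigma) (auto simp: case_prod_unfold)
  also have "\<dots> = (\<Sum>(lp, mm)\<in>snd ` ?V. g lp mm)"
  proof -
    have "inj_on snd ?V" by (auto simp: inj_on_def SD_def)
    then show ?thesis by (subst sum.reindex) (auto simp: case_prod_unfold)
  qed
  also have "\<dots> = (\<Sum>(lp, mm)\<in>?T. g lp mm)"
  proof (rule sum.mono_neutral_left[OF fin])
    show "snd ` ?V \<subseteq> ?T"
      by (auto simp: VU_def SD_def vertical_strip_def)
    show "\<forall>p\<in>?T - snd ` ?V. (case p of (lp, mm) \<Rightarrow> g lp mm) = 0"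
    proof
      fix x assume "x \<in> ?T - snd ` ?V"
      then obtain lp mm where x: "x = (lp, mm)"
        and p: "is_partition lp" "is_partition mm" "subpart la lp" "subpart mm mu"
        and r: "r = psize lp - psize la + (psize mu - psize mm)" and n: "(lp, mm) \<notin> snd ` ?V"
        by auto
      \<comment> \<open>By containment the truncated subtractions in \<open>?T\<close> are true
        differences. So a pair outside the image can only fail to be a vertical strip, where
        \<open>vs\<close> is 0.\<close>
      have s: "psize la \<le> psize lp" "psize mm \<le> psize mu" using p psize_mono by auto
      have "\<not> vertical_strip lp la"
      proof
        assume v: "vertical_strip lp la"
        have "(psize mu - psize mm, lp, mm) \<in> ?V"
          using p v s r by (auto simp: VU_def SD_def)
        from imageI[OF this, of snd] show False using n by simp
      qed
      then show "(case x of (lp, mm) \<Rightarrow> g lp mm) = 0" by (simp add: x g_def vs_def)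
    qed
  qed
  finally show ?thesis by (simp add: g_def)
qed

theorem theorem2:
  fixes la mu :: "nat list" and r :: nat
  assumes "is_partition la" and "is_partition mu" and "subpart mu la"
  shows "skewP la mu * schur (replicate r 1) = skewP la mu * elem r
       \<and> skewP la mu * elem r = skewP la mu * HLP (replicate r 1)
       \<and> skewP la mu * HLP (replicate r 1) =
         (\<Sum>(lp, mm) \<in> {(lp, mm). is_partition lp \<and> is_partition mm \<and>
                                   subpart la lp \<and> subpart mm mu \<and>
                                   (psize lp - psize la) + (psize mu - psize mm) = r}.
            smul ((-1) ^ (psize mu - psize mm) * vs lp la * sk mu mm) (skewP lp mm))"
  unfolding schur_ones HLP_ones elem_ee by (intro conjI refl skew_pieri assms(1,2))

end
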